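(* Let $R$ be a Dedekind domain, let $\mathcal A$ be a fully additive hom-finite $R$-category, and let $A,B$ be objects of $\mathcal A$. (1) If $A_{\mathfrak p}$ is isomorphic to a direct summand of $B_{\mathfrak p}$ for all $\mathfrak p\in\max R$, then there is an object $A'\in G(A)$ that is a direct summand of $B$. (2) (Roiter addition theorem) Let $QA\in\operatorname{add}QB$ and $A'\in G(A)$. Then there is an object $B'\in G(B)$ such that $A\oplus B\simeq A'\oplus B'$. (3) If $A'\in G(A)$, then $A'$ is a direct summand of $A\oplus A$. (4) Let $A',A''\in G(A)$. Then there is $A'''\in G(A)$ such that $A'\oplus A''\simeq A\oplus A'''$.
   Context: All categories are small and preadditive. A category is fully additive if it is additive and every idempotent endomorphism splits. An $R$-category is a category whose Hom sets $\mathcal A(A,B)$ are $R$-modules with $R$-bilinear composition; it is hom-finite if all $\mathcal A(A,B)$ are finitely generated $R$-modules. Let $R$ be a Dedekind domain with field of fractions $K$ and $\max R$ its set of maximal ideals. For a commutative $R$-algebra $S$, $S\otimes_R\mathcal A$ is the category with the same objects as $\mathcal A$ and morphisms $S\otimes_R\mathcal A(A,B)$. For a preadditive category $\mathcal C$, $\operatorname{add}\mathcal C$ is the (unique up to equivalence) fully additive category containing $\mathcal C$ as a full subcategory in which every object is a direct summand of a finite direct sum of objects of $\mathcal C$. For an object $X$ of a fully additive category, $\operatorname{add}X$ is the full subcategory of direct summands of finite direct sums of copies of $X$. Put $Q\mathcal A=\operatorname{add}(K\otimes_R\mathcal A)$ and $\mathcal A_{\mathfrak p}=\operatorname{add}(R_{\mathfrak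 p}\otimes_R\mathcal A)$; $QA$ and $A_{\mathfrak p}$ denote the object $A$ of $\mathcal A$ regarded in these categories. The genus of $A$ is $G(A)=\{B\in\operatorname{ob}\mathcal A\mid B_{\mathfrak p}\simeq A_{\mathfrak p}\text{ for all }\mathfrak p\in\max R\}$. *)

theory Defs
  imports "HOL-Algebra.Algebra"
begin

section \<open>Localization and Dedekind domains\<close>

text \<open>\<open>fraction R S a s\<close> is the fraction \<open>a/s\<close> in \<open>S\<^sup>-\<^sup>1R\<close>, i.e.\ the class of \<open>(a, s)\<close> under
  \<open>(a, s) \<sim> (b, t) \<longleftrightarrow> u(at - bs) = 0\<close> for some \<open>u \<in> S\<close>.\<close>

definition fraction :: "('r, 'x) ring_scheme \<Rightarrow> 'r set \<Rightarrow> 'r \<Rightarrow> 'r \<Rightarrow> ('r \<times> 'r) set" where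
  "fraction R S a s = {(b, t). b \<in> carrier R \<and> t \<in> S \<and>
     (\<exists>u\<in>S. u \<otimes>\<^bsub>R\<^esub> (a \<otimes>\<^bsub>R\<^esub> t \<ominus>\<^bsub>R\<^esub> b \<otimes>\<^bsub>R\<^esub> s) = \<zero>\<^bsub>R\<^esub>)}"

definition localization :: "('r, 'x) ring_scheme \<Rightarrow> 'r set \<Rightarrow> ('r, ('r \<times> 'r) set) module" where
  "localization R S =
    \<lparr>carrier = {fraction R S a s | a s. a \<in> carrier R \<and> s \<in> S},
     monoid.mult = (\<lambda>U V. \<Union>(a, s)\<in>U. \<Union>(b, t)\<in>V. fraction R S (a \<otimes>\<^bsub>R\<^esub> b) (s \<otimes>\<^bsub>R\<^esub> t)),
     monoid.one = fraction R S \<one>\<^bsub>R\<^esub> \<one>\<^bsub>R\<^esub>,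
     ring.zero = fraction R S \<zero>\<^bsub>R\<^esub> \<one>\<^bsub>R\<^esub>,
     ring.add = (\<lambda>U V. \<Union>(a, s)\<in>U. \<Union>(b, t)\<in>V.
       fraction R S (a \<otimes>\<^bsub>R\<^esub> t \<oplus>\<^bsub>R\<^esub> b \<otimes>\<^bsub>R\<^esub> s) (s \<otimes>\<^bsub>R\<^esub> t)),
     smult = (\<lambda>r U. \<Union>(a, s)\<in>U. fraction R S (r \<otimes>\<^bsub>R\<^esub> a) s)\<rparr>"

definition fraction_field :: "('r, 'x) ring_scheme \<Rightarrow> ('r, ('r \<times> 'r) set) module" where
  "fraction_field R = localization R (carrier R - {\<zero>\<^bsub>R\<^esub>})"

definition integral_over_base :: "('r, 'x) ring_scheme \<Rightarrow> ('r, 's, 'y) module_scheme \<Rightarrow> 's \<Rightarrow> bool" where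
  "integral_over_base R S x \<longleftrightarrow>
    (\<exists>p. p \<noteq> [] \<and> set p \<subseteq> (\<lambda>a. a \<odot>\<^bsub>S\<^esub> \<one>\<^bsub>S\<^esub>) ` carrier R \<and> lead_coeff p = \<one>\<^bsub>S\<^esub> \<and>
         ring.eval S p x = \<zero>\<^bsub>S\<^esub>)"

text \<open>Fields are not excluded: a field is a Dedekind domain (with \<open>{0}\<close> as its maximal ideal).\<close>

locale dedekind_domain = noetherian_domain +
  assumes integrally_closed:
      "x \<in> carrier (fraction_field R) \<Longrightarrow> integral_over_base R (fraction_field R) x \<Longrightarrow>
       \<exists>a\<in>carrier R. x = a \<odot>\<^bsub>fraction_field R\<^esub> \<one>\<^bsub>fraction_field R\<^esub>"
    and nonzero_prime_maximal: "primeideal P R \<Longrightarrow> P \<noteq> {\<zero>} \<Longrightarrow> maximalideal P R"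


section \<open>Preadditive categories and R-categories\<close>

text \<open>\<open>Comp C A B D g f\<close> is \<open>g \<circ> f\<close> for \<open>f : A \<rightarrow> B\<close> and \<open>g : B \<rightarrow> D\<close>. Hom sets of different pairs
  of objects need not be disjoint, hence the object arguments. Only the additive group and the
  scalar multiplication of a Hom set are meaningful (the record type \<open>module\<close> extends
  \<open>ring\<close>); for a merely preadditive category the scalar multiplication is not used either.\<close>

record ('o, 'r, 'm) category =
  Obj :: "'o set"
  Hom :: "'o \<Rightarrow> 'o \<Rightarrow> ('r, 'm) module"
  Comp :: "'o \<Rightarrow> 'o \<Rightarrow> 'o \<Rightarrow> 'm \<Rightarrow> 'm \<Rightarrow> 'm"
  Ident :: "'o \<Rightarrow> 'm"

abbreviation Mor :: "('o, 'r, 'm) category \<Rightarrow> 'o \<Rightarrow> 'o \<Rightarrow> 'm set" where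
  "Mor C A B \<equiv> carrier (Hom C A B)"

locale preadditive_category =
  fixes C :: "('o, 'r, 'm) category"
  assumes hom_abelian_group:
      "A \<in> Obj C \<Longrightarrow> B \<in> Obj C \<Longrightarrow> abelian_group (Hom C A B)"
    and comp_closed:
      "\<lbrakk>A \<in> Obj C; B \<in> Obj C; D \<in> Obj C; f \<in> Mor C A B; g \<in> Mor C B D\<rbrakk> \<Longrightarrow>
       Comp C A B D g f \<in> Mor C A D"
    and comp_assoc:
      "\<lbrakk>A \<in> Obj C; B \<in> Obj C; D \<in> Obj C; E \<in> Obj C;
        f \<in> Mor C A B; g \<in> Mor C B D; h \<in> Mor C D E\<rbrakk> \<Longrightarrow>
       Comp C A D E h (Comp C A B D g f) = Comp C A B E (Comp C B D E h g) f"
    and ident_closed: "A \<in> Obj C \<Longrightarrow> Ident C A \<in> Mor C A A"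
    and comp_ident_left:
      "\<lbrakk>A \<in> Obj C; B \<in> Obj C; f \<in> Mor C A B\<rbrakk> \<Longrightarrow> Comp C A B B (Ident C B) f = f"
    and comp_ident_right:
      "\<lbrakk>A \<in> Obj C; B \<in> Obj C; f \<in> Mor C A B\<rbrakk> \<Longrightarrow> Comp C A A B f (Ident C A) = f"
    and comp_add_left:
      "\<lbrakk>A \<in> Obj C; B \<in> Obj C; D \<in> Obj C; f \<in> Mor C A B; g \<in> Mor C B D; g' \<in> Mor C B D\<rbrakk> \<Longrightarrow>
       Comp C A B D (g \<oplus>\<^bsub>Hom C B D\<^esub> g') f
         = Comp C A B D g f \<oplus>\<^bsub>Hom C A D\<^esub> Comp C A B D g' f"
    and comp_add_right:
      "\<lbrakk>A \<in> Obj C; B \<in> Obj C; D \<in> Obj C; f \<in> Mor C A B; f' \<in> Mor C A B; g \<in> Mor C B D\<rbrakk> \<Longrightarrow>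
       Comp C A B D g (f \<oplus>\<^bsub>Hom C A B\<^esub> f')
         = Comp C A B D g f \<oplus>\<^bsub>Hom C A D\<^esub> Comp C A B D g f'"

locale R_category = preadditive_category C + cring R
  for R :: "('r, 'x) ring_scheme" and C :: "('o, 'r, 'm) category" +
  assumes hom_module: "A \<in> Obj C \<Longrightarrow> B \<in> Obj C \<Longrightarrow> module R (Hom C A B)"
    and comp_smult_left:
      "\<lbrakk>A \<in> Obj C; B \<in> Obj C; D \<in> Obj C; r \<in> carrier R; f \<in> Mor C A B; g \<in> Mor C B D\<rbrakk> \<Longrightarrow>
       Comp C A B D (r \<odot>\<^bsub>Hom C B D\<^esub> g) f = r \<odot>\<^bsub>Hom C A D\<^esub> Comp C A B D g f"
    and comp_smult_right:
      "\<lbrakk>A \<in> Obj C; B \<in> Obj C; D \<in> Obj C; r \<in> carrier R; f \<in> Mor C A B; g \<in> Mor C B D\<rbrakk> \<Longrightarrow>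
       Comp C A B D g (r \<odot>\<^bsub>Hom C A B\<^esub> f) = r \<odot>\<^bsub>Hom C A D\<^esub> Comp C A B D g f"

definition finitely_generated_module :: "('r, 'x) ring_scheme \<Rightarrow> ('r, 'm, 'y) module_scheme \<Rightarrow> bool" where
  "finitely_generated_module R M \<longleftrightarrow>
    (\<exists>G. finite G \<and> G \<subseteq> carrier M \<and>
      (\<forall>x\<in>carrier M. \<exists>c\<in>G \<rightarrow> carrier R. x = (\<Oplus>\<^bsub>M\<^esub>g\<in>G. c g \<odot>\<^bsub>M\<^esub> g)))"

locale hom_finite_R_category = R_category +
  assumes hom_finite: "A \<in> Obj C \<Longrightarrow> B \<in> Obj C \<Longrightarrow> finitely_generated_module R (Hom C A B)"


section \<open>Direct sums, summands, full additivity\<close>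

definition isomorphic_objs :: "('o, 'r, 'm) category \<Rightarrow> 'o \<Rightarrow> 'o \<Rightarrow> bool" where
  "isomorphic_objs C A B \<longleftrightarrow> A \<in> Obj C \<and> B \<in> Obj C \<and>
    (\<exists>f\<in>Mor C A B. \<exists>g\<in>Mor C B A.
      Comp C A B A g f = Ident C A \<and> Comp C B A B f g = Ident C B)"

text \<open>The object \<open>S\<close> is a direct sum (biproduct) of the list \<open>As\<close>, with injections \<open>\<iota>\<close> and projections
  \<open>\<pi>\<close>. For \<open>As = []\<close> this says that \<open>S\<close> is a zero object.\<close>

definition is_direct_sum :: "('o, 'r, 'm) category \<Rightarrow> 'o list \<Rightarrow> 'o \<Rightarrow> bool" where
  "is_direct_sum C As S \<longleftrightarrow> set As \<subseteq> Obj C \<and> S \<in> Obj C \<and>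
    (\<exists>\<iota> \<pi>.
      (\<forall>i<length As. \<iota> i \<in> Mor C (As ! i) S \<and> \<pi> i \<in> Mor C S (As ! i)) \<and>
      (\<forall>i<length As. \<forall>j<length As. Comp C (As ! i) S (As ! j) (\<pi> j) (\<iota> i) =
         (if i = j then Ident C (As ! i) else \<zero>\<^bsub>Hom C (As ! i) (As ! j)\<^esub>)) \<and>
      (\<Oplus>\<^bsub>Hom C S S\<^esub>i\<in>{..<length As}. Comp C S (As ! i) S (\<iota> i) (\<pi> i)) = Ident C S)"

text \<open>A chosen direct sum \<open>A \<oplus> B\<close>; used only in categories in which direct sums exist.\<close>

definition dsum_obj :: "('o, 'r, 'm) category \<Rightarrow> 'o \<Rightarrow> 'o \<Rightarrow> 'o" where
  "dsum_obj C A B = (SOME S. is_direct_sum C [A, B] S)"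

definition direct_summand :: "('o, 'r, 'm) category \<Rightarrow> 'o \<Rightarrow> 'o \<Rightarrow> bool" where
  "direct_summand C A B \<longleftrightarrow> (\<exists>D. is_direct_sum C [A, D] B)"

definition fully_additive :: "('o, 'r, 'm) category \<Rightarrow> bool" where
  "fully_additive C \<longleftrightarrow> preadditive_category C \<and>
    (\<forall>As. set As \<subseteq> Obj C \<longrightarrow> (\<exists>S. is_direct_sum C As S)) \<and>
    (\<forall>A\<in>Obj C. \<forall>e\<in>Mor C A A. Comp C A A A e e = e \<longrightarrow>
      (\<exists>B\<in>Obj C. \<exists>p\<in>Mor C A B. \<exists>i\<in>Mor C B A.
        Comp C A B A i p = e \<and> Comp C B A B p i = Ident C B))"

text \<open>The objects of \<open>add A\<close>, for an object \<open>A\<close> of a fully additive category.\<close>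

definition add_of_object :: "('o, 'r, 'm) category \<Rightarrow> 'o \<Rightarrow> 'o set" where
  "add_of_object C A =
    {B. \<exists>n S. is_direct_sum C (replicate n A) S \<and> direct_summand C B S}"


section \<open>Scalar extension\<close>

text \<open>\<open>S \<otimes>\<^sub>R M\<close> is the free abelian group on \<open>S \<times> M\<close> modulo the subgroup \<open>tensor_relations R S M\<close>.\<close>

definition tensor_relations :: "('r, 'x) ring_scheme \<Rightarrow> ('r, 's, 'y) module_scheme \<Rightarrow>
    ('r, 'm, 'z) module_scheme \<Rightarrow> ('s \<times> 'm \<Rightarrow>\<^sub>0 int) set" where
  "tensor_relations R S M = generate (free_Abelian_group (carrier S \<times> carrier M))
    ({frag_of (s \<oplus>\<^bsub>S\<^esub> s', m) - frag_of (s, m) - frag_of (s', m) | s s' m.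
        s \<in> carrier S \<and> s' \<in> carrier S \<and> m \<in> carrier M} \<union>
     {frag_of (s, m \<oplus>\<^bsub>M\<^esub> m') - frag_of (s, m) - frag_of (s, m') | s m m'.
        s \<in> carrier S \<and> m \<in> carrier M \<and> m' \<in> carrier M} \<union>
     {frag_of (r \<odot>\<^bsub>S\<^esub> s, m) - frag_of (s, r \<odot>\<^bsub>M\<^esub> m) | r s m.
        r \<in> carrier R \<and> s \<in> carrier S \<and> m \<in> carrier M})"

definition tensor_class :: "('r, 'x) ring_scheme \<Rightarrow> ('r, 's, 'y) module_scheme \<Rightarrow>
    ('r, 'm, 'z) module_scheme \<Rightarrow> ('s \<times> 'm \<Rightarrow>\<^sub>0 int) \<Rightarrow> ('s \<times> 'm \<Rightarrow>\<^sub>0 int) set" where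
  "tensor_class R S M x =
     tensor_relations R S M #>\<^bsub>free_Abelian_group (carrier S \<times> carrier M)\<^esub> x"

text \<open>For a commutative \<open>R\<close>-algebra \<open>S\<close>, the \<open>S\<close>-module structure is \<open>s(t \<otimes> m) = st \<otimes> m\<close>. The unions
  in this and the next definition range over all representatives and all yield the same class.\<close>

definition tensor :: "('r, 'x) ring_scheme \<Rightarrow> ('r, 's, 'y) module_scheme \<Rightarrow>
    ('r, 'm, 'z) module_scheme \<Rightarrow> ('s, ('s \<times> 'm \<Rightarrow>\<^sub>0 int) set) module" where
  "tensor R S M =
    (let T = free_Abelian_group (carrier S \<times> carrier M) Mod tensor_relations R S M in
     \<lparr>carrier = carrier T, monoid.mult = undefined, monoid.one = undefined,
      ring.zero = \<one>\<^bsub>T\<^esub>, ring.add = (\<otimes>\<^bsub>T\<^esub>),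
      smult = (\<lambda>s U. \<Union>u\<in>U. tensor_class R S M
        (frag_extend (\<lambda>(t, m). frag_of (s \<otimes>\<^bsub>S\<^esub> t, m)) u))\<rparr>)"

definition scalar_extension :: "('r, 'x) ring_scheme \<Rightarrow> ('r, 's, 'y) module_scheme \<Rightarrow>
    ('o, 'r, 'm) category \<Rightarrow> ('o, 's, ('s \<times> 'm \<Rightarrow>\<^sub>0 int) set) category" where
  "scalar_extension R S C =
    \<lparr>Obj = Obj C,
     Hom = (\<lambda>A B. tensor R S (Hom C A B)),
     Comp = (\<lambda>A B D V U. \<Union>v\<in>V. \<Union>u\<in>U. tensor_class R S (Hom C A D)
       (frag_extend (\<lambda>(s, g). frag_extend (\<lambda>(t, f). frag_of (s \<otimes>\<^bsub>S\<^esub> t, Comp C A B D g f)) u) v)),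
     Ident = (\<lambda>A. tensor_class R S (Hom C A A) (frag_of (\<one>\<^bsub>S\<^esub>, Ident C A)))\<rparr>"


section \<open>The fully additive category add C\<close>

text \<open>\<open>add C\<close> is realized as the idempotent completion of the category of matrices over \<open>C\<close>. A matrix
  from \<open>As\<close> to \<open>Bs\<close> has the entry \<open>M (i, j) : As ! j \<rightarrow> Bs ! i\<close>.\<close>

definition matrix_index :: "'o list \<Rightarrow> 'o list \<Rightarrow> (nat \<times> nat) set" where
  "matrix_index As Bs = {..<length Bs} \<times> {..<length As}"

definition matrix_category ::
    "('o, 'r, 'm) category \<Rightarrow> ('o list, 'r, nat \<times> nat \<Rightarrow> 'm) category" where
  "matrix_category C =
    \<lparr>Obj = {As. set As \<subseteq> Obj C},
     Hom = (\<lambda>As Bs.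
       \<lparr>carrier = (\<Pi>\<^sub>E (i, j)\<in>matrix_index As Bs. Mor C (As ! j) (Bs ! i)),
        monoid.mult = undefined, monoid.one = undefined,
        ring.zero = (\<lambda>(i, j)\<in>matrix_index As Bs. \<zero>\<^bsub>Hom C (As ! j) (Bs ! i)\<^esub>),
        ring.add = (\<lambda>M N. \<lambda>(i, j)\<in>matrix_index As Bs. M (i, j) \<oplus>\<^bsub>Hom C (As ! j) (Bs ! i)\<^esub> N (i, j)),
        smult = (\<lambda>r M. \<lambda>(i, j)\<in>matrix_index As Bs. r \<odot>\<^bsub>Hom C (As ! j) (Bs ! i)\<^esub> M (i, j))\<rparr>),
     Comp = (\<lambda>As Bs Ds N M. \<lambda>(i, j)\<in>matrix_index As Ds.
       \<Oplus>\<^bsub>Hom C (As ! j) (Ds ! i)\<^esub>k\<in>{..<length Bs}.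
         Comp C (As ! j) (Bs ! k) (Ds ! i) (N (i, k)) (M (k, j))),
     Ident = (\<lambda>As. \<lambda>(i, j)\<in>matrix_index As As.
       if i = j then Ident C (As ! i) else \<zero>\<^bsub>Hom C (As ! j) (As ! i)\<^esub>)\<rparr>"

definition idempotent_completion ::
    "('o, 'r, 'm) category \<Rightarrow> ('o \<times> 'm, 'r, 'm) category" where
  "idempotent_completion C =
    \<lparr>Obj = {(A, e). A \<in> Obj C \<and> e \<in> Mor C A A \<and> Comp C A A A e e = e},
     Hom = (\<lambda>(A, e) (B, e'). (Hom C A B)
       \<lparr>carrier := {f \<in> Mor C A B. Comp C A A B (Comp C A B B e' f) e = f}\<rparr>),
     Comp = (\<lambda>(A, _) (B, _) (D, _). Comp C A B D),
     Ident = snd\<rparr>"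

definition add_category ::
    "('o, 'r, 'm) category \<Rightarrow> ('o list \<times> (nat \<times> nat \<Rightarrow> 'm), 'r, nat \<times> nat \<Rightarrow> 'm) category" where
  "add_category C = idempotent_completion (matrix_category C)"

text \<open>An object \<open>A\<close> of \<open>C\<close>, regarded as an object of \<open>add C\<close>.\<close>

definition add_embed :: "('o, 'r, 'm) category \<Rightarrow> 'o \<Rightarrow> 'o list \<times> (nat \<times> nat \<Rightarrow> 'm)" where
  "add_embed C A = ([A], Ident (matrix_category C) [A])"


section \<open>Localizations and the genus\<close>

definition rational_category where
  "rational_category R \<A> = add_category (scalar_extension R (fraction_field R) \<A>)"

definition rational_object where
  "rational_object R \<A> A = add_embed (scalar_extension R (fraction_field R) \<A>) A"

definition local_category where
  "local_category R \<A> \<pp> = add_category (scalar_extension R (localization R (carrier R - \<pp>)) \<A>)"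

definition local_object where
  "local_object R \<A> \<pp> A = add_embed (scalar_extension R (localization R (carrier R - \<pp>)) \<A>) A"

definition genus :: "('r, 'x) ring_scheme \<Rightarrow> ('o, 'r, 'm) category \<Rightarrow> 'o \<Rightarrow> 'o set" where
  "genus R \<A> A = {B \<in> Obj \<A>. \<forall>\<pp>. maximalideal \<pp> R \<longrightarrow>
     isomorphic_objs (local_category R \<A> \<pp>) (local_object R \<A> \<pp> B) (local_object R \<A> \<pp> A)}"

end

theory Submission
  imports Defs
begin

text \<open>A map \<open>f : A \<rightarrow> B\<close> becomes an isomorphism at \<open>p\<close> iff \<open>gf = s\<close> and \<open>fg = s\<close> for some \<open>g : B \<rightarrow> A\<close> and \<open>s \<notin> p\<close>,
  and this is stable under perturbation \<open>f + r m\<close> with \<open>r \<in> p\<close>, because endomorphisms are integral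
  over \<open>R\<close>. Hence local choices at finitely many \<open>p\<close> can be interpolated by one map. If \<open>R\<close> has
  finitely many maximal ideals, this already gives global isomorphisms; otherwise every \<open>s \<noteq> 0\<close> avoids some
  \<open>p\<close>, which keeps interpolated maps invertible over \<open>K\<close>.

  For (1), one constructs a map \<open>f : A \<rightarrow> B\<close> split away from some \<open>s\<close> and a map \<open>j : A \<rightarrow> B\<close> split at the
  \<open>p\<close> containing \<open>s\<close> that have the same image over \<open>K\<close>; a combination of the two projections is an
  idempotent of \<open>B\<close>, and its image is the required \<open>A'\<close>. For (2), write a multiple of \<open>1\<^sub>A\<close> as
  \<open>\<Sum> x\<^sub>k y\<^sub>k\<close> with \<open>y\<^sub>k : A \<rightarrow> B\<close> and choose, in the style of Serre's theorem, the columns \<open>c\<^sub>k\<close> of a map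
  \<open>h = h\<^sub>0 + \<Sum> c\<^sub>k y\<^sub>k : A \<rightarrow> A'\<close> and a map \<open>b : B \<rightarrow> A'\<close> such that for every \<open>p\<close> some \<open>h + b c\<close> is invertible at \<open>p\<close>. Then
  \<open>(h, b) : A \<oplus> B \<rightarrow> A'\<close> splits and its kernel lies in the genus of \<open>B\<close>. Parts (3) and (4) are
  special cases of (2).\<close>

section \<open>Noetherian domains of dimension one\<close>

text \<open>A condition at all maximal ideals is out of reach of interpolation. It becomes finite
  because a nonzero scalar lies in only finitely many of them: a map with one local inverse is
  invertible at almost all \<open>p\<close>. So the maps \<open>A \<rightarrow> A'\<close> built for
  (2) are kept invertible at some \<open>p\<close> throughout. Hom modules may have torsion, so an
  identity over \<open>K\<close> holds in the category only up to torsion. In (1) this is why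
  \<open>s\<close> contains a factor that kills the torsion of \<open>Hom A B\<close>. In (1),
  \<open>f\<close> and \<open>j\<close> come from a common right inverse over \<open>K\<close> of a
  map \<open>g : B \<rightarrow> A\<close>, an affine combination of two such inverses with weights
  \<open>s s u\<close> and \<open>1 - s s u\<close>. One inverse has denominator \<open>s\<close>,
  the other a denominator \<open>N\<close>, and \<open>u\<close> is found by writing a multiple of
  \<open>N\<close> as \<open>s^k (1 - s s u)\<close>: the power of \<open>s\<close> is harmless away
  from \<open>s\<close>, and \<open>1 - s s u\<close> cancels against the weight. Of the two factors
  \<open>s\<close>, one clears the denominator of the first inverse, and the other makes
  \<open>j\<close> congruent modulo \<open>s\<close> to a map already split at the \<open>p\<close>
  containing \<open>s\<close>.\<close>

context noetherian_ring begin

text \<open>Iterating a choice of strictly larger counterexamples would give a strictly increasing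
  chain of ideals, whose union is one of its members by the chain condition.\<close>

lemma ideal_noetherian_induct [consumes 1, case_names step]:
  assumes I: "ideal I R"
    and step: "\<And>I. ideal I R \<Longrightarrow> (\<And>J. ideal J R \<Longrightarrow> I \<subset> J \<Longrightarrow> P J) \<Longrightarrow> P I"
  shows "P I"
proof (rule ccontr)
  assume nP: "\<not> P I"
  have "\<exists>J. ideal J R \<and> \<not> P J \<and> I \<subset> J" if "ideal I R \<and> \<not> P I" for I
    using step that by blast
  then obtain f where f: "\<And>I. ideal I R \<and> \<not> P I \<Longrightarrow> ideal (f I) R \<and> \<not> P (f I) \<and> I \<subset> f I"
    by metis
  define g where "g n = (f ^^ n) I" for n
  have g: "ideal (g n) R \<and> \<not> P (g n) \<and> g n \<subset> g (Suc n)" for n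
  proof -
    have "ideal (g n) R \<and> \<not> P (g n)"
      by (induction n) (use I nP f in \<open>auto simp: g_def\<close>)
    then show ?thesis using f[of "g n"] by (simp add: g_def)
  qed
  have mono: "g m \<subseteq> g n" if "m \<le> n" for m n
    using lift_Suc_mono_le[of g, OF _ that] g by (meson psubset_imp_subset)
  have "subset.chain {I. ideal I R} (range g)"
    unfolding subset_chain_def
  proof (intro conjI ballI)
    fix a b assume "a \<in> range g" "b \<in> range g"
    then obtain m n where "a = g m" "b = g n" by blast
    then show "a \<subseteq> b \<or> b \<subseteq> a" using mono[of m n] mono[of n m] nat_le_linear[of m n] by auto
  qed (use g in blast)
  then have "\<Union>(range g) \<in> range g"
    by (intro ideal_chain_is_trivial) auto
  then obtain n where "\<Union>(range g) = g n" by auto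
  then show False using g[of n] by blast
qed

text \<open>A proper ideal that is not maximal has a larger proper ideal above it, to which the
  Noetherian induction applies.\<close>

lemma exists_maximalideal_superset:
  assumes "ideal I R" and "\<one> \<notin> I"
  shows "\<exists>p. maximalideal p R \<and> I \<subseteq> p"
  using assms
proof (induction I rule: ideal_noetherian_induct)
  case (step I)
  show ?case
  proof (cases "maximalideal I R")
    case False
    have "I \<noteq> carrier R" using step.prems by auto
    then obtain J where J: "ideal J R" "I \<subseteq> J" "J \<subseteq> carrier R" "J \<noteq> I" "J \<noteq> carrier R"
      using False maximalidealI[OF step.hyps] by blast
    then have "\<one> \<notin> J" using ideal.one_imp_carrier by blast
    with step.IH J have "\<exists>p. maximalideal p R \<and> J \<subseteq> p" by blast
    then show ?thesis using J by blast
  qed auto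
qed

end

lemma (in ring) maximalideal_Icarr: "maximalideal p R \<Longrightarrow> x \<in> p \<Longrightarrow> x \<in> carrier R"
  using ideal.Icarr[OF maximalideal.axioms(1)] .

lemma (in ring) maximalideal_l_closed:
  "maximalideal p R \<Longrightarrow> x \<in> p \<Longrightarrow> r \<in> carrier R \<Longrightarrow> r \<otimes> x \<in> p"
  using ideal.I_l_closed[OF maximalideal.axioms(1)] .

text \<open>\<open>r\<close> represents the inverse of \<open>a\<close> in the residue field
  \<open>R/p\<close>: maximality forces \<open>p + aR\<close> to contain
  \<open>\<one>\<close>.\<close>

lemma (in cring) maximalideal_coprime:
  assumes p: "maximalideal p R" and a: "a \<in> carrier R" "a \<notin> p"
  shows "\<exists>r\<in>carrier R. \<one> \<ominus> r \<otimes> a \<in> p"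
proof -
  interpret p: maximalideal p R by fact
  have id: "ideal (p <+>\<^bsub>R\<^esub> PIdl a) R"
    by (rule add_ideals[OF p.is_ideal cgenideal_ideal[OF a(1)]])
  have sub: "p \<subseteq> p <+>\<^bsub>R\<^esub> PIdl a"
  proof
    fix x assume x: "x \<in> p"
    have "x = x \<oplus> \<zero> \<otimes> a" using x a p.Icarr by simp
    then show "x \<in> p <+>\<^bsub>R\<^esub> PIdl a" using x unfolding set_add_def' cgenideal_def by blast
  qed
  have "a \<in> p <+>\<^bsub>R\<^esub> PIdl a"
  proof -
    have "a = \<zero> \<oplus> \<one> \<otimes> a" using a by simp
    then show ?thesis using p.zero_closed unfolding set_add_def' cgenideal_def by blast
  qed
  then have "p <+>\<^bsub>R\<^esub> PIdl a = carrier R"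
    using p.I_maximal[OF id sub] ideal.Icarr[OF id] a by blast
  then obtain x r where xr: "x \<in> p" "r \<in> carrier R" "\<one> = x \<oplus> r \<otimes> a"
    unfolding set_add_def' cgenideal_def using one_closed by (smt (verit) UN_E mem_Collect_eq singletonD)
  then have "\<one> \<ominus> r \<otimes> a = x"
    using a p.Icarr[OF xr(1)] by (simp add: a_minus_def a_assoc r_neg)
  then show ?thesis using xr(1,2) by metis
qed

lemma (in cring) maximalideal_mult_notin:
  assumes p: "maximalideal p R" and "a \<in> carrier R" "a \<notin> p" "b \<in> carrier R" "b \<notin> p"
  shows "a \<otimes> b \<notin> p"
  using primeideal.I_prime[OF maximalideal_prime[OF p]] assms by blast

lemma (in cring) maximalideal_pow_notin:
  assumes p: "maximalideal p R" and "a \<in> carrier R" "a \<notin> p"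
  shows "a [^] (n::nat) \<notin> p"
proof (induction n)
  case 0
  then show ?case using p maximalideal.I_notcarr[OF p] ideal.one_imp_carrier[OF maximalideal.axioms(1)[OF p]] by auto
qed (use maximalideal_mult_notin assms in auto)

context dedekind_domain begin

text \<open>If \<open>I\<close> is proper and not prime, pick \<open>a b \<in> I\<close> with
  \<open>a\<close> and \<open>b\<close> outside \<open>I\<close>; then
  \<open>(I + aR)(I + bR) \<subseteq> I\<close>, and the lists found for the two larger ideals are
  concatenated. The product ideal is represented by its generating products: \<open>xs\<close> takes
  one element from each member of \<open>ps\<close>, and repetitions in \<open>ps\<close> are
  allowed.\<close>

lemma ideal_contains_product_of_maximals:
  assumes "ideal I R" "I \<noteq> {\<zero>}"
  shows "\<exists>ps. (\<forall>p\<in>set ps. maximalideal p R) \<and> (\<forall>xs. list_all2 (\<in>) xs ps \<longrightarrow> foldr (\<otimes>) xs \<one> \<in> I)"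
  using assms
proof (induction I rule: ideal_noetherian_induct)
  case (step I)
  interpret I: ideal I R by fact
  consider "I = carrier R" | "primeideal I R" | "I \<noteq> carrier R" "\<not> primeideal I R" by blast
  then show ?case
  proof cases
    case 1
    then show ?thesis by (intro exI[of _ "[]"]) auto
  next
    case 2
    then have "maximalideal I R" using nonzero_prime_maximal step.prems by blast
    then show ?thesis
      by (intro exI[of _ "[I]"]) (auto simp: list_all2_Cons2 I.Icarr)
  next
    case 3
    then obtain a b where ab: "a \<in> carrier R" "b \<in> carrier R" "a \<otimes> b \<in> I" "a \<notin> I" "b \<notin> I"
      using primeidealI[OF step.hyps is_cring] by blast
    have bigger: "ideal (I <+>\<^bsub>R\<^esub> PIdl c) R \<and> I \<subset> I <+>\<^bsub>R\<^esub> PIdl c" if "c \<in> carrier R" "c \<notin> I" for c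
    proof -
      have "x \<in> I <+>\<^bsub>R\<^esub> PIdl c" if "x \<in> I" for x
      proof -
        have "x = x \<oplus> \<zero> \<otimes> c" using that I.Icarr \<open>c \<in> carrier R\<close> by simp
        then show ?thesis using that unfolding set_add_def' cgenideal_def by blast
      qed
      moreover have "c \<in> I <+>\<^bsub>R\<^esub> PIdl c"
      proof -
        have "c = \<zero> \<oplus> \<one> \<otimes> c" using that by simp
        then show ?thesis using I.zero_closed unfolding set_add_def' cgenideal_def by blast
      qed
      ultimately show ?thesis
        using that add_ideals[OF step.hyps cgenideal_ideal[OF that(1)]] by blast
    qed
    have nz: "I <+>\<^bsub>R\<^esub> PIdl c \<noteq> {\<zero>}" if "c \<in> carrier R" "c \<notin> I" for c
      using bigger[OF that] step.prems I.zero_closed by blast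
    obtain ps where ps: "\<forall>p\<in>set ps. maximalideal p R"
      "\<And>xs. list_all2 (\<in>) xs ps \<Longrightarrow> foldr (\<otimes>) xs \<one> \<in> I <+>\<^bsub>R\<^esub> PIdl a"
      using step.IH[of "I <+>\<^bsub>R\<^esub> PIdl a"] bigger nz ab by meson
    obtain qs where qs: "\<forall>p\<in>set qs. maximalideal p R"
      "\<And>xs. list_all2 (\<in>) xs qs \<Longrightarrow> foldr (\<otimes>) xs \<one> \<in> I <+>\<^bsub>R\<^esub> PIdl b"
      using step.IH[of "I <+>\<^bsub>R\<^esub> PIdl b"] bigger nz ab by meson
    have prod: "x \<otimes> y \<in> I" if xy: "x \<in> I <+>\<^bsub>R\<^esub> PIdl a" "y \<in> I <+>\<^bsub>R\<^esub> PIdl b" for x y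
    proof -
      obtain i r j t where ij: "i \<in> I" "r \<in> carrier R" "x = i \<oplus> r \<otimes> a" "j \<in> I" "t \<in> carrier R" "y = j \<oplus> t \<otimes> b"
        using xy unfolding set_add_def' cgenideal_def by blast
      have "x \<otimes> y = i \<otimes> (j \<oplus> t \<otimes> b) \<oplus> ((r \<otimes> a) \<otimes> j \<oplus> (r \<otimes> t) \<otimes> (a \<otimes> b))"
        using ij ab I.Icarr by algebra
      then show ?thesis using ij ab I.Icarr
        by (simp add: I.I_l_closed I.I_r_closed)
    qed
    have carr_list: "set xs \<subseteq> carrier R" if "list_all2 (\<in>) xs ps" "\<forall>p\<in>set ps. maximalideal p R" for xs ps
      using that by (induction rule: list_all2_induct) (auto dest: maximalideal_Icarr)
    have "foldr (\<otimes>) zs \<one> \<in> I" if zs: "list_all2 (\<in>) zs (ps @ qs)" for zs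
    proof -
      obtain xs ys where xy: "zs = xs @ ys" "list_all2 (\<in>) xs ps" "list_all2 (\<in>) ys qs"
        using zs by (auto simp: list_all2_append2)
      have carr: "set xs \<subseteq> carrier R" "set ys \<subseteq> carrier R"
        using carr_list xy ps(1) qs(1) by auto
      have "foldr (\<otimes>) ys \<one> \<in> carrier R" using carr(2) by (induction ys) auto
      then have "foldr (\<otimes>) zs \<one> = foldr (\<otimes>) xs \<one> \<otimes> foldr (\<otimes>) ys \<one> \<and> foldr (\<otimes>) xs \<one> \<in> carrier R"
        using carr(1) unfolding xy(1) by (induction xs) (auto simp: m_assoc)
      then show ?thesis using prod[OF ps(2)[OF xy(2)] qs(2)[OF xy(3)]] by simp
    qed
    then show ?thesis using ps(1) qs(1) by (intro exI[of _ "ps @ qs"]) auto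
  qed
qed

lemma principal_contains_product_of_maximals:
  assumes "a \<in> carrier R" "a \<noteq> \<zero>"
  shows "\<exists>ps. (\<forall>p\<in>set ps. maximalideal p R) \<and>
    (\<forall>xs. list_all2 (\<in>) xs ps \<longrightarrow> (\<exists>r\<in>carrier R. foldr (\<otimes>) xs \<one> = r \<otimes> a))"
proof -
  have "a \<in> PIdl a" using cgenideal_self[OF assms(1)] .
  then have "PIdl a \<noteq> {\<zero>}" using assms by blast
  from ideal_contains_product_of_maximals[OF cgenideal_ideal[OF assms(1)] this]
  show ?thesis by (simp add: cgenideal_def) blast
qed

text \<open>Only members of \<open>ps\<close> can contain \<open>a\<close>: for any other maximal
  \<open>p\<close>, each \<open>q\<close> in \<open>ps\<close> has an element outside
  \<open>p\<close>, and the product of these is a multiple of \<open>a\<close> that is not in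
  \<open>p\<close>.\<close>

lemma finite_maximalideals_containing:
  assumes a: "a \<in> carrier R" "a \<noteq> \<zero>"
  shows "finite {p. maximalideal p R \<and> a \<in> p}"
proof -
  obtain ps where ps: "\<forall>p\<in>set ps. maximalideal p R"
    "\<And>xs. list_all2 (\<in>) xs ps \<Longrightarrow> \<exists>r\<in>carrier R. foldr (\<otimes>) xs \<one> = r \<otimes> a"
    using principal_contains_product_of_maximals[OF a] by blast
  have "p \<in> set ps" if p: "maximalideal p R" "a \<in> p" for p
  proof (rule ccontr)
    interpret p: maximalideal p R by fact
    assume np: "p \<notin> set ps"
    have "\<exists>x. x \<in> q \<and> x \<in> carrier R \<and> x \<notin> p" if q: "q \<in> set ps" for q
    proof -
      interpret q: maximalideal q R using ps q by blast
      have "\<not> q \<subseteq> p"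
        using q.I_maximal[OF p.is_ideal] p.Icarr p.I_notcarr np q by blast
      then show ?thesis using q.Icarr by blast
    qed
    then obtain f where f: "\<And>q. q \<in> set ps \<Longrightarrow> f q \<in> q \<and> f q \<in> carrier R \<and> f q \<notin> p" by metis
    have "foldr (\<otimes>) (map f ps) \<one> \<notin> p \<and> foldr (\<otimes>) (map f ps) \<one> \<in> carrier R"
      using f
    proof (induction ps)
      case Nil
      then show ?case using p.I_notcarr p.one_imp_carrier by auto
    next
      case (Cons q qs)
      then show ?case using maximalideal_mult_notin[OF p(1)] by auto
    qed
    moreover have "list_all2 (\<in>) (map f ps) ps"
      using f by (auto simp: list_all2_conv_all_nth)
    ultimately show False using ps(2) p.I_l_closed[OF p(2)] by metis
  qed
  then show ?thesis by (metis (no_types, lifting) List.finite_set finite_subset mem_Collect_eq subsetI)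
qed

text \<open>From every maximal ideal of a product list for \<open>a\<close> take \<open>s\<close>
  itself if it lies there, and otherwise an element \<open>1 - t s s\<close>. The factors of the
  second kind multiply to something congruent to 1 modulo \<open>s s\<close>; the square, not merely
  \<open>s\<close>, is what \<open>local_summand\<close> spends later.\<close>

lemma dvd_power_times_unipotent:
  assumes a: "a \<in> carrier R" "a \<noteq> \<zero>" and s: "s \<in> carrier R"
  shows "\<exists>r\<in>carrier R. \<exists>q\<in>carrier R. \<exists>k::nat. r \<otimes> a = s [^] k \<otimes> (\<one> \<ominus> (s \<otimes> s) \<otimes> q)"
proof -
  obtain ps where ps: "\<forall>p\<in>set ps. maximalideal p R"
    "\<And>xs. list_all2 (\<in>) xs ps \<Longrightarrow> \<exists>r\<in>carrier R. foldr (\<otimes>) xs \<one> = r \<otimes> a"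
    using principal_contains_product_of_maximals[OF a] by blast
  have "\<exists>xs. list_all2 (\<in>) xs ps \<and> (\<exists>q\<in>carrier R. \<exists>k::nat. foldr (\<otimes>) xs \<one> = s [^] k \<otimes> (\<one> \<ominus> (s \<otimes> s) \<otimes> q))"
    using ps(1)
  proof (induction ps)
    case Nil
    show ?case using s by (auto intro!: bexI[of _ \<zero>] exI[of _ "0::nat"] simp: a_minus_def)
  next
    case (Cons p ps)
    then obtain xs q and k :: nat where xs: "list_all2 (\<in>) xs ps" and q: "q \<in> carrier R"
      "foldr (\<otimes>) xs \<one> = s [^] k \<otimes> (\<one> \<ominus> (s \<otimes> s) \<otimes> q)" by auto
    have p: "maximalideal p R" using Cons by simp
    show ?case
    proof (cases "s \<in> p")
      case True
      have "foldr (\<otimes>) (s # xs) \<one> = s [^] Suc k \<otimes> (\<one> \<ominus> (s \<otimes> s) \<otimes> q)"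
        using q s by (simp add: m_ac)
      then show ?thesis using True xs q(1) by (intro exI[of _ "s # xs"]) blast
    next
      case False
      then obtain t where t: "t \<in> carrier R" "\<one> \<ominus> t \<otimes> (s \<otimes> s) \<in> p"
        using maximalideal_coprime[OF p, of "s \<otimes> s"] maximalideal_mult_notin[OF p] s by auto
      \<comment> \<open>Chosen so that \<open>(1 - t s s)(1 - s s q) = 1 - s s u\<close>.\<close>
      define u where "u = t \<oplus> q \<ominus> s \<otimes> s \<otimes> q \<otimes> t"
      have u: "u \<in> carrier R" unfolding u_def using t q s by simp
      have sk: "s [^] k \<in> carrier R" using s by simp
      have "foldr (\<otimes>) ((\<one> \<ominus> t \<otimes> (s \<otimes> s)) # xs) \<one> = s [^] k \<otimes> (\<one> \<ominus> (s \<otimes> s) \<otimes> u)"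
        unfolding u_def foldr.simps o_apply q(2) using q(1) s t(1) sk by algebra
      then show ?thesis using t xs u
        by (intro exI[of _ "(\<one> \<ominus> t \<otimes> (s \<otimes> s)) # xs"]) auto
    qed
  qed
  then show ?thesis using ps(2) by metis
qed

end

text \<open>Chinese remaindering: multiplying elements of the sets \<open>q - p\<close> gives an
  element of all \<open>q \<in> F\<close> outside \<open>p\<close>, which is then multiplied by an
  inverse modulo \<open>p\<close>.\<close>

lemma (in cring) maximalideals_interpolate:
  assumes F: "finite F" "\<And>q. q \<in> F \<Longrightarrow> maximalideal q R" and p: "maximalideal p R" "p \<notin> F"
  shows "\<exists>e\<in>carrier R. \<one> \<ominus> e \<in> p \<and> (\<forall>q\<in>F. e \<in> q)"
proof -
  interpret p: maximalideal p R by fact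
  have "\<exists>e\<in>carrier R. e \<notin> p \<and> (\<forall>q\<in>F. e \<in> q)"
    using F p(2)
  proof (induction F)
    case empty
    show ?case using p.I_notcarr p.one_imp_carrier by auto
  next
    case (insert q F)
    then obtain e where e: "e \<in> carrier R" "e \<notin> p" "\<forall>q\<in>F. e \<in> q" by auto
    interpret q: maximalideal q R using insert by blast
    have "\<not> q \<subseteq> p" using q.I_maximal[OF p.is_ideal] p.Icarr p.I_notcarr insert by blast
    then obtain x where x: "x \<in> q" "x \<notin> p" by blast
    have "e \<otimes> x \<notin> p" using maximalideal_mult_notin[OF p(1)] e x q.Icarr by blast
    moreover have "\<forall>q'\<in>insert q F. e \<otimes> x \<in> q'"
    proof
      fix q' assume "q' \<in> insert q F"
      then consider "q' = q" | "q' \<in> F" "maximalideal q' R" using insert by blast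
      then show "e \<otimes> x \<in> q'"
      proof cases
        case 2
        interpret q': maximalideal q' R by fact
        show ?thesis using 2 e x q.Icarr by (auto intro: q'.I_r_closed)
      qed (use e x q.I_l_closed in auto)
    qed
    ultimately show ?case using e x q.Icarr by blast
  qed
  then obtain e where e: "e \<in> carrier R" "e \<notin> p" "\<forall>q\<in>F. e \<in> q" by blast
  then obtain r where r: "r \<in> carrier R" "\<one> \<ominus> r \<otimes> e \<in> p"
    using maximalideal_coprime[OF p(1)] by blast
  then show ?thesis using e F(2) maximalideal_l_closed
    by (intro bexI[of _ "r \<otimes> e"]) auto
qed

section \<open>Finitely generated modules\<close>

lemma (in cring) cring_idealI:
  assumes sub: "I \<subseteq> carrier R" and zero: "\<zero> \<in> I"
    and add: "\<And>a b. a \<in> I \<Longrightarrow> b \<in> I \<Longrightarrow> a \<oplus> b \<in> I"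
    and mult: "\<And>a x. a \<in> I \<Longrightarrow> x \<in> carrier R \<Longrightarrow> x \<otimes> a \<in> I"
  shows "ideal I R"
proof (rule idealI[OF ring_axioms])
  have "\<ominus> a \<in> I" if "a \<in> I" for a
    using mult[OF that, of "\<ominus> \<one>"] that sub l_minus[of \<one> a] by auto
  then show "subgroup I (add_monoid R)"
    using assms by (auto intro!: add.subgroupI simp: a_inv_def)
  show "a \<otimes> x \<in> I" if "a \<in> I" "x \<in> carrier R" for a x
    using mult[OF that] that sub m_comm by auto
qed (use mult in auto)

context module begin

text \<open>The submodule generated by \<open>G\<close>, built one scaled generator at a time so
  that proofs about it are rule inductions without coefficient functions. \<open>G\<close> may be
  infinite, such as the range of a sequence.\<close>

inductive_set mspan :: "'c set \<Rightarrow> 'c set" for G where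
  zero: "\<zero>\<^bsub>M\<^esub> \<in> mspan G"
| step: "g \<in> G \<Longrightarrow> r \<in> carrier R \<Longrightarrow> x \<in> mspan G \<Longrightarrow> r \<odot>\<^bsub>M\<^esub> g \<oplus>\<^bsub>M\<^esub> x \<in> mspan G"

lemma mspan_closed:
  assumes "G \<subseteq> carrier M" "x \<in> mspan G"
  shows "x \<in> carrier M"
  using assms(2) by induction (use assms(1) in auto)

lemma mspan_add:
  assumes G: "G \<subseteq> carrier M" and x: "x \<in> mspan G" and y: "y \<in> mspan G"
  shows "x \<oplus>\<^bsub>M\<^esub> y \<in> mspan G"
  using x
proof induction
  case zero
  then show ?case using y mspan_closed[OF G] by simp
next
  case (step g r x)
  then have "(r \<odot>\<^bsub>M\<^esub> g \<oplus>\<^bsub>M\<^esub> x) \<oplus>\<^bsub>M\<^esub> y = r \<odot>\<^bsub>M\<^esub> g \<oplus>\<^bsub>M\<^esub> (x \<oplus>\<^bsub>M\<^esub> y)"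
    using G mspan_closed[OF G] y by (intro M.a_assoc) auto
  then show ?case using step mspan.step by simp
qed

lemma mspan_smult:
  assumes G: "G \<subseteq> carrier M" and x: "x \<in> mspan G" and a: "a \<in> carrier R"
  shows "a \<odot>\<^bsub>M\<^esub> x \<in> mspan G"
  using x
proof induction
  case zero
  then show ?case using a mspan.zero by simp
next
  case (step g r x)
  then have "a \<odot>\<^bsub>M\<^esub> (r \<odot>\<^bsub>M\<^esub> g \<oplus>\<^bsub>M\<^esub> x) = (a \<otimes> r) \<odot>\<^bsub>M\<^esub> g \<oplus>\<^bsub>M\<^esub> a \<odot>\<^bsub>M\<^esub> x"
    using G mspan_closed[OF G] a by (subst smult_r_distr) (auto simp: smult_assoc1)
  then show ?case using step mspan.step a by simp
qed

lemma mspan_submodule: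
  assumes G: "G \<subseteq> carrier M"
  shows "submodule (mspan G) R M"
proof (rule submoduleI)
  show "\<ominus>\<^bsub>M\<^esub> a \<in> mspan G" if "a \<in> mspan G" for a
    using mspan_smult[OF G that, of "\<ominus> \<one>"] smult_l_minus[of \<one> a] mspan_closed[OF G that] by simp
qed (use mspan_add[OF G] mspan_smult[OF G] mspan_closed[OF G] mspan.zero in auto)

lemma mspan_superset: "G \<subseteq> carrier M \<Longrightarrow> G \<subseteq> mspan G"
  using mspan.step[OF _ one_closed mspan.zero, of _ G] by force

lemma mspan_least:
  assumes N: "submodule N R M" and "G \<subseteq> N"
  shows "mspan G \<subseteq> N"
proof
  have zero: "\<zero>\<^bsub>M\<^esub> \<in> N"
    using N[THEN submodule.axioms(1), THEN subgroup.one_closed] by simp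
  fix x assume "x \<in> mspan G"
  then show "x \<in> N"
    by induction (use assms submoduleE[OF N] zero in auto)
qed

lemma mspan_mono: "G \<subseteq> H \<Longrightarrow> H \<subseteq> carrier M \<Longrightarrow> mspan G \<subseteq> mspan H"
  by (rule mspan_least[OF mspan_submodule]) (use mspan_superset in auto)

lemma mspan_insert:
  assumes G: "insert g G \<subseteq> carrier M" and x: "x \<in> mspan (insert g G)"
  shows "\<exists>r\<in>carrier R. \<exists>m\<in>mspan G. x = r \<odot>\<^bsub>M\<^esub> g \<oplus>\<^bsub>M\<^esub> m"
  using x
proof induction
  case zero
  show ?case using G mspan.zero by (intro bexI[of _ \<zero>] bexI[of _ "\<zero>\<^bsub>M\<^esub>"]) auto
next
  case (step h r x)
  then obtain a m where am: "a \<in> carrier R" "m \<in> mspan G" "x = a \<odot>\<^bsub>M\<^esub> g \<oplus>\<^bsub>M\<^esub> m" by blast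
  have m: "m \<in> carrier M" using am mspan_closed G by blast
  show ?case
  proof (cases "h = g")
    case True
    have "r \<odot>\<^bsub>M\<^esub> h \<oplus>\<^bsub>M\<^esub> x = (r \<oplus> a) \<odot>\<^bsub>M\<^esub> g \<oplus>\<^bsub>M\<^esub> m"
      using True am m G step by (simp add: smult_l_distr M.a_assoc)
    then show ?thesis using am step by blast
  next
    case False
    then have h: "h \<in> G" using step by simp
    have "r \<odot>\<^bsub>M\<^esub> h \<oplus>\<^bsub>M\<^esub> x = a \<odot>\<^bsub>M\<^esub> g \<oplus>\<^bsub>M\<^esub> (r \<odot>\<^bsub>M\<^esub> h \<oplus>\<^bsub>M\<^esub> m)"
      using am m G h step(2) unfolding am(3) by (intro M.a_lcomm) auto
    then show ?thesis using am step h mspan.step by blast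
  qed
qed

text \<open>The coefficients of \<open>g\<close> that occur in elements of \<open>N\<close>, in the
  manner of the leading coefficients in Hilbert's basis theorem; \<open>mspan G\<close> holds the
  lower terms.\<close>

lemma coefficient_ideal:
  assumes G: "insert g G \<subseteq> carrier M" and N: "submodule N R M"
  shows "ideal {r \<in> carrier R. \<exists>m\<in>mspan G. r \<odot>\<^bsub>M\<^esub> g \<oplus>\<^bsub>M\<^esub> m \<in> N} R" (is "ideal ?I R")
proof (rule cring_idealI)
  note Gc = mspan_closed[of G] and N' = submoduleE[OF N]
  have G': "G \<subseteq> carrier M" and g: "g \<in> carrier M" using G by auto
  show "\<zero> \<in> ?I"
  proof -
    have "\<zero> \<odot>\<^bsub>M\<^esub> g \<oplus>\<^bsub>M\<^esub> \<zero>\<^bsub>M\<^esub> \<in> N"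
      using N[THEN submodule.axioms(1), THEN subgroup.one_closed] g by simp
    then show ?thesis using mspan.zero by blast
  qed
  show "a \<oplus> b \<in> ?I" if "a \<in> ?I" "b \<in> ?I" for a b
  proof -
    obtain m n where mn: "m \<in> mspan G" "n \<in> mspan G" "a \<odot>\<^bsub>M\<^esub> g \<oplus>\<^bsub>M\<^esub> m \<in> N" "b \<odot>\<^bsub>M\<^esub> g \<oplus>\<^bsub>M\<^esub> n \<in> N"
      using \<open>a \<in> ?I\<close> \<open>b \<in> ?I\<close> by blast
    have "(a \<oplus> b) \<odot>\<^bsub>M\<^esub> g \<oplus>\<^bsub>M\<^esub> (m \<oplus>\<^bsub>M\<^esub> n) = (a \<odot>\<^bsub>M\<^esub> g \<oplus>\<^bsub>M\<^esub> m) \<oplus>\<^bsub>M\<^esub> (b \<odot>\<^bsub>M\<^esub> g \<oplus>\<^bsub>M\<^esub> n)"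
      using that mn Gc[OF G'] g by (simp add: smult_l_distr M.a_ac)
    moreover have "\<dots> \<in> N" using mn N' by blast
    ultimately have "(a \<oplus> b) \<odot>\<^bsub>M\<^esub> g \<oplus>\<^bsub>M\<^esub> (m \<oplus>\<^bsub>M\<^esub> n) \<in> N" by simp
    then show ?thesis using that mn mspan_add[OF G'] by blast
  qed
  show "x \<otimes> a \<in> ?I" if ax: "a \<in> ?I" "x \<in> carrier R" for a x
  proof -
    obtain m where m: "m \<in> mspan G" "a \<odot>\<^bsub>M\<^esub> g \<oplus>\<^bsub>M\<^esub> m \<in> N" using ax by blast
    have "(x \<otimes> a) \<odot>\<^bsub>M\<^esub> g \<oplus>\<^bsub>M\<^esub> x \<odot>\<^bsub>M\<^esub> m = x \<odot>\<^bsub>M\<^esub> (a \<odot>\<^bsub>M\<^esub> g \<oplus>\<^bsub>M\<^esub> m)"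
      using that m Gc[OF G'] g by (simp add: smult_r_distr smult_assoc1)
    moreover have "\<dots> \<in> N" using m that N' by blast
    ultimately have "(x \<otimes> a) \<odot>\<^bsub>M\<^esub> g \<oplus>\<^bsub>M\<^esub> x \<odot>\<^bsub>M\<^esub> m \<in> N" by simp
    then show ?thesis using that m mspan_smult[OF G'] by blast
  qed
qed auto

lemma submodule_Int:
  assumes "submodule N R M" "submodule N' R M"
  shows "submodule (N \<inter> N') R M"
proof (rule submoduleI)
  show "\<zero>\<^bsub>M\<^esub> \<in> N \<inter> N'"
    using assms[THEN submodule.axioms(1), THEN subgroup.one_closed] by simp
qed (use submoduleE[OF assms(1)] submoduleE[OF assms(2)] in auto)

lemma mspan_finite_support:
  assumes "x \<in> mspan G"
  shows "\<exists>H. finite H \<and> H \<subseteq> G \<and> x \<in> mspan H"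
  using assms
proof induction
  case zero
  show ?case by (intro exI[of _ "{}"]) (auto intro: mspan.zero)
next
  case (step g r x)
  then obtain H where H: "finite H" "H \<subseteq> G" "x \<in> mspan H" by blast
  have "x \<in> mspan (insert g H)"
    using H(3) by induction (auto intro: mspan.intros)
  then have "r \<odot>\<^bsub>M\<^esub> g \<oplus>\<^bsub>M\<^esub> x \<in> mspan (insert g H)" using step by (intro mspan.step) auto
  then show ?case using H step by (intro exI[of _ "insert g H"]) auto
qed

text \<open>Induction on the generators: lift generators of the coefficient ideal of
  \<open>g\<close> to elements of \<open>N\<close>. Subtracting a combination of these lifts from an
  element of \<open>N\<close> removes its \<open>g\<close>-part, and what remains lies in
  \<open>N \<inter> mspan G\<close>, where the induction hypothesis applies.\<close>

theorem submodule_of_finite_mspan: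
  assumes noeth: "noetherian_ring R" and G: "finite G" "G \<subseteq> carrier M"
    and N: "submodule N R M" "N \<subseteq> mspan G"
  shows "\<exists>H. finite H \<and> H \<subseteq> N \<and> N = mspan H"
  using G N
proof (induction G arbitrary: N)
  case empty
  have "x = \<zero>\<^bsub>M\<^esub>" if "x \<in> mspan {}" for x
    using that by cases auto
  then have "N \<subseteq> mspan {}" "N = {\<zero>\<^bsub>M\<^esub>}" using empty submoduleE(2)[OF empty(2)] by auto
  then show ?case using mspan.zero mspan_least[OF empty(2), of "{}"] by (intro exI[of _ "{}"]) auto
next
  case (insert g G N)
  interpret noetherian_ring R by fact
  have gG: "insert g G \<subseteq> carrier M" and G: "G \<subseteq> carrier M" and g: "g \<in> carrier M" using insert by auto
  have Nc: "N \<subseteq> carrier M" using submoduleE(1)[OF insert(5)] .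
  let ?I = "\<lambda>N. {r \<in> carrier R. \<exists>m\<in>mspan G. r \<odot>\<^bsub>M\<^esub> g \<oplus>\<^bsub>M\<^esub> m \<in> N}"
  obtain A where A: "A \<subseteq> carrier R" "finite A" "?I N = Idl A"
    using finetely_gen[OF coefficient_ideal[OF gG insert(5)]] by blast
  have "\<exists>m\<in>mspan G. a \<odot>\<^bsub>M\<^esub> g \<oplus>\<^bsub>M\<^esub> m \<in> N" if "a \<in> A" for a
    using A genideal_self[OF A(1)] that by blast
  then obtain h where h: "\<And>a. a \<in> A \<Longrightarrow> h a \<in> mspan G \<and> a \<odot>\<^bsub>M\<^esub> g \<oplus>\<^bsub>M\<^esub> h a \<in> N" by metis
  have sub': "submodule (N \<inter> mspan G) R M"
    by (rule submodule_Int[OF insert(5) mspan_submodule[OF G]])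
  obtain H where H: "finite H" "H \<subseteq> N \<inter> mspan G" "N \<inter> mspan G = mspan H"
    using insert.IH[OF G sub'] by blast
  define K where "K = (\<lambda>a. a \<odot>\<^bsub>M\<^esub> g \<oplus>\<^bsub>M\<^esub> h a) ` A \<union> H"
  have K: "finite K" "K \<subseteq> N" using A(2) H h unfolding K_def by auto
  have Kc: "K \<subseteq> carrier M" using K Nc by blast
  have KN: "mspan K \<subseteq> N" using mspan_least[OF insert(5) K(2)] .
  \<comment> \<open>Both coefficient sets are ideals, so they need to be compared only on the
    generators \<open>A\<close>.\<close>
  have "A \<subseteq> ?I (mspan K)"
    using h A(1) mspan_superset[OF Kc] unfolding K_def by blast
  then have IK: "?I N \<subseteq> ?I (mspan K)"
    unfolding A(3) by (intro genideal_minimal coefficient_ideal[OF gG] mspan_submodule[OF Kc])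
  have "N \<subseteq> mspan K"
  proof
    fix n assume n: "n \<in> N"
    obtain r m where rm: "r \<in> carrier R" "m \<in> mspan G" "n = r \<odot>\<^bsub>M\<^esub> g \<oplus>\<^bsub>M\<^esub> m"
      using mspan_insert[OF gG] insert(6) n by blast
    then have "r \<in> ?I N" using n by blast
    then obtain m' where m': "m' \<in> mspan G" "r \<odot>\<^bsub>M\<^esub> g \<oplus>\<^bsub>M\<^esub> m' \<in> mspan K" using IK by blast
    have c: "m \<in> carrier M" "m' \<in> carrier M" using rm m' mspan_closed[OF G] by auto
    have eq: "n = (r \<odot>\<^bsub>M\<^esub> g \<oplus>\<^bsub>M\<^esub> m') \<oplus>\<^bsub>M\<^esub> (m \<oplus>\<^bsub>M\<^esub> \<ominus>\<^bsub>M\<^esub> m')"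
      using c g rm by (simp add: M.a_assoc M.a_lcomm[of m' m] M.r_neg)
    have "m \<oplus>\<^bsub>M\<^esub> \<ominus>\<^bsub>M\<^esub> m' = n \<oplus>\<^bsub>M\<^esub> \<ominus>\<^bsub>M\<^esub> (r \<odot>\<^bsub>M\<^esub> g \<oplus>\<^bsub>M\<^esub> m')"
      using c g rm by (simp add: M.minus_add M.a_ac M.r_neg1 M.r_neg)
    moreover have "\<dots> \<in> N"
      using n m'(2) KN submoduleE[OF insert(5)] by blast
    moreover have "m \<oplus>\<^bsub>M\<^esub> \<ominus>\<^bsub>M\<^esub> m' \<in> mspan G"
      using rm m' submoduleE[OF mspan_submodule[OF G]] by blast
    ultimately have "m \<oplus>\<^bsub>M\<^esub> \<ominus>\<^bsub>M\<^esub> m' \<in> mspan H" using H by auto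
    then have "m \<oplus>\<^bsub>M\<^esub> \<ominus>\<^bsub>M\<^esub> m' \<in> mspan K" using mspan_mono[of H K] Kc unfolding K_def by blast
    then show "n \<in> mspan K" using eq m'(2) mspan_add[OF Kc] by simp
  qed
  then show ?case using K KN by blast
qed

lemma finitely_generated_mspan:
  assumes "finitely_generated_module R M"
  obtains G where "finite G" "G \<subseteq> carrier M" "carrier M = mspan G"
proof -
  obtain G where G: "finite G" "G \<subseteq> carrier M"
    "\<And>x. x \<in> carrier M \<Longrightarrow> \<exists>c\<in>G \<rightarrow> carrier R. x = (\<Oplus>\<^bsub>M\<^esub>g\<in>G. c g \<odot>\<^bsub>M\<^esub> g)"
    using assms unfolding finitely_generated_module_def by blast
  have fs: "(\<Oplus>\<^bsub>M\<^esub>g\<in>H. c g \<odot>\<^bsub>M\<^esub> g) \<in> mspan G" if "finite H" "H \<subseteq> G" "c \<in> G \<rightarrow> carrier R" for H c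
    using that
  proof (induction H)
    case (insert h H)
    then have "(\<Oplus>\<^bsub>M\<^esub>g\<in>insert h H. c g \<odot>\<^bsub>M\<^esub> g) = c h \<odot>\<^bsub>M\<^esub> h \<oplus>\<^bsub>M\<^esub> (\<Oplus>\<^bsub>M\<^esub>g\<in>H. c g \<odot>\<^bsub>M\<^esub> g)"
      using G(2) by (intro M.finsum_insert) (auto simp: Pi_iff subset_iff)
    then show ?case using insert by (auto intro!: mspan.step)
  qed (auto intro: mspan.zero)
  have "carrier M \<subseteq> mspan G" using G(3) fs[OF G(1) order_refl] by auto
  then show ?thesis using that[OF G(1,2)] mspan_closed[OF G(2)] by blast
qed

text \<open>The span of the whole sequence is finitely generated, and finitely many generators
  involve only finitely many terms. For the powers of an endomorphism this is an integral
  equation.\<close>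

lemma noetherian_sequence:
  fixes w :: "nat \<Rightarrow> 'c"
  assumes noeth: "noetherian_ring R" and fg: "finitely_generated_module R M"
    and w: "\<And>n. w n \<in> carrier M"
  shows "\<exists>n. w n \<in> mspan (w ` {..<n})"
proof -
  obtain G where G: "finite G" "G \<subseteq> carrier M" "carrier M = mspan G"
    using finitely_generated_mspan[OF fg] .
  have rw: "range w \<subseteq> carrier M" using w by auto
  obtain H where H: "finite H" "H \<subseteq> mspan (range w)" "mspan (range w) = mspan H"
    using submodule_of_finite_mspan[OF noeth G(1,2) mspan_submodule[OF rw]] mspan_closed[OF rw] G(3) by blast
  have "\<exists>n. H \<subseteq> mspan (w ` {..<n})"
    using H(1,2)
  proof (induction H)
    case (insert h H)
    then obtain n where n: "H \<subseteq> mspan (w ` {..<n})" by auto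
    obtain K where K: "finite K" "K \<subseteq> range w" "h \<in> mspan K"
      using mspan_finite_support insert by (meson insert_subset)
    obtain J where J: "finite J" "K = w ` J" using finite_subset_image[OF K(1,2)] by blast
    define m where "m = max n (Suc (Max (insert 0 J)))"
    have "J \<subseteq> {..<m}" using J(1) unfolding m_def by (auto simp: less_max_iff_disj less_Suc_eq_le)
    then have "mspan K \<subseteq> mspan (w ` {..<m})" using J w by (intro mspan_mono) auto
    moreover have "mspan (w ` {..<n}) \<subseteq> mspan (w ` {..<m})"
      using w unfolding m_def by (intro mspan_mono) auto
    ultimately show ?case using n K by blast
  qed auto
  then obtain n where n: "H \<subseteq> mspan (w ` {..<n})" by blast
  have "mspan H \<subseteq> mspan (w ` {..<n})"
    by (rule mspan_least[OF mspan_submodule n]) (use w in auto)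
  then have "w n \<in> mspan (w ` {..<n})" using H(3) mspan_superset[OF rw] by blast
  then show ?thesis ..
qed

text \<open>The torsion submodule is finitely generated, so a product of annihilators of its
  generators kills all of it.\<close>

lemma torsion_annihilator:
  assumes noeth: "noetherian_ring R" and dom: "domain R" and fg: "finitely_generated_module R M"
  shows "\<exists>t\<in>carrier R - {\<zero>}. \<forall>r\<in>carrier R - {\<zero>}. \<forall>x\<in>carrier M. r \<odot>\<^bsub>M\<^esub> x = \<zero>\<^bsub>M\<^esub> \<longrightarrow> t \<odot>\<^bsub>M\<^esub> x = \<zero>\<^bsub>M\<^esub>"
proof -
  interpret domain R by fact
  define N where "N = {x \<in> carrier M. \<exists>r\<in>carrier R - {\<zero>}. r \<odot>\<^bsub>M\<^esub> x = \<zero>\<^bsub>M\<^esub>}"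
  have N: "submodule N R M"
  proof (rule submoduleI)
    show "\<zero>\<^bsub>M\<^esub> \<in> N" unfolding N_def by (auto intro!: bexI[of _ \<one>])
    show smult: "a \<odot>\<^bsub>M\<^esub> x \<in> N" if a: "a \<in> carrier R" "x \<in> N" for a x
    proof -
      obtain r where r: "r \<in> carrier R - {\<zero>}" "r \<odot>\<^bsub>M\<^esub> x = \<zero>\<^bsub>M\<^esub>" "x \<in> carrier M" using a unfolding N_def by blast
      have "r \<odot>\<^bsub>M\<^esub> (a \<odot>\<^bsub>M\<^esub> x) = a \<odot>\<^bsub>M\<^esub> (r \<odot>\<^bsub>M\<^esub> x)"
        using r a by (metis Diff_iff m_comm smult_assoc1)
      then show ?thesis using r a unfolding N_def by auto
    qed
    show "\<ominus>\<^bsub>M\<^esub> x \<in> N" if "x \<in> N" for x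
      using smult[of "\<ominus> \<one>" x] that smult_l_minus[of \<one> x] unfolding N_def by auto
    show "x \<oplus>\<^bsub>M\<^esub> y \<in> N" if xy: "x \<in> N" "y \<in> N" for x y
    proof -
      obtain r t where r: "r \<in> carrier R - {\<zero>}" "r \<odot>\<^bsub>M\<^esub> x = \<zero>\<^bsub>M\<^esub>" "x \<in> carrier M"
        "t \<in> carrier R - {\<zero>}" "t \<odot>\<^bsub>M\<^esub> y = \<zero>\<^bsub>M\<^esub>" "y \<in> carrier M" using xy unfolding N_def by blast
      have "(t \<otimes> r) \<odot>\<^bsub>M\<^esub> x = \<zero>\<^bsub>M\<^esub>" "(r \<otimes> t) \<odot>\<^bsub>M\<^esub> y = \<zero>\<^bsub>M\<^esub>" using r by (auto simp: smult_assoc1)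
      then have "(r \<otimes> t) \<odot>\<^bsub>M\<^esub> (x \<oplus>\<^bsub>M\<^esub> y) = \<zero>\<^bsub>M\<^esub>" using r by (simp add: smult_r_distr m_comm)
      moreover have "r \<otimes> t \<in> carrier R - {\<zero>}" using r integral_iff by auto
      ultimately show ?thesis using r unfolding N_def by blast
    qed
  qed (auto simp: N_def)
  obtain G where G: "finite G" "G \<subseteq> carrier M" "carrier M = mspan G"
    using finitely_generated_mspan[OF fg] .
  obtain H where H: "finite H" "H \<subseteq> N" "N = mspan H"
    using submodule_of_finite_mspan[OF noeth G(1,2) N] G(3) unfolding N_def by auto
  have "\<exists>t\<in>carrier R - {\<zero>}. \<forall>x\<in>H. t \<odot>\<^bsub>M\<^esub> x = \<zero>\<^bsub>M\<^esub>"
    using H(1,2)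
  proof (induction H)
    case (insert h H)
    then obtain t r where t: "t \<in> carrier R - {\<zero>}" "\<forall>x\<in>H. t \<odot>\<^bsub>M\<^esub> x = \<zero>\<^bsub>M\<^esub>"
      "r \<in> carrier R - {\<zero>}" "r \<odot>\<^bsub>M\<^esub> h = \<zero>\<^bsub>M\<^esub>" "h \<in> carrier M" "H \<subseteq> carrier M"
      unfolding N_def by auto
    have "(r \<otimes> t) \<odot>\<^bsub>M\<^esub> x = \<zero>\<^bsub>M\<^esub>" if "x \<in> insert h H" for x
    proof (cases "x = h")
      case True
      have "(t \<otimes> r) \<odot>\<^bsub>M\<^esub> h = \<zero>\<^bsub>M\<^esub>" using t by (simp add: smult_assoc1)
      then show ?thesis using True t m_comm by auto
    next
      case False
      then show ?thesis using t that by (auto simp: smult_assoc1 subset_iff)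
    qed
    moreover have "r \<otimes> t \<in> carrier R - {\<zero>}" using t integral_iff by auto
    ultimately show ?case by blast
  qed auto
  then obtain t where t: "t \<in> carrier R - {\<zero>}" "\<forall>x\<in>H. t \<odot>\<^bsub>M\<^esub> x = \<zero>\<^bsub>M\<^esub>" by blast
  have Hc: "H \<subseteq> carrier M" using H(2) unfolding N_def by auto
  have "t \<odot>\<^bsub>M\<^esub> x = \<zero>\<^bsub>M\<^esub>" if "x \<in> mspan H" for x
    using that
  proof induction
    case (step g r x)
    have "t \<odot>\<^bsub>M\<^esub> (r \<odot>\<^bsub>M\<^esub> g) = r \<odot>\<^bsub>M\<^esub> (t \<odot>\<^bsub>M\<^esub> g)"
      using t step Hc by (metis Diff_iff m_comm smult_assoc1 subsetD)
    then show ?case using step t Hc mspan_closed[OF Hc] by (auto simp: smult_r_distr subset_iff)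
  qed (use t in auto)
  then have "\<forall>r\<in>carrier R - {\<zero>}. \<forall>x\<in>carrier M. r \<odot>\<^bsub>M\<^esub> x = \<zero>\<^bsub>M\<^esub> \<longrightarrow> t \<odot>\<^bsub>M\<^esub> x = \<zero>\<^bsub>M\<^esub>"
    using H(3) unfolding N_def by blast
  then show ?thesis using t by blast
qed

end

section \<open>Preadditive categories\<close>

context preadditive_category begin

lemma hom_add_closed [simp]:
  "A \<in> Obj C \<Longrightarrow> B \<in> Obj C \<Longrightarrow> f \<in> Mor C A B \<Longrightarrow> g \<in> Mor C A B \<Longrightarrow> f \<oplus>\<^bsub>Hom C A B\<^esub> g \<in> Mor C A B"
  using abelian_groupE(1)[OF hom_abelian_group] .

lemma hom_zero_closed [simp]: "A \<in> Obj C \<Longrightarrow> B \<in> Obj C \<Longrightarrow> \<zero>\<^bsub>Hom C A B\<^esub> \<in> Mor C A B"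
  using abelian_groupE(2)[OF hom_abelian_group] .

lemma hom_neg_closed [simp]:
  "A \<in> Obj C \<Longrightarrow> B \<in> Obj C \<Longrightarrow> f \<in> Mor C A B \<Longrightarrow> \<ominus>\<^bsub>Hom C A B\<^esub> f \<in> Mor C A B"
  using abelian_group.a_inv_closed[OF hom_abelian_group] .

lemma hom_l_zero [simp]:
  "A \<in> Obj C \<Longrightarrow> B \<in> Obj C \<Longrightarrow> f \<in> Mor C A B \<Longrightarrow> \<zero>\<^bsub>Hom C A B\<^esub> \<oplus>\<^bsub>Hom C A B\<^esub> f = f"
  using abelian_monoid.l_zero[OF abelian_group.axioms(1)[OF hom_abelian_group]] .

lemma hom_r_zero [simp]:
  "A \<in> Obj C \<Longrightarrow> B \<in> Obj C \<Longrightarrow> f \<in> Mor C A B \<Longrightarrow> f \<oplus>\<^bsub>Hom C A B\<^esub> \<zero>\<^bsub>Hom C A B\<^esub> = f"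
  using abelian_monoid.r_zero[OF abelian_group.axioms(1)[OF hom_abelian_group]] .

lemma hom_r_neg [simp]:
  "A \<in> Obj C \<Longrightarrow> B \<in> Obj C \<Longrightarrow> f \<in> Mor C A B \<Longrightarrow> f \<oplus>\<^bsub>Hom C A B\<^esub> \<ominus>\<^bsub>Hom C A B\<^esub> f = \<zero>\<^bsub>Hom C A B\<^esub>"
  using abelian_group.r_neg[OF hom_abelian_group] .

lemma hom_l_neg [simp]:
  "A \<in> Obj C \<Longrightarrow> B \<in> Obj C \<Longrightarrow> f \<in> Mor C A B \<Longrightarrow> \<ominus>\<^bsub>Hom C A B\<^esub> f \<oplus>\<^bsub>Hom C A B\<^esub> f = \<zero>\<^bsub>Hom C A B\<^esub>"
  using abelian_group.l_neg[OF hom_abelian_group] .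

lemma hom_r_neg1 [simp]:
  "A \<in> Obj C \<Longrightarrow> B \<in> Obj C \<Longrightarrow> f \<in> Mor C A B \<Longrightarrow> g \<in> Mor C A B \<Longrightarrow>
    \<ominus>\<^bsub>Hom C A B\<^esub> f \<oplus>\<^bsub>Hom C A B\<^esub> (f \<oplus>\<^bsub>Hom C A B\<^esub> g) = g"
  using abelian_group.r_neg1[OF hom_abelian_group] .

lemma hom_r_neg2 [simp]:
  "A \<in> Obj C \<Longrightarrow> B \<in> Obj C \<Longrightarrow> f \<in> Mor C A B \<Longrightarrow> g \<in> Mor C A B \<Longrightarrow>
    f \<oplus>\<^bsub>Hom C A B\<^esub> (\<ominus>\<^bsub>Hom C A B\<^esub> f \<oplus>\<^bsub>Hom C A B\<^esub> g) = g"
  using abelian_group.r_neg2[OF hom_abelian_group] .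

lemma hom_minus_minus [simp]:
  "A \<in> Obj C \<Longrightarrow> B \<in> Obj C \<Longrightarrow> f \<in> Mor C A B \<Longrightarrow> \<ominus>\<^bsub>Hom C A B\<^esub> (\<ominus>\<^bsub>Hom C A B\<^esub> f) = f"
  using abelian_group.minus_minus[OF hom_abelian_group] .

lemma hom_minus_zero [simp]:
  "A \<in> Obj C \<Longrightarrow> B \<in> Obj C \<Longrightarrow> \<ominus>\<^bsub>Hom C A B\<^esub> \<zero>\<^bsub>Hom C A B\<^esub> = \<zero>\<^bsub>Hom C A B\<^esub>"
  by (metis hom_l_neg hom_neg_closed hom_r_zero hom_zero_closed)

lemma hom_minus_add:
  "A \<in> Obj C \<Longrightarrow> B \<in> Obj C \<Longrightarrow> f \<in> Mor C A B \<Longrightarrow> g \<in> Mor C A B \<Longrightarrow>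
    \<ominus>\<^bsub>Hom C A B\<^esub> (f \<oplus>\<^bsub>Hom C A B\<^esub> g) = \<ominus>\<^bsub>Hom C A B\<^esub> f \<oplus>\<^bsub>Hom C A B\<^esub> \<ominus>\<^bsub>Hom C A B\<^esub> g"
  using abelian_group.minus_add[OF hom_abelian_group] .

lemma hom_a_assoc:
  "A \<in> Obj C \<Longrightarrow> B \<in> Obj C \<Longrightarrow> f \<in> Mor C A B \<Longrightarrow> g \<in> Mor C A B \<Longrightarrow> h \<in> Mor C A B \<Longrightarrow>
    f \<oplus>\<^bsub>Hom C A B\<^esub> g \<oplus>\<^bsub>Hom C A B\<^esub> h = f \<oplus>\<^bsub>Hom C A B\<^esub> (g \<oplus>\<^bsub>Hom C A B\<^esub> h)"
  using abelian_monoid.a_assoc[OF abelian_group.axioms(1)[OF hom_abelian_group]] .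

lemma hom_a_comm:
  "A \<in> Obj C \<Longrightarrow> B \<in> Obj C \<Longrightarrow> f \<in> Mor C A B \<Longrightarrow> g \<in> Mor C A B \<Longrightarrow>
    f \<oplus>\<^bsub>Hom C A B\<^esub> g = g \<oplus>\<^bsub>Hom C A B\<^esub> f"
  using abelian_monoid.a_comm[OF abelian_group.axioms(1)[OF hom_abelian_group]] .

lemma hom_a_lcomm:
  "A \<in> Obj C \<Longrightarrow> B \<in> Obj C \<Longrightarrow> f \<in> Mor C A B \<Longrightarrow> g \<in> Mor C A B \<Longrightarrow> h \<in> Mor C A B \<Longrightarrow>
    f \<oplus>\<^bsub>Hom C A B\<^esub> (g \<oplus>\<^bsub>Hom C A B\<^esub> h) = g \<oplus>\<^bsub>Hom C A B\<^esub> (f \<oplus>\<^bsub>Hom C A B\<^esub> h)"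
  using abelian_monoid.a_lcomm[OF abelian_group.axioms(1)[OF hom_abelian_group]] .

lemmas hom_a_ac = hom_a_assoc hom_a_comm hom_a_lcomm

lemma hom_add_eq_zeroD:
  "A \<in> Obj C \<Longrightarrow> B \<in> Obj C \<Longrightarrow> f \<in> Mor C A B \<Longrightarrow> g \<in> Mor C A B \<Longrightarrow>
    f \<oplus>\<^bsub>Hom C A B\<^esub> g = \<zero>\<^bsub>Hom C A B\<^esub> \<Longrightarrow> g = \<ominus>\<^bsub>Hom C A B\<^esub> f"
  by (metis hom_a_comm hom_neg_closed hom_r_neg1 hom_r_zero)

lemma hom_idem_zero:
  "A \<in> Obj C \<Longrightarrow> B \<in> Obj C \<Longrightarrow> f \<in> Mor C A B \<Longrightarrow> f \<oplus>\<^bsub>Hom C A B\<^esub> f = f \<Longrightarrow> f = \<zero>\<^bsub>Hom C A B\<^esub>"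
  by (metis hom_l_neg hom_r_neg1)

declare comp_closed [simp] ident_closed [simp] comp_ident_left [simp] comp_ident_right [simp]

lemma comp_zero_left [simp]:
  assumes "A \<in> Obj C" "B \<in> Obj C" "D \<in> Obj C" "f \<in> Mor C A B"
  shows "Comp C A B D \<zero>\<^bsub>Hom C B D\<^esub> f = \<zero>\<^bsub>Hom C A D\<^esub>"
  using comp_add_left[of A B D f "\<zero>\<^bsub>Hom C B D\<^esub>" "\<zero>\<^bsub>Hom C B D\<^esub>"] assms
  by (intro hom_idem_zero) auto

lemma comp_zero_right [simp]:
  assumes "A \<in> Obj C" "B \<in> Obj C" "D \<in> Obj C" "g \<in> Mor C B D"
  shows "Comp C A B D g \<zero>\<^bsub>Hom C A B\<^esub> = \<zero>\<^bsub>Hom C A D\<^esub>"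
  using comp_add_right[of A B D "\<zero>\<^bsub>Hom C A B\<^esub>" "\<zero>\<^bsub>Hom C A B\<^esub>" g] assms
  by (intro hom_idem_zero) auto

lemma comp_neg_left [simp]:
  assumes "A \<in> Obj C" "B \<in> Obj C" "D \<in> Obj C" "f \<in> Mor C A B" "g \<in> Mor C B D"
  shows "Comp C A B D (\<ominus>\<^bsub>Hom C B D\<^esub> g) f = \<ominus>\<^bsub>Hom C A D\<^esub> Comp C A B D g f"
  using comp_add_left[of A B D f g "\<ominus>\<^bsub>Hom C B D\<^esub> g"] assms
  by (intro hom_add_eq_zeroD) auto

lemma comp_neg_right [simp]:
  assumes "A \<in> Obj C" "B \<in> Obj C" "D \<in> Obj C" "f \<in> Mor C A B" "g \<in> Mor C B D"
  shows "Comp C A B D g (\<ominus>\<^bsub>Hom C A B\<^esub> f) = \<ominus>\<^bsub>Hom C A D\<^esub> Comp C A B D g f"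
  using comp_add_right[of A B D f "\<ominus>\<^bsub>Hom C A B\<^esub> f" g] assms
  by (intro hom_add_eq_zeroD) auto

lemma comp_assoc_left:
  "\<lbrakk>A \<in> Obj C; B \<in> Obj C; D \<in> Obj C; E \<in> Obj C; f \<in> Mor C A B; g \<in> Mor C B D; h \<in> Mor C D E\<rbrakk> \<Longrightarrow>
    Comp C A B E (Comp C B D E h g) f = Comp C A D E h (Comp C A B D g f)"
  using comp_assoc by simp

lemma hom_diff_eq:
  assumes "A \<in> Obj C" "B \<in> Obj C" "f \<in> Mor C A B" "g \<in> Mor C A B" "h \<in> Mor C A B" "k \<in> Mor C A B"
    and "f \<oplus>\<^bsub>Hom C A B\<^esub> g = h \<oplus>\<^bsub>Hom C A B\<^esub> k"
  shows "f \<oplus>\<^bsub>Hom C A B\<^esub> \<ominus>\<^bsub>Hom C A B\<^esub> h = k \<oplus>\<^bsub>Hom C A B\<^esub> \<ominus>\<^bsub>Hom C A B\<^esub> g"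
proof -
  have "f = (h \<oplus>\<^bsub>Hom C A B\<^esub> k) \<oplus>\<^bsub>Hom C A B\<^esub> \<ominus>\<^bsub>Hom C A B\<^esub> g"
    using assms(1-6) by (simp add: hom_a_assoc flip: assms(7))
  moreover have "f \<oplus>\<^bsub>Hom C A B\<^esub> \<ominus>\<^bsub>Hom C A B\<^esub> h = \<ominus>\<^bsub>Hom C A B\<^esub> h \<oplus>\<^bsub>Hom C A B\<^esub> f"
    using assms(1-6) by (simp add: hom_a_comm)
  ultimately have "f \<oplus>\<^bsub>Hom C A B\<^esub> \<ominus>\<^bsub>Hom C A B\<^esub> h = \<ominus>\<^bsub>Hom C A B\<^esub> h \<oplus>\<^bsub>Hom C A B\<^esub> (h \<oplus>\<^bsub>Hom C A B\<^esub> (k \<oplus>\<^bsub>Hom C A B\<^esub> \<ominus>\<^bsub>Hom C A B\<^esub> g))"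
    using assms(1-6) by (simp only: hom_a_assoc hom_neg_closed)
  then show ?thesis using assms(1-6) by simp
qed

lemma is_direct_sum_pair:
  "is_direct_sum C [A, B] M \<longleftrightarrow> A \<in> Obj C \<and> B \<in> Obj C \<and> M \<in> Obj C \<and>
    (\<exists>i\<in>Mor C A M. \<exists>j\<in>Mor C B M. \<exists>p\<in>Mor C M A. \<exists>q\<in>Mor C M B.
      Comp C A M A p i = Ident C A \<and> Comp C B M B q j = Ident C B \<and>
      Comp C B M A p j = \<zero>\<^bsub>Hom C B A\<^esub> \<and> Comp C A M B q i = \<zero>\<^bsub>Hom C A B\<^esub> \<and>
      Comp C M A M i p \<oplus>\<^bsub>Hom C M M\<^esub> Comp C M B M j q = Ident C M)" (is "?L \<longleftrightarrow> ?R")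
proof (cases "A \<in> Obj C \<and> B \<in> Obj C \<and> M \<in> Obj C")
  case True
  interpret M: abelian_group "Hom C M M" using True hom_abelian_group by blast
  have two: "(\<forall>i<length [A, B]. P i) \<longleftrightarrow> P 0 \<and> P 1" for P
    by (auto simp: less_Suc_eq)
  have set2: "{..<length [A, B]} = {0, 1}" by auto
  have fs: "(\<Oplus>\<^bsub>Hom C M M\<^esub>i\<in>{..<length [A, B]}. h i) = h 0 \<oplus>\<^bsub>Hom C M M\<^esub> h 1"
    if "h 0 \<in> Mor C M M" "h 1 \<in> Mor C M M" for h
    unfolding set2 using that by simp
  show ?thesis
  proof
    assume ?L
    then obtain \<iota> \<pi> where h:
      "\<forall>i<length [A, B]. \<iota> i \<in> Mor C ([A, B] ! i) M \<and> \<pi> i \<in> Mor C M ([A, B] ! i)"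
      "\<forall>i<length [A, B]. \<forall>j<length [A, B]. Comp C ([A, B] ! i) M ([A, B] ! j) (\<pi> j) (\<iota> i) =
         (if i = j then Ident C ([A, B] ! i) else \<zero>\<^bsub>Hom C ([A, B] ! i) ([A, B] ! j)\<^esub>)"
      "(\<Oplus>\<^bsub>Hom C M M\<^esub>i\<in>{..<length [A, B]}. Comp C M ([A, B] ! i) M (\<iota> i) (\<pi> i)) = Ident C M"
      unfolding is_direct_sum_def by blast
    have m: "\<iota> 0 \<in> Mor C A M" "\<iota> 1 \<in> Mor C B M" "\<pi> 0 \<in> Mor C M A" "\<pi> 1 \<in> Mor C M B"
      using h(1) unfolding two by auto
    have "Comp C M A M (\<iota> 0) (\<pi> 0) \<oplus>\<^bsub>Hom C M M\<^esub> Comp C M B M (\<iota> 1) (\<pi> 1) = Ident C M"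
      using h(3) m True by (subst (asm) fs) auto
    then show ?R using True m h(2) unfolding two
      by (intro conjI bexI[of _ "\<iota> 0"] bexI[of _ "\<iota> 1"] bexI[of _ "\<pi> 0"] bexI[of _ "\<pi> 1"]) auto
  next
    assume ?R
    then obtain i j p q where h: "i \<in> Mor C A M" "j \<in> Mor C B M" "p \<in> Mor C M A" "q \<in> Mor C M B"
      "Comp C A M A p i = Ident C A" "Comp C B M B q j = Ident C B"
      "Comp C B M A p j = \<zero>\<^bsub>Hom C B A\<^esub>" "Comp C A M B q i = \<zero>\<^bsub>Hom C A B\<^esub>"
      "Comp C M A M i p \<oplus>\<^bsub>Hom C M M\<^esub> Comp C M B M j q = Ident C M" by blast
    show ?L
      unfolding is_direct_sum_def two
      by (intro conjI exI[of _ "\<lambda>k. if k = 0 then i else j"] exI[of _ "\<lambda>k. if k = 0 then p else q"])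
        (use True h in \<open>auto simp: fs[simplified]\<close>)
  qed
qed (auto simp: is_direct_sum_def)

lemma direct_sum_pair_unique:
  assumes "is_direct_sum C [A, B] M" "is_direct_sum C [A, B] N"
  shows "isomorphic_objs C M N"
proof -
  obtain i j p q i' j' p' q' where m [simp]: "A \<in> Obj C" "B \<in> Obj C" "M \<in> Obj C" "N \<in> Obj C"
    "i \<in> Mor C A M" "j \<in> Mor C B M" "p \<in> Mor C M A" "q \<in> Mor C M B"
    "i' \<in> Mor C A N" "j' \<in> Mor C B N" "p' \<in> Mor C N A" "q' \<in> Mor C N B"
    and e: "Comp C A M A p i = Ident C A" "Comp C B M B q j = Ident C B"
      "Comp C B M A p j = \<zero>\<^bsub>Hom C B A\<^esub>" "Comp C A M B q i = \<zero>\<^bsub>Hom C A B\<^esub>"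
      "Comp C M A M i p \<oplus>\<^bsub>Hom C M M\<^esub> Comp C M B M j q = Ident C M"
      "Comp C A N A p' i' = Ident C A" "Comp C B N B q' j' = Ident C B"
      "Comp C B N A p' j' = \<zero>\<^bsub>Hom C B A\<^esub>" "Comp C A N B q' i' = \<zero>\<^bsub>Hom C A B\<^esub>"
      "Comp C N A N i' p' \<oplus>\<^bsub>Hom C N N\<^esub> Comp C N B N j' q' = Ident C N"
    using assms unfolding is_direct_sum_pair by blast
  \<comment> \<open>Each biproduct equation precomposed with an arbitrary map:
    \<open>comp_assoc_left\<close> nests compositions to the right, where the bare equations would
    not match.\<close>
  have e2: "\<And>K f. K \<in> Obj C \<Longrightarrow> f \<in> Mor C K A \<Longrightarrow> Comp C K M A p (Comp C K A M i f) = f"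
    "\<And>K f. K \<in> Obj C \<Longrightarrow> f \<in> Mor C K B \<Longrightarrow> Comp C K M B q (Comp C K B M j f) = f"
    "\<And>K f. K \<in> Obj C \<Longrightarrow> f \<in> Mor C K B \<Longrightarrow> Comp C K M A p (Comp C K B M j f) = \<zero>\<^bsub>Hom C K A\<^esub>"
    "\<And>K f. K \<in> Obj C \<Longrightarrow> f \<in> Mor C K A \<Longrightarrow> Comp C K M B q (Comp C K A M i f) = \<zero>\<^bsub>Hom C K B\<^esub>"
    "\<And>K f. K \<in> Obj C \<Longrightarrow> f \<in> Mor C K A \<Longrightarrow> Comp C K N A p' (Comp C K A N i' f) = f"
    "\<And>K f. K \<in> Obj C \<Longrightarrow> f \<in> Mor C K B \<Longrightarrow> Comp C K N B q' (Comp C K B N j' f) = f"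
    "\<And>K f. K \<in> Obj C \<Longrightarrow> f \<in> Mor C K B \<Longrightarrow> Comp C K N A p' (Comp C K B N j' f) = \<zero>\<^bsub>Hom C K A\<^esub>"
    "\<And>K f. K \<in> Obj C \<Longrightarrow> f \<in> Mor C K A \<Longrightarrow> Comp C K N B q' (Comp C K A N i' f) = \<zero>\<^bsub>Hom C K B\<^esub>"
    by (simp_all add: comp_assoc e)
  let ?f = "Comp C M A N i' p \<oplus>\<^bsub>Hom C M N\<^esub> Comp C M B N j' q"
  let ?g = "Comp C N A M i p' \<oplus>\<^bsub>Hom C N M\<^esub> Comp C N B M j q'"
  have "Comp C M N M ?g ?f = Ident C M" "Comp C N M N ?f ?g = Ident C N"
    by (simp_all add: comp_add_left comp_add_right comp_assoc_left e2 e)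
  then show ?thesis unfolding isomorphic_objs_def
    by (intro conjI bexI[of _ ?f] bexI[of _ ?g]) auto
qed

text \<open>The complement is the image of the idempotent \<open>1 - i p\<close>, which splits by
  full additivity.\<close>

lemma retract_complement:
  assumes fa: "fully_additive C"
    and m [simp]: "A \<in> Obj C" "B \<in> Obj C" "i \<in> Mor C A B" "p \<in> Mor C B A"
    and pi: "Comp C A B A p i = Ident C A"
  shows "\<exists>D\<in>Obj C. \<exists>j\<in>Mor C D B. \<exists>q\<in>Mor C B D. Comp C D B D q j = Ident C D \<and>
    Comp C D B A p j = \<zero>\<^bsub>Hom C D A\<^esub> \<and> Comp C A B D q i = \<zero>\<^bsub>Hom C A D\<^esub> \<and>
    Comp C B A B i p \<oplus>\<^bsub>Hom C B B\<^esub> Comp C B D B j q = Ident C B"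
proof -
  let ?e = "Ident C B \<oplus>\<^bsub>Hom C B B\<^esub> \<ominus>\<^bsub>Hom C B B\<^esub> Comp C B A B i p"
  have pi': "Comp C K B A p (Comp C K A B i f) = f" if "K \<in> Obj C" "f \<in> Mor C K A" for K f
    using that pi by (simp add: comp_assoc)
  have "Comp C B B B ?e ?e = ?e"
    by (simp add: comp_add_left comp_add_right comp_assoc_left pi' hom_minus_add)
  then obtain D q j where D [simp]: "D \<in> Obj C" "q \<in> Mor C B D" "j \<in> Mor C D B"
    and e: "Comp C B D B j q = ?e" "Comp C D B D q j = Ident C D"
    using fa m unfolding fully_additive_def by (metis comp_closed hom_add_closed hom_neg_closed ident_closed)
  have "Comp C D B A p j = Comp C D D A (Comp C D B A p j) (Comp C D B D q j)"
    unfolding e(2) by simp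
  also have "\<dots> = Comp C D B A p (Comp C D B B (Comp C B D B j q) j)"
    by (simp add: comp_assoc_left)
  also have "\<dots> = \<zero>\<^bsub>Hom C D A\<^esub>"
    unfolding e(1) by (simp add: comp_add_left comp_add_right comp_assoc_left pi')
  finally have pj: "Comp C D B A p j = \<zero>\<^bsub>Hom C D A\<^esub>" .
  have "Comp C A B D q i = Comp C A D D (Comp C D B D q j) (Comp C A B D q i)"
    unfolding e(2) by simp
  also have "\<dots> = Comp C A B D q (Comp C A B B (Comp C B D B j q) i)"
    by (simp add: comp_assoc_left)
  also have "\<dots> = \<zero>\<^bsub>Hom C A D\<^esub>"
    unfolding e(1) by (simp add: comp_add_left comp_add_right comp_assoc_left pi pi')
  finally have qi: "Comp C A B D q i = \<zero>\<^bsub>Hom C A D\<^esub>" .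
  have "Comp C B A B i p \<oplus>\<^bsub>Hom C B B\<^esub> Comp C B D B j q = Ident C B"
    unfolding e(1) by (simp add: hom_a_lcomm[of B B "Comp C B A B i p" "Ident C B"])
  then show ?thesis using D e(2) pj qi by blast
qed

lemma retract_direct_summand:
  assumes "fully_additive C" "A \<in> Obj C" "B \<in> Obj C" "i \<in> Mor C A B" "p \<in> Mor C B A"
    and "Comp C A B A p i = Ident C A"
  shows "direct_summand C A B"
  using retract_complement[OF assms] assms unfolding direct_summand_def is_direct_sum_pair by blast

lemma is_direct_sum_dsum_obj:
  assumes "fully_additive C" "A \<in> Obj C" "B \<in> Obj C"
  shows "is_direct_sum C [A, B] (dsum_obj C A B)"
proof -
  have "\<exists>S. is_direct_sum C [A, B] S"
    using assms unfolding fully_additive_def by auto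
  then show ?thesis unfolding dsum_obj_def by (rule someI_ex)
qed

end

section \<open>Maps that are invertible or split at a maximal ideal\<close>

locale linear_category = R_category R C
  for R :: "('r, 'x) ring_scheme" (structure) and C :: "('o, 'r, 'm) category"
begin

lemma hom_smult_closed [simp]:
  "A \<in> Obj C \<Longrightarrow> B \<in> Obj C \<Longrightarrow> r \<in> carrier R \<Longrightarrow> f \<in> Mor C A B \<Longrightarrow> r \<odot>\<^bsub>Hom C A B\<^esub> f \<in> Mor C A B"
  using module.smult_closed[OF hom_module] .

lemma hom_smult_l_distr:
  "A \<in> Obj C \<Longrightarrow> B \<in> Obj C \<Longrightarrow> r \<in> carrier R \<Longrightarrow> s \<in> carrier R \<Longrightarrow> f \<in> Mor C A B \<Longrightarrow>
    (r \<oplus> s) \<odot>\<^bsub>Hom C A B\<^esub> f = r \<odot>\<^bsub>Hom C A B\<^esub> f \<oplus>\<^bsub>Hom C A B\<^esub> s \<odot>\<^bsub>Hom C A B\<^esub> f"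
  using module.smult_l_distr[OF hom_module] .

lemma hom_smult_r_distr:
  "A \<in> Obj C \<Longrightarrow> B \<in> Obj C \<Longrightarrow> r \<in> carrier R \<Longrightarrow> f \<in> Mor C A B \<Longrightarrow> g \<in> Mor C A B \<Longrightarrow>
    r \<odot>\<^bsub>Hom C A B\<^esub> (f \<oplus>\<^bsub>Hom C A B\<^esub> g) = r \<odot>\<^bsub>Hom C A B\<^esub> f \<oplus>\<^bsub>Hom C A B\<^esub> r \<odot>\<^bsub>Hom C A B\<^esub> g"
  using module.smult_r_distr[OF hom_module] .

lemma hom_smult_assoc:
  "A \<in> Obj C \<Longrightarrow> B \<in> Obj C \<Longrightarrow> r \<in> carrier R \<Longrightarrow> s \<in> carrier R \<Longrightarrow> f \<in> Mor C A B \<Longrightarrow>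
    r \<odot>\<^bsub>Hom C A B\<^esub> (s \<odot>\<^bsub>Hom C A B\<^esub> f) = (r \<otimes> s) \<odot>\<^bsub>Hom C A B\<^esub> f"
  using module.smult_assoc1[OF hom_module] by metis

lemma hom_smult_one [simp]:
  "A \<in> Obj C \<Longrightarrow> B \<in> Obj C \<Longrightarrow> f \<in> Mor C A B \<Longrightarrow> \<one> \<odot>\<^bsub>Hom C A B\<^esub> f = f"
  using module.smult_one[OF hom_module] .

lemma hom_smult_l_null [simp]:
  "A \<in> Obj C \<Longrightarrow> B \<in> Obj C \<Longrightarrow> f \<in> Mor C A B \<Longrightarrow> \<zero> \<odot>\<^bsub>Hom C A B\<^esub> f = \<zero>\<^bsub>Hom C A B\<^esub>"
  using module.smult_l_null[OF hom_module] .

lemma hom_smult_r_null [simp]: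
  "A \<in> Obj C \<Longrightarrow> B \<in> Obj C \<Longrightarrow> r \<in> carrier R \<Longrightarrow> r \<odot>\<^bsub>Hom C A B\<^esub> \<zero>\<^bsub>Hom C A B\<^esub> = \<zero>\<^bsub>Hom C A B\<^esub>"
  using module.smult_r_null[OF hom_module] .

lemma hom_smult_l_minus:
  "A \<in> Obj C \<Longrightarrow> B \<in> Obj C \<Longrightarrow> r \<in> carrier R \<Longrightarrow> f \<in> Mor C A B \<Longrightarrow>
    (\<ominus> r) \<odot>\<^bsub>Hom C A B\<^esub> f = \<ominus>\<^bsub>Hom C A B\<^esub> (r \<odot>\<^bsub>Hom C A B\<^esub> f)"
  using module.smult_l_minus[OF hom_module] .

lemma hom_smult_r_minus:
  "A \<in> Obj C \<Longrightarrow> B \<in> Obj C \<Longrightarrow> r \<in> carrier R \<Longrightarrow> f \<in> Mor C A B \<Longrightarrow>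
    r \<odot>\<^bsub>Hom C A B\<^esub> (\<ominus>\<^bsub>Hom C A B\<^esub> f) = \<ominus>\<^bsub>Hom C A B\<^esub> (r \<odot>\<^bsub>Hom C A B\<^esub> f)"
  using module.smult_r_minus[OF hom_module] .

lemmas smult_simps = comp_smult_left comp_smult_right hom_smult_assoc

lemmas cat_distribs = comp_add_left comp_add_right comp_assoc_left
  comp_smult_left comp_smult_right hom_smult_r_distr hom_smult_assoc

text \<open>An inverse over the localization, with denominators cleared. Both composites share the
  scalar \<open>s\<close>; different scalars are merged by \<open>iso_at_two_sided\<close>.\<close>

definition iso_at :: "'r set \<Rightarrow> 'o \<Rightarrow> 'o \<Rightarrow> 'm \<Rightarrow> bool" where
  "iso_at p A B f \<longleftrightarrow> f \<in> Mor C A B \<and> (\<exists>g\<in>Mor C B A. \<exists>s\<in>carrier R - p.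
     Comp C A B A g f = s \<odot>\<^bsub>Hom C A A\<^esub> Ident C A \<and> Comp C B A B f g = s \<odot>\<^bsub>Hom C B B\<^esub> Ident C B)"

text \<open>For maximal \<open>p\<close> this says that \<open>f\<close> becomes a split
  monomorphism over the localization at \<open>p\<close>.\<close>

definition split_at :: "'r set \<Rightarrow> 'o \<Rightarrow> 'o \<Rightarrow> 'm \<Rightarrow> bool" where
  "split_at p A B f \<longleftrightarrow> f \<in> Mor C A B \<and> (\<exists>g\<in>Mor C B A. \<exists>s\<in>carrier R - p.
     Comp C A B A g f = s \<odot>\<^bsub>Hom C A A\<^esub> Ident C A)"

lemma iso_atD: "iso_at p A B f \<Longrightarrow> f \<in> Mor C A B"
  by (simp add: iso_at_def)

lemma split_atD: "split_at p A B f \<Longrightarrow> f \<in> Mor C A B"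
  by (simp add: split_at_def)

lemma iso_at_imp_split_at: "iso_at p A B f \<Longrightarrow> split_at p A B f"
  by (auto simp: iso_at_def split_at_def)

lemma iso_at_ident:
  assumes "A \<in> Obj C" "\<one> \<notin> p"
  shows "iso_at p A A (Ident C A)"
  unfolding iso_at_def using assms by (auto intro!: bexI[of _ "Ident C A"] bexI[of _ \<one>])

text \<open>The usual equality of left and right inverses, with scalars: evaluating
  \<open>l f r\<close> in two ways gives \<open>t l = s r\<close>, so \<open>t l\<close> is an
  inverse on both sides with scalar \<open>s t\<close>.\<close>

lemma iso_at_two_sided:
  assumes p: "maximalideal p R" and m [simp]: "A \<in> Obj C" "B \<in> Obj C" "f \<in> Mor C A B" "l \<in> Mor C B A" "r \<in> Mor C B A"
    and s: "s \<in> carrier R - p" "Comp C A B A l f = s \<odot>\<^bsub>Hom C A A\<^esub> Ident C A"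
    and t: "t \<in> carrier R - p" "Comp C B A B f r = t \<odot>\<^bsub>Hom C B B\<^esub> Ident C B"
  shows "iso_at p A B f"
proof -
  have [simp]: "s \<in> carrier R" "t \<in> carrier R" using s t by auto
  have "t \<odot>\<^bsub>Hom C B A\<^esub> l = Comp C B B A l (Comp C B A B f r)"
    by (simp add: t comp_smult_right)
  also have "\<dots> = s \<odot>\<^bsub>Hom C B A\<^esub> r"
    by (simp add: comp_assoc s comp_smult_left)
  finally have lr: "t \<odot>\<^bsub>Hom C B A\<^esub> l = s \<odot>\<^bsub>Hom C B A\<^esub> r" .
  have "Comp C A B A (t \<odot>\<^bsub>Hom C B A\<^esub> l) f = (s \<otimes> t) \<odot>\<^bsub>Hom C A A\<^esub> Ident C A"
    by (simp add: smult_simps s m_comm)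
  moreover have "Comp C B A B f (t \<odot>\<^bsub>Hom C B A\<^esub> l) = (s \<otimes> t) \<odot>\<^bsub>Hom C B B\<^esub> Ident C B"
    unfolding lr by (simp add: smult_simps t)
  moreover have "s \<otimes> t \<in> carrier R - p"
    using maximalideal_mult_notin[OF p] s t by auto
  ultimately show ?thesis unfolding iso_at_def
    by (intro conjI bexI[of _ "t \<odot>\<^bsub>Hom C B A\<^esub> l"] bexI[of _ "s \<otimes> t"]) auto
qed

lemma iso_at_sym:
  assumes "iso_at p A B f" "A \<in> Obj C" "B \<in> Obj C"
  shows "\<exists>g. iso_at p B A g"
  using assms unfolding iso_at_def by blast

lemma iso_at_comp:
  assumes p: "maximalideal p R" and o: "A \<in> Obj C" "B \<in> Obj C" "D \<in> Obj C"
    and "iso_at p A B f" "iso_at p B D g"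
  shows "iso_at p A D (Comp C A B D g f)"
proof -
  note [simp] = o
  obtain f' g' s t where m [simp]: "f \<in> Mor C A B" "f' \<in> Mor C B A" "g \<in> Mor C B D" "g' \<in> Mor C D B"
    "s \<in> carrier R" "t \<in> carrier R" and st: "s \<notin> p" "t \<notin> p" and
    e: "Comp C A B A f' f = s \<odot>\<^bsub>Hom C A A\<^esub> Ident C A" "Comp C B A B f f' = s \<odot>\<^bsub>Hom C B B\<^esub> Ident C B"
    "Comp C B D B g' g = t \<odot>\<^bsub>Hom C B B\<^esub> Ident C B" "Comp C D B D g g' = t \<odot>\<^bsub>Hom C D D\<^esub> Ident C D"
    using assms unfolding iso_at_def by blast
  have e': "Comp C A D B g' (Comp C A B D g f) = t \<odot>\<^bsub>Hom C A B\<^esub> f"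
    "Comp C D A B f (Comp C D B A f' g') = s \<odot>\<^bsub>Hom C D B\<^esub> g'"
    by (simp_all add: comp_assoc comp_smult_left e)
  have "s \<otimes> t \<in> carrier R - p" using maximalideal_mult_notin[OF p] st by auto
  then show ?thesis unfolding iso_at_def
    by (intro conjI bexI[of _ "Comp C D B A f' g'"] bexI[of _ "s \<otimes> t"])
      (auto simp: comp_assoc_left e e' smult_simps m_comm)
qed

lemma local_global:
  assumes T: "ideal T R" and loc: "\<And>p. maximalideal p R \<Longrightarrow> \<exists>t\<in>T. t \<notin> p"
    and noeth: "noetherian_ring R"
  shows "\<one> \<in> T"
  using noetherian_ring.exists_maximalideal_superset[OF noeth T] loc by blast

text \<open>\<open>\<Phi> p\<close> is any property that survives adding multiples by elements of
  \<open>p\<close>. A solution \<open>c\<close> for \<open>F\<close> and a solution \<open>d\<close>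
  at a further \<open>q\<close> are joined by means of an \<open>e\<close> that is 1 modulo
  \<open>q\<close> and 0 modulo the members of \<open>F\<close>.\<close>

lemma interpolate:
  assumes F: "finite F" "\<And>p. p \<in> F \<Longrightarrow> maximalideal p R"
    and o [simp]: "A \<in> Obj C" "B \<in> Obj C"
    and ex: "\<And>p. p \<in> F \<Longrightarrow> \<exists>c\<in>Mor C A B. \<Phi> p c"
    and stable: "\<And>p c m r. p \<in> F \<Longrightarrow> c \<in> Mor C A B \<Longrightarrow> m \<in> Mor C A B \<Longrightarrow> r \<in> p \<Longrightarrow> \<Phi> p c \<Longrightarrow>
      \<Phi> p (c \<oplus>\<^bsub>Hom C A B\<^esub> r \<odot>\<^bsub>Hom C A B\<^esub> m)"
  shows "\<exists>c\<in>Mor C A B. \<forall>p\<in>F. \<Phi> p c"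
  using F ex stable
proof (induction F)
  case empty
  show ?case using hom_zero_closed[OF o] by blast
next
  case (insert q F)
  have "\<exists>c\<in>Mor C A B. \<forall>p\<in>F. \<Phi> p c"
  proof (rule insert.IH)
    show "\<Phi> p (c \<oplus>\<^bsub>Hom C A B\<^esub> r \<odot>\<^bsub>Hom C A B\<^esub> m)"
      if "p \<in> F" "c \<in> Mor C A B" "m \<in> Mor C A B" "r \<in> p" "\<Phi> p c" for p c m r
      by (rule insert.prems(3)) (use that in simp_all)
  qed (use insert.prems(1,2) in simp_all)
  then obtain c where c [simp]: "c \<in> Mor C A B" and cF: "\<forall>p\<in>F. \<Phi> p c" by blast
  obtain d where d [simp]: "d \<in> Mor C A B" and dq: "\<Phi> q d"
    using insert.prems(2)[of q] by blast
  obtain e where e [simp]: "e \<in> carrier R" and eq: "\<one> \<ominus> e \<in> q" "\<forall>p\<in>F. e \<in> p"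
    using maximalideals_interpolate[of F q] insert.hyps insert.prems(1) by auto
  \<comment> \<open>Read as \<open>c + e (d - c)\<close> it is a perturbation of \<open>c\<close> at
    the members of \<open>F\<close>; read as \<open>d + (1 - e)(c - d)\<close> it is a perturbation
    of \<open>d\<close> at \<open>q\<close>.\<close>
  let ?b = "c \<oplus>\<^bsub>Hom C A B\<^esub> e \<odot>\<^bsub>Hom C A B\<^esub> (d \<oplus>\<^bsub>Hom C A B\<^esub> \<ominus>\<^bsub>Hom C A B\<^esub> c)"
  have "?b = d \<oplus>\<^bsub>Hom C A B\<^esub> (\<one> \<ominus> e) \<odot>\<^bsub>Hom C A B\<^esub> (c \<oplus>\<^bsub>Hom C A B\<^esub> \<ominus>\<^bsub>Hom C A B\<^esub> d)"
    by (simp add: a_minus_def hom_smult_l_distr hom_smult_r_distr hom_smult_l_minus hom_smult_r_minus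
        hom_minus_add hom_a_ac)
  moreover have "\<Phi> q \<dots>"
    by (rule insert.prems(3)) (use dq eq in auto)
  moreover have "\<Phi> p ?b" if "p \<in> F" for p
    by (rule insert.prems(3)) (use that cF eq in auto)
  ultimately show ?case by (intro bexI[of _ ?b]) auto
qed

end

locale hom_finite_over_dedekind = dedekind_domain R + linear_category R C + hom_finite_R_category R C
  for R :: "('r, 'x) ring_scheme" (structure) and C :: "('o, 'r, 'm) category"
begin

lemma noetherian: "noetherian_ring R" ..

lemma minus_power_notin:
  assumes p: "maximalideal p R" and x: "x \<in> carrier R" "x \<notin> p"
  shows "(\<ominus> x) [^] (n::nat) \<notin> p"
proof -
  interpret p: maximalideal p R by fact
  have "\<ominus> x \<notin> p" using x p.a_inv_closed[of "\<ominus> x"] by auto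
  then show ?thesis using maximalideal_pow_notin[OF p] x by simp
qed

text \<open>Multiplying an integral equation for \<open>w\<close> by a power of \<open>a\<close> and substituting
  \<open>a w = u - x\<close> exhibits an element of \<open>\<plusminus>x\<^sup>n + aR\<close> as a multiple of \<open>u\<close>.\<close>

lemma quasi_invertible_perturbation:
  assumes p: "maximalideal p R" and A [simp]: "A \<in> Obj C" and w [simp]: "w \<in> Mor C A A"
    and x: "x \<in> carrier R" "x \<notin> p" and a: "a \<in> p"
  defines "u \<equiv> x \<odot>\<^bsub>Hom C A A\<^esub> Ident C A \<oplus>\<^bsub>Hom C A A\<^esub> a \<odot>\<^bsub>Hom C A A\<^esub> w"
  shows "\<exists>h\<in>Mor C A A. \<exists>t\<in>carrier R - p. Comp C A A A u h = t \<odot>\<^bsub>Hom C A A\<^esub> Ident C A \<and>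
    Comp C A A A h u = t \<odot>\<^bsub>Hom C A A\<^esub> Ident C A"
proof -
  interpret p: maximalideal p R by fact
  interpret M: module R "Hom C A A" using hom_module by simp
  note [simp] = x(1)
  have [simp]: "a \<in> carrier R" using a p.Icarr by simp
  define W where "W n = ((Comp C A A A w) ^^ n) (Ident C A)" for n
  have W [simp]: "W n \<in> Mor C A A" for n by (induction n) (auto simp: W_def)
  have WS: "W (Suc n) = Comp C A A A w (W n)" for n by (simp add: W_def)
  have u [simp]: "u \<in> Mor C A A" unfolding u_def by simp
  have aw: "a \<odot>\<^bsub>Hom C A A\<^esub> w = u \<oplus>\<^bsub>Hom C A A\<^esub> (\<ominus> x) \<odot>\<^bsub>Hom C A A\<^esub> Ident C A"
    unfolding u_def by (simp add: hom_smult_l_minus hom_a_comm[of A A _ "\<ominus>\<^bsub>Hom C A A\<^esub> _"])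
  \<comment> \<open>\<open>z\<close> is congruent to the scalar \<open>y\<close> modulo
    \<open>u\<close>, with a quotient \<open>g\<close> commuting with \<open>u\<close>. Commutation
    makes the final quotient an inverse on both sides.\<close>
  define good where "good z y \<longleftrightarrow> z \<in> Mor C A A \<and> y \<in> carrier R \<and> (\<exists>g\<in>Mor C A A.
      z = Comp C A A A u g \<oplus>\<^bsub>Hom C A A\<^esub> y \<odot>\<^bsub>Hom C A A\<^esub> Ident C A \<and> Comp C A A A u g = Comp C A A A g u)" for z y
  have good_add: "good (z \<oplus>\<^bsub>Hom C A A\<^esub> z') (y \<oplus> y')" if zy: "good z y" "good z' y'" for z z' y y'
  proof -
    obtain g g' where [simp]: "z \<in> Mor C A A" "z' \<in> Mor C A A" "y \<in> carrier R" "y' \<in> carrier R" "g \<in> Mor C A A" "g' \<in> Mor C A A"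
      and e: "z = Comp C A A A u g \<oplus>\<^bsub>Hom C A A\<^esub> y \<odot>\<^bsub>Hom C A A\<^esub> Ident C A" "Comp C A A A u g = Comp C A A A g u"
       "z' = Comp C A A A u g' \<oplus>\<^bsub>Hom C A A\<^esub> y' \<odot>\<^bsub>Hom C A A\<^esub> Ident C A" "Comp C A A A u g' = Comp C A A A g' u"
      using zy unfolding good_def by blast
    show ?thesis unfolding good_def
      by (intro conjI bexI[of _ "g \<oplus>\<^bsub>Hom C A A\<^esub> g'"])
        (simp, simp, simp add: e(1,3) comp_add_right hom_smult_l_distr hom_a_ac,
         simp add: e(2,4) comp_add_left comp_add_right, simp)
  qed
  have good_smult: "good (r \<odot>\<^bsub>Hom C A A\<^esub> z) (r \<otimes> y)" if zy: "good z y" "r \<in> carrier R" for z r y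
  proof -
    obtain g where [simp]: "z \<in> Mor C A A" "y \<in> carrier R" "g \<in> Mor C A A"
      and e: "z = Comp C A A A u g \<oplus>\<^bsub>Hom C A A\<^esub> y \<odot>\<^bsub>Hom C A A\<^esub> Ident C A" "Comp C A A A u g = Comp C A A A g u"
      using zy unfolding good_def by blast
    show ?thesis unfolding good_def
      by (intro conjI bexI[of _ "r \<odot>\<^bsub>Hom C A A\<^esub> g"])
        (use zy(2) in \<open>simp, simp, simp add: e(1) smult_simps hom_smult_r_distr,
         simp add: e(2) smult_simps, simp\<close>)
  qed
  \<comment> \<open>Since \<open>a w = u - x\<close>, the map \<open>a w\<close> is the scalar
    \<open>- x\<close> modulo \<open>u\<close>.\<close>
  have good_W: "good ((a [^] n) \<odot>\<^bsub>Hom C A A\<^esub> W n) ((\<ominus> x) [^] n)" for n :: nat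
  proof (induction n)
    case 0
    show ?case unfolding good_def by (auto intro!: bexI[of _ "\<zero>\<^bsub>Hom C A A\<^esub>"] simp: W_def)
  next
    case (Suc n)
    define y where "y = (\<ominus> x) [^] n"
    have y [simp]: "y \<in> carrier R" unfolding y_def by simp
    obtain g where [simp]: "g \<in> Mor C A A"
      and e: "(a [^] n) \<odot>\<^bsub>Hom C A A\<^esub> W n = Comp C A A A u g \<oplus>\<^bsub>Hom C A A\<^esub> y \<odot>\<^bsub>Hom C A A\<^esub> Ident C A" "Comp C A A A u g = Comp C A A A g u"
      using Suc unfolding good_def y_def by blast
    have e': "Comp C A A A u (Comp C A A A g h) = Comp C A A A g (Comp C A A A u h)" if "h \<in> Mor C A A" for h
      using that e(2) by (simp add: comp_assoc)
    let ?v = "u \<oplus>\<^bsub>Hom C A A\<^esub> (\<ominus> x) \<odot>\<^bsub>Hom C A A\<^esub> Ident C A"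
    have "(a [^] Suc n) \<odot>\<^bsub>Hom C A A\<^esub> W (Suc n) = Comp C A A A (a \<odot>\<^bsub>Hom C A A\<^esub> w) ((a [^] n) \<odot>\<^bsub>Hom C A A\<^esub> W n)"
      unfolding WS by (simp add: smult_simps m_comm)
    also have "\<dots> = Comp C A A A u (Comp C A A A ?v g \<oplus>\<^bsub>Hom C A A\<^esub> y \<odot>\<^bsub>Hom C A A\<^esub> Ident C A) \<oplus>\<^bsub>Hom C A A\<^esub> (y \<otimes> \<ominus> x) \<odot>\<^bsub>Hom C A A\<^esub> Ident C A"
      unfolding e(1) aw by (simp add: cat_distribs hom_a_ac m_comm)
    finally show ?case unfolding good_def
      by (intro conjI bexI[of _ "Comp C A A A ?v g \<oplus>\<^bsub>Hom C A A\<^esub> y \<odot>\<^bsub>Hom C A A\<^esub> Ident C A"])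
        (auto simp: y_def[symmetric] cat_distribs e(2) e')
  qed
  \<comment> \<open>A power \<open>W i\<close> with \<open>i < n\<close> consumes only
    \<open>a^i\<close> of the factor \<open>a^n\<close>; the surplus contains at least one
    \<open>a\<close>, so the resulting scalar is divisible by \<open>a\<close>.\<close>
  have good_span: "\<exists>b\<in>carrier R. good ((a [^] n) \<odot>\<^bsub>Hom C A A\<^esub> z) (a \<otimes> b)" if "z \<in> M.mspan (W ` {..<n})" for z and n :: nat
    using that
  proof induction
    case zero
    have "good \<zero>\<^bsub>Hom C A A\<^esub> \<zero>" unfolding good_def by (auto intro!: bexI[of _ "\<zero>\<^bsub>Hom C A A\<^esub>"])
    then show ?case by (intro bexI[of _ \<zero>]) auto
  next
    case (step g r z)
    then obtain i b where i: "i < n" "g = W i" and b: "b \<in> carrier R" "good ((a [^] n) \<odot>\<^bsub>Hom C A A\<^esub> z) (a \<otimes> b)" by auto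
    have z: "z \<in> Mor C A A" by (rule M.mspan_closed[OF _ step(3)]) auto
    define c where "c = a [^] (n - Suc i)"
    have c [simp]: "c \<in> carrier R" unfolding c_def by simp
    have "n = Suc (n - Suc i) + i" using i by simp
    then have an: "a [^] n = (a [^] (n - Suc i) \<otimes> a) \<otimes> a [^] i"
      by (metis \<open>a \<in> carrier R\<close> nat_pow_Suc nat_pow_mult)
    define d where "d = r \<otimes> c \<otimes> (\<ominus> x) [^] i"
    have d: "d \<in> carrier R" unfolding d_def using step by simp
    have "good ((r \<otimes> c \<otimes> a) \<odot>\<^bsub>Hom C A A\<^esub> ((a [^] i) \<odot>\<^bsub>Hom C A A\<^esub> W i)) ((r \<otimes> c \<otimes> a) \<otimes> (\<ominus> x) [^] i)"
      using step by (intro good_smult good_W) auto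
    moreover have "(r \<otimes> c \<otimes> a) \<otimes> (\<ominus> x) [^] i = a \<otimes> d" unfolding d_def using step by (simp add: m_ac)
    moreover have "(r \<otimes> c \<otimes> a) \<odot>\<^bsub>Hom C A A\<^esub> ((a [^] i) \<odot>\<^bsub>Hom C A A\<^esub> W i) = (a [^] n) \<odot>\<^bsub>Hom C A A\<^esub> (r \<odot>\<^bsub>Hom C A A\<^esub> g)"
      using step i unfolding an c_def by (simp add: hom_smult_assoc m_ac)
    ultimately have "good ((a [^] n) \<odot>\<^bsub>Hom C A A\<^esub> (r \<odot>\<^bsub>Hom C A A\<^esub> g)) (a \<otimes> d)" by simp
    from good_add[OF this b(2)] have "good ((a [^] n) \<odot>\<^bsub>Hom C A A\<^esub> (r \<odot>\<^bsub>Hom C A A\<^esub> g \<oplus>\<^bsub>Hom C A A\<^esub> z)) (a \<otimes> (d \<oplus> b))"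
      using step i z d b by (simp add: hom_smult_r_distr r_distr)
    then show ?case using d b by blast
  qed
  obtain n where "W n \<in> M.mspan (W ` {..<n})"
    using M.noetherian_sequence[OF noetherian hom_finite[OF A A], of W] W by blast
  then obtain b where b: "b \<in> carrier R" "good ((a [^] n) \<odot>\<^bsub>Hom C A A\<^esub> W n) (a \<otimes> b)" using good_span by blast
  define y where "y = (\<ominus> x) [^] n"
  have y [simp]: "y \<in> carrier R" "a \<otimes> b \<in> carrier R" unfolding y_def using b by simp_all
  obtain g h where [simp]: "g \<in> Mor C A A" "h \<in> Mor C A A"
    and e: "Comp C A A A u g \<oplus>\<^bsub>Hom C A A\<^esub> y \<odot>\<^bsub>Hom C A A\<^esub> Ident C A = Comp C A A A u h \<oplus>\<^bsub>Hom C A A\<^esub> (a \<otimes> b) \<odot>\<^bsub>Hom C A A\<^esub> Ident C A"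
      "Comp C A A A u g = Comp C A A A g u" "Comp C A A A u h = Comp C A A A h u"
    using good_W[of n] b(2) unfolding good_def y_def by metis
  \<comment> \<open>Comparing the two expressions for \<open>a^n w^n\<close> gives
    \<open>u (g - h) = a b - (- x)^n\<close>, a scalar outside \<open>p\<close> because
    \<open>a \<in> p\<close> and \<open>x \<notin> p\<close>.\<close>
  let ?k = "g \<oplus>\<^bsub>Hom C A A\<^esub> \<ominus>\<^bsub>Hom C A A\<^esub> h" and ?t = "a \<otimes> b \<ominus> y"
  have "Comp C A A A u ?k = ?t \<odot>\<^bsub>Hom C A A\<^esub> Ident C A"
    using hom_diff_eq[OF _ _ _ _ _ _ e(1)] by (simp add: comp_add_right a_minus_def hom_smult_l_distr hom_smult_l_minus)
  moreover have "Comp C A A A ?k u = Comp C A A A u ?k"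
    by (simp add: comp_add_left comp_add_right e)
  moreover have "?t \<notin> p"
  proof
    assume "?t \<in> p"
    moreover have "a \<otimes> b \<in> p" using a b by (simp add: p.I_r_closed)
    ultimately have "a \<otimes> b \<ominus> ?t \<in> p" by (simp add: a_minus_def)
    moreover have "a \<otimes> b \<ominus> ?t = y" using y by algebra
    ultimately show False using minus_power_notin[OF p x] unfolding y_def by simp
  qed
  ultimately show ?thesis by (intro bexI[of _ ?k] bexI[of _ ?t]) auto
qed

text \<open>Composing with a local left inverse \<open>g\<close> turns the perturbation of
  \<open>f\<close> into a perturbation of the scalar \<open>s\<close> among the endomorphisms of
  \<open>A\<close>.\<close>

lemma split_at_perturbation:
  assumes p: "maximalideal p R" and o [simp]: "A \<in> Obj C" "B \<in> Obj C"
    and f: "split_at p A B f" and m [simp]: "m \<in> Mor C A B" and a: "a \<in> p"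
  shows "split_at p A B (f \<oplus>\<^bsub>Hom C A B\<^esub> a \<odot>\<^bsub>Hom C A B\<^esub> m)"
proof -
  have [simp]: "a \<in> carrier R" using maximalideal_Icarr[OF p a] .
  obtain g s where [simp]: "f \<in> Mor C A B" "g \<in> Mor C B A" "s \<in> carrier R" and s: "s \<notin> p"
    and gf: "Comp C A B A g f = s \<odot>\<^bsub>Hom C A A\<^esub> Ident C A" using f unfolding split_at_def by blast
  have "Comp C A B A g (f \<oplus>\<^bsub>Hom C A B\<^esub> a \<odot>\<^bsub>Hom C A B\<^esub> m) = s \<odot>\<^bsub>Hom C A A\<^esub> Ident C A \<oplus>\<^bsub>Hom C A A\<^esub> a \<odot>\<^bsub>Hom C A A\<^esub> Comp C A B A g m"
    by (simp add: cat_distribs gf)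
  then obtain h t where h: "h \<in> Mor C A A" "t \<in> carrier R - p"
    "Comp C A A A h (Comp C A B A g (f \<oplus>\<^bsub>Hom C A B\<^esub> a \<odot>\<^bsub>Hom C A B\<^esub> m)) = t \<odot>\<^bsub>Hom C A A\<^esub> Ident C A"
    using quasi_invertible_perturbation[OF p, of A "Comp C A B A g m" s a] s a by auto
  then show ?thesis unfolding split_at_def
    by (intro conjI bexI[of _ "Comp C B A A h g"] bexI[of _ t]) (auto simp: comp_assoc_left)
qed

text \<open>A left inverse comes from endomorphisms of \<open>A\<close>, a right inverse from
  endomorphisms of \<open>B\<close>; \<open>iso_at_two_sided\<close> matches them.\<close>

lemma iso_at_perturbation:
  assumes p: "maximalideal p R" and o [simp]: "A \<in> Obj C" "B \<in> Obj C"
    and f: "iso_at p A B f" and m [simp]: "m \<in> Mor C A B" and a: "a \<in> p"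
  shows "iso_at p A B (f \<oplus>\<^bsub>Hom C A B\<^esub> a \<odot>\<^bsub>Hom C A B\<^esub> m)"
proof -
  have [simp]: "a \<in> carrier R" using maximalideal_Icarr[OF p a] .
  obtain g s where [simp]: "f \<in> Mor C A B" "g \<in> Mor C B A" "s \<in> carrier R" and s: "s \<notin> p"
    and e: "Comp C A B A g f = s \<odot>\<^bsub>Hom C A A\<^esub> Ident C A" "Comp C B A B f g = s \<odot>\<^bsub>Hom C B B\<^esub> Ident C B"
    using f unfolding iso_at_def by blast
  let ?f = "f \<oplus>\<^bsub>Hom C A B\<^esub> a \<odot>\<^bsub>Hom C A B\<^esub> m"
  obtain l t where l: "l \<in> Mor C B A" "t \<in> carrier R - p" "Comp C A B A l ?f = t \<odot>\<^bsub>Hom C A A\<^esub> Ident C A"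
    using split_at_perturbation[OF p o iso_at_imp_split_at[OF f] m a] unfolding split_at_def by blast
  have "Comp C B A B ?f g = s \<odot>\<^bsub>Hom C B B\<^esub> Ident C B \<oplus>\<^bsub>Hom C B B\<^esub> a \<odot>\<^bsub>Hom C B B\<^esub> Comp C B A B m g"
    by (simp add: cat_distribs e)
  then obtain h r where h: "h \<in> Mor C B B" "r \<in> carrier R - p"
    "Comp C B B B (Comp C B A B ?f g) h = r \<odot>\<^bsub>Hom C B B\<^esub> Ident C B"
    using quasi_invertible_perturbation[OF p, of B "Comp C B A B m g" s a] s a by auto
  show ?thesis
    by (rule iso_at_two_sided[OF p _ _ _ l(1) _ l(2,3) h(2), of "Comp C B B A g h"])
      (use h in \<open>auto simp: comp_assoc_left\<close>)
qed

end

section \<open>Gluing and exchange\<close>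

context hom_finite_over_dedekind begin

lemma exists_maximalideal: "\<exists>p. maximalideal p R"
  using exists_maximalideal_superset[OF zeroideal] by auto

lemma zero_in_maximalideal: "maximalideal p R \<Longrightarrow> \<zero> \<in> p"
  using additive_subgroup.zero_closed[OF ideal.axioms(1)[OF maximalideal.axioms(1)]] .

lemma one_notin_maximalideal: "maximalideal p R \<Longrightarrow> \<one> \<notin> p"
  using maximalideal.I_notcarr ideal.one_imp_carrier[OF maximalideal.axioms(1)] by metis

lemma iso_at_scalar:
  assumes "A \<in> Obj C" "B \<in> Obj C" "f \<in> Mor C A B" "g \<in> Mor C B A" "s \<in> carrier R" "s \<notin> p"
    "Comp C A B A g f = s \<odot>\<^bsub>Hom C A A\<^esub> Ident C A" "Comp C B A B f g = s \<odot>\<^bsub>Hom C B B\<^esub> Ident C B"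
  shows "iso_at p A B f"
  using assms unfolding iso_at_def by blast

text \<open>The scalar of one local inverse is nonzero, and the same inverse works at every
  \<open>p\<close> not containing it.\<close>

lemma finite_not_iso_at:
  assumes "maximalideal q R" "A \<in> Obj C" "B \<in> Obj C" "iso_at q A B h"
  shows "finite {p. maximalideal p R \<and> \<not> iso_at p A B h}"
proof -
  obtain g s where s: "s \<in> carrier R" "s \<notin> q" and g: "h \<in> Mor C A B" "g \<in> Mor C B A"
    "Comp C A B A g h = s \<odot>\<^bsub>Hom C A A\<^esub> Ident C A" "Comp C B A B h g = s \<odot>\<^bsub>Hom C B B\<^esub> Ident C B"
    using assms unfolding iso_at_def by blast
  have "s \<noteq> \<zero>" using s zero_in_maximalideal[OF assms(1)] by blast
  moreover have "{p. maximalideal p R \<and> \<not> iso_at p A B h} \<subseteq> {p. maximalideal p R \<and> s \<in> p}"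
    using iso_at_scalar[OF assms(2,3) g(1,2) s(1) _ g(3,4)] by blast
  ultimately show ?thesis using finite_maximalideals_containing[OF s(1)] finite_subset by blast
qed

text \<open>The scalars \<open>s\<close> with \<open>s 1 \<in> N\<close> form an ideal that no
  maximal ideal contains. \<open>N\<close> will consist of the left or right multiples of a fixed
  map, so that local one-sided inverses yield a global one.\<close>

lemma local_global_ident:
  assumes A: "A \<in> Obj C" and N: "N \<subseteq> Mor C A A"
    and zero: "\<zero>\<^bsub>Hom C A A\<^esub> \<in> N"
    and add: "\<And>x y. x \<in> N \<Longrightarrow> y \<in> N \<Longrightarrow> x \<oplus>\<^bsub>Hom C A A\<^esub> y \<in> N"
    and smult: "\<And>r x. r \<in> carrier R \<Longrightarrow> x \<in> N \<Longrightarrow> r \<odot>\<^bsub>Hom C A A\<^esub> x \<in> N"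
    and loc: "\<And>p. maximalideal p R \<Longrightarrow> \<exists>s\<in>carrier R - p. s \<odot>\<^bsub>Hom C A A\<^esub> Ident C A \<in> N"
  shows "Ident C A \<in> N"
proof -
  let ?T = "{s \<in> carrier R. s \<odot>\<^bsub>Hom C A A\<^esub> Ident C A \<in> N}"
  have "ideal ?T R"
    using A zero add smult by (intro cring_idealI) (auto simp: hom_smult_l_distr simp flip: hom_smult_assoc)
  then have "\<one> \<in> ?T"
    by (rule local_global) (use loc noetherian in auto)
  then show ?thesis using A by simp
qed

lemma split_at_all_imp_split:
  assumes A [simp]: "A \<in> Obj C" and B [simp]: "B \<in> Obj C"
    and loc: "\<And>p. maximalideal p R \<Longrightarrow> split_at p A B f" and f [simp]: "f \<in> Mor C A B"
  shows "\<exists>l\<in>Mor C B A. Comp C A B A l f = Ident C A"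
proof -
  have "Ident C A \<in> (\<lambda>l. Comp C A B A l f) ` Mor C B A"
  proof (rule local_global_ident)
    show "\<zero>\<^bsub>Hom C A A\<^esub> \<in> (\<lambda>l. Comp C A B A l f) ` Mor C B A"
      by (rule image_eqI[of _ _ "\<zero>\<^bsub>Hom C B A\<^esub>"]) auto
    show "x \<oplus>\<^bsub>Hom C A A\<^esub> y \<in> (\<lambda>l. Comp C A B A l f) ` Mor C B A"
      if "x \<in> (\<lambda>l. Comp C A B A l f) ` Mor C B A" "y \<in> (\<lambda>l. Comp C A B A l f) ` Mor C B A" for x y
      using that by (auto simp flip: comp_add_left)
    show "r \<odot>\<^bsub>Hom C A A\<^esub> x \<in> (\<lambda>l. Comp C A B A l f) ` Mor C B A"
      if "r \<in> carrier R" "x \<in> (\<lambda>l. Comp C A B A l f) ` Mor C B A" for r x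
      using that by (auto simp flip: comp_smult_left)
    show "\<exists>s\<in>carrier R - p. s \<odot>\<^bsub>Hom C A A\<^esub> Ident C A \<in> (\<lambda>l. Comp C A B A l f) ` Mor C B A"
      if "maximalideal p R" for p
      using loc[OF that] unfolding split_at_def by (metis image_eqI)
  qed auto
  then show ?thesis by auto
qed

text \<open>Over the localization at \<open>p\<close>, the automorphism of
  \<open>A \<oplus> B\<close> defined by the graph of \<open>c\<close> turns \<open>(h, b)\<close>
  into \<open>(h + b c, b)\<close>, whose first entry is invertible; hence the kernel is a copy of
  \<open>B\<close>. Globally \<open>(h, b)\<close> is a split epimorphism, and \<open>B'\<close> is
  its kernel.\<close>

lemma kernel_in_genus:
  assumes fa: "fully_additive C"
    and o [simp]: "A \<in> Obj C" "A' \<in> Obj C" "B \<in> Obj C"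
    and h [simp]: "h \<in> Mor C A A'" "b \<in> Mor C B A'"
    and loc: "\<And>p. maximalideal p R \<Longrightarrow> \<exists>c\<in>Mor C A B. iso_at p A A' (h \<oplus>\<^bsub>Hom C A A'\<^esub> Comp C A B A' b c)"
    and M: "is_direct_sum C [A, B] M"
  shows "\<exists>B'\<in>Obj C. is_direct_sum C [A', B'] M \<and> (\<forall>p. maximalideal p R \<longrightarrow> (\<exists>k. iso_at p B' B k))"
proof -
  obtain i1 i2 p1 p2 where m [simp]: "M \<in> Obj C" "i1 \<in> Mor C A M" "i2 \<in> Mor C B M" "p1 \<in> Mor C M A" "p2 \<in> Mor C M B"
    and e: "Comp C A M A p1 i1 = Ident C A" "Comp C B M B p2 i2 = Ident C B"
      "Comp C B M A p1 i2 = \<zero>\<^bsub>Hom C B A\<^esub>" "Comp C A M B p2 i1 = \<zero>\<^bsub>Hom C A B\<^esub>"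
      "Comp C M A M i1 p1 \<oplus>\<^bsub>Hom C M M\<^esub> Comp C M B M i2 p2 = Ident C M"
    using M unfolding is_direct_sum_pair by blast
  have e2: "\<And>K f. K \<in> Obj C \<Longrightarrow> f \<in> Mor C K A \<Longrightarrow> Comp C K M A p1 (Comp C K A M i1 f) = f"
    "\<And>K f. K \<in> Obj C \<Longrightarrow> f \<in> Mor C K B \<Longrightarrow> Comp C K M B p2 (Comp C K B M i2 f) = f"
    "\<And>K f. K \<in> Obj C \<Longrightarrow> f \<in> Mor C K B \<Longrightarrow> Comp C K M A p1 (Comp C K B M i2 f) = \<zero>\<^bsub>Hom C K A\<^esub>"
    "\<And>K f. K \<in> Obj C \<Longrightarrow> f \<in> Mor C K A \<Longrightarrow> Comp C K M B p2 (Comp C K A M i1 f) = \<zero>\<^bsub>Hom C K B\<^esub>"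
    by (simp_all add: comp_assoc e)
  define \<tau> where "\<tau> = Comp C M A A' h p1 \<oplus>\<^bsub>Hom C M A'\<^esub> Comp C M B A' b p2"
  have \<tau> [simp]: "\<tau> \<in> Mor C M A'" unfolding \<tau>_def by simp
  have "Ident C A' \<in> Comp C A' M A' \<tau> ` Mor C A' M"
  proof (rule local_global_ident)
    show "\<zero>\<^bsub>Hom C A' A'\<^esub> \<in> Comp C A' M A' \<tau> ` Mor C A' M"
      by (rule image_eqI[of _ _ "\<zero>\<^bsub>Hom C A' M\<^esub>"]) auto
    show "x \<oplus>\<^bsub>Hom C A' A'\<^esub> y \<in> Comp C A' M A' \<tau> ` Mor C A' M"
      if "x \<in> Comp C A' M A' \<tau> ` Mor C A' M" "y \<in> Comp C A' M A' \<tau> ` Mor C A' M" for x y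
      using that by (auto simp flip: comp_add_right)
    show "r \<odot>\<^bsub>Hom C A' A'\<^esub> x \<in> Comp C A' M A' \<tau> ` Mor C A' M"
      if "r \<in> carrier R" "x \<in> Comp C A' M A' \<tau> ` Mor C A' M" for r x
      using that by (auto simp flip: comp_smult_right)
    show "\<exists>s\<in>carrier R - p. s \<odot>\<^bsub>Hom C A' A'\<^esub> Ident C A' \<in> Comp C A' M A' \<tau> ` Mor C A' M"
      if p: "maximalideal p R" for p
    proof -
      obtain c v s where c [simp]: "c \<in> Mor C A B" "v \<in> Mor C A' A" and s: "s \<in> carrier R - p" and
        uv: "Comp C A' A A' (h \<oplus>\<^bsub>Hom C A A'\<^esub> Comp C A B A' b c) v = s \<odot>\<^bsub>Hom C A' A'\<^esub> Ident C A'"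
        using loc[OF p] unfolding iso_at_def by blast
      \<comment> \<open>The local section \<open>(v, c v)\<close> of \<open>\<tau>\<close>, up to
        the scalar \<open>s\<close>.\<close>
      let ?\<sigma> = "Comp C A' A M i1 v \<oplus>\<^bsub>Hom C A' M\<^esub> Comp C A' B M i2 (Comp C A' A B c v)"
      have "Comp C A' M A' \<tau> ?\<sigma> = s \<odot>\<^bsub>Hom C A' A'\<^esub> Ident C A'"
        unfolding uv[symmetric] \<tau>_def by (simp add: comp_add_left comp_add_right comp_assoc_left e2)
      then show ?thesis using s by (metis c(2) comp_closed hom_add_closed image_eqI m(1,2,3) o c(1))
    qed
  qed auto
  then obtain \<sigma> where \<sigma> [simp]: "\<sigma> \<in> Mor C A' M" and \<tau>\<sigma>: "Comp C A' M A' \<tau> \<sigma> = Ident C A'" by auto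
  obtain B' \<kappa> \<rho> where [simp]: "B' \<in> Obj C" "\<kappa> \<in> Mor C B' M" "\<rho> \<in> Mor C M B'"
    and k: "Comp C B' M B' \<rho> \<kappa> = Ident C B'" "Comp C B' M A' \<tau> \<kappa> = \<zero>\<^bsub>Hom C B' A'\<^esub>"
      "Comp C A' M B' \<rho> \<sigma> = \<zero>\<^bsub>Hom C A' B'\<^esub>"
      "Comp C M A' M \<sigma> \<tau> \<oplus>\<^bsub>Hom C M M\<^esub> Comp C M B' M \<kappa> \<rho> = Ident C M"
    using retract_complement[OF fa o(2) m(1) \<sigma> \<tau> \<tau>\<sigma>] by blast
  have ds: "is_direct_sum C [A', B'] M"
    unfolding is_direct_sum_pair using k \<tau>\<sigma> \<tau> \<sigma> by (intro conjI bexI[of _ \<sigma>] bexI[of _ \<tau>] bexI[of _ \<kappa>] bexI[of _ \<rho>]) auto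
  have "\<exists>k. iso_at p B' B k" if p: "maximalideal p R" for p
  proof -
    obtain c v s where c [simp]: "c \<in> Mor C A B" "v \<in> Mor C A' A" and s: "s \<in> carrier R" "s \<notin> p" and
      uv: "Comp C A' A A' (h \<oplus>\<^bsub>Hom C A A'\<^esub> Comp C A B A' b c) v = s \<odot>\<^bsub>Hom C A' A'\<^esub> Ident C A'"
        "Comp C A A' A v (h \<oplus>\<^bsub>Hom C A A'\<^esub> Comp C A B A' b c) = s \<odot>\<^bsub>Hom C A A\<^esub> Ident C A"
      using loc[OF p] unfolding iso_at_def by blast
    note [simp] = s(1)
    \<comment> \<open>In coordinates
      \<open>k \<beta> = (- v b \<beta>, s \<beta> - c v b \<beta>)\<close>: the kernel of
      \<open>\<tau>\<close> parametrized by \<open>B\<close>, with denominators cleared. The map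
      \<open>q (\<alpha>, \<beta>) = \<beta> - c \<alpha>\<close> recovers the parameter up to
      \<open>s\<close>.\<close>
    define k where "k = (\<ominus>\<^bsub>Hom C B M\<^esub> Comp C B A M i1 (Comp C B A' A v b)) \<oplus>\<^bsub>Hom C B M\<^esub>
      Comp C B B M i2 (s \<odot>\<^bsub>Hom C B B\<^esub> Ident C B \<oplus>\<^bsub>Hom C B B\<^esub> \<ominus>\<^bsub>Hom C B B\<^esub> Comp C B A B c (Comp C B A' A v b))"
    define q where "q = p2 \<oplus>\<^bsub>Hom C M B\<^esub> \<ominus>\<^bsub>Hom C M B\<^esub> Comp C M A B c p1"
    have [simp]: "k \<in> Mor C B M" "q \<in> Mor C M B" unfolding k_def q_def by simp_all
    have qk: "Comp C B M B q k = s \<odot>\<^bsub>Hom C B B\<^esub> Ident C B"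
      unfolding q_def k_def
      by (simp add: comp_add_left comp_add_right comp_assoc_left comp_smult_right e e2 hom_minus_add hom_a_ac)
    have "Comp C B M A' \<tau> k = s \<odot>\<^bsub>Hom C B A'\<^esub> b \<oplus>\<^bsub>Hom C B A'\<^esub> \<ominus>\<^bsub>Hom C B A'\<^esub>
        Comp C B A' A' (Comp C A' A A' (h \<oplus>\<^bsub>Hom C A A'\<^esub> Comp C A B A' b c) v) b"
      unfolding \<tau>_def k_def
      by (simp add: comp_add_left comp_add_right comp_assoc_left comp_smult_right e e2 hom_minus_add hom_a_ac)
    then have \<tau>k: "Comp C B M A' \<tau> k = \<zero>\<^bsub>Hom C B A'\<^esub>"
      unfolding uv by (simp add: comp_smult_left)
    define y z where "y = Comp C B' M A p1 \<kappa>" and "z = Comp C B' M B p2 \<kappa>"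
    have [simp]: "y \<in> Mor C B' A" "z \<in> Mor C B' B" unfolding y_def z_def by simp_all
    have "Comp C B' A A' h y \<oplus>\<^bsub>Hom C B' A'\<^esub> Comp C B' B A' b z = \<zero>\<^bsub>Hom C B' A'\<^esub>"
      using k(2) unfolding \<tau>_def y_def z_def by (simp add: comp_add_left comp_assoc_left)
    then have bz: "Comp C B' B A' b z = \<ominus>\<^bsub>Hom C B' A'\<^esub> Comp C B' A A' h y"
      by (intro hom_add_eq_zeroD) auto
    have vu: "Comp C B' A' A v (Comp C B' A A' h y) \<oplus>\<^bsub>Hom C B' A\<^esub>
        Comp C B' A' A v (Comp C B' B A' b (Comp C B' A B c y)) = s \<odot>\<^bsub>Hom C B' A\<^esub> y"
    proof -
      have "Comp C B' A A (Comp C A A' A v (h \<oplus>\<^bsub>Hom C A A'\<^esub> Comp C A B A' b c)) y = s \<odot>\<^bsub>Hom C B' A\<^esub> y"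
        unfolding uv by (simp add: comp_smult_left)
      then show ?thesis by (simp add: comp_add_left comp_add_right comp_assoc_left)
    qed
    have \<kappa>: "\<kappa> = Comp C B' A M i1 y \<oplus>\<^bsub>Hom C B' M\<^esub> Comp C B' B M i2 z"
    proof -
      have "\<kappa> = Comp C B' M M (Comp C M A M i1 p1 \<oplus>\<^bsub>Hom C M M\<^esub> Comp C M B M i2 p2) \<kappa>" unfolding e by simp
      then show ?thesis unfolding y_def z_def by (simp add: comp_add_left comp_assoc_left)
    qed
    have q\<kappa>: "Comp C B' M B q \<kappa> = z \<oplus>\<^bsub>Hom C B' B\<^esub> \<ominus>\<^bsub>Hom C B' B\<^esub> Comp C B' A B c y"
      unfolding q_def y_def z_def by (simp add: comp_add_left comp_assoc_left)
    \<comment> \<open>Since \<open>\<tau> \<kappa> = 0\<close> gives \<open>b z = - h y\<close>,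
      applying \<open>v b\<close> to \<open>z - c y\<close> gives
      \<open>- v (h + b c) y\<close>.\<close>
    have vb: "Comp C B' B A (Comp C B A' A v b) (Comp C B' M B q \<kappa>) = \<ominus>\<^bsub>Hom C B' A\<^esub> (s \<odot>\<^bsub>Hom C B' A\<^esub> y)"
      unfolding q\<kappa> vu[symmetric] by (simp add: comp_add_right comp_assoc_left bz hom_minus_add)
    have kq: "Comp C B' B M k (Comp C B' M B q \<kappa>) = s \<odot>\<^bsub>Hom C B' M\<^esub> \<kappa>"
    proof -
      have "Comp C B' B M k (Comp C B' M B q \<kappa>) =
        (\<ominus>\<^bsub>Hom C B' M\<^esub> Comp C B' A M i1 (Comp C B' B A (Comp C B A' A v b) (Comp C B' M B q \<kappa>))) \<oplus>\<^bsub>Hom C B' M\<^esub>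
        Comp C B' B M i2 (s \<odot>\<^bsub>Hom C B' B\<^esub> Comp C B' M B q \<kappa> \<oplus>\<^bsub>Hom C B' B\<^esub>
          \<ominus>\<^bsub>Hom C B' B\<^esub> Comp C B' A B c (Comp C B' B A (Comp C B A' A v b) (Comp C B' M B q \<kappa>)))"
        unfolding k_def by (simp add: comp_add_left comp_assoc_left comp_smult_left)
      also have "\<dots> = s \<odot>\<^bsub>Hom C B' M\<^esub> Comp C B' A M i1 y \<oplus>\<^bsub>Hom C B' M\<^esub> s \<odot>\<^bsub>Hom C B' M\<^esub> Comp C B' B M i2 z"
        unfolding vb unfolding q\<kappa>
        by (simp add: comp_smult_right hom_smult_r_distr hom_smult_r_minus comp_add_right hom_a_assoc)
      also have "\<dots> = s \<odot>\<^bsub>Hom C B' M\<^esub> \<kappa>" unfolding \<kappa> by (simp add: hom_smult_r_distr)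
      finally show ?thesis .
    qed
    have "Comp C B' B B' (Comp C B M B' \<rho> k) (Comp C B' M B q \<kappa>) = s \<odot>\<^bsub>Hom C B' B'\<^esub> Ident C B'"
      by (simp add: comp_assoc_left kq comp_smult_right k)
    moreover have "Comp C B B' B (Comp C B' M B q \<kappa>) (Comp C B M B' \<rho> k) = s \<odot>\<^bsub>Hom C B B\<^esub> Ident C B"
    proof -
      have "k = Comp C B M M (Comp C M A' M \<sigma> \<tau> \<oplus>\<^bsub>Hom C M M\<^esub> Comp C M B' M \<kappa> \<rho>) k" unfolding k by simp
      then have "Comp C B B' M \<kappa> (Comp C B M B' \<rho> k) = k" by (simp add: comp_add_left comp_assoc_left \<tau>k)
      then show ?thesis by (simp add: comp_assoc_left qk)
    qed
    ultimately have "iso_at p B' B (Comp C B' M B q \<kappa>)"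
      by (intro iso_at_scalar[of _ _ _ "Comp C B M B' \<rho> k" s]) (use s in auto)
    then show ?thesis ..
  qed
  then show ?thesis using ds \<open>B' \<in> Obj C\<close> by blast
qed

text \<open>Over \<open>K\<close>, \<open>fg/s\<close> and \<open>jl/t\<close> are idempotents, and
  \<open>f g j = s j\<close> and \<open>j l f = t f\<close> say that each fixes the image of the
  other. Hence the combination with weights \<open>a s\<close> and \<open>b t\<close>, which add up
  to 1, is an idempotent with the same image; it is \<open>a f g + b j l\<close>, free of
  denominators. Its image is identified with \<open>A\<close> by \<open>g\<close> where
  \<open>s\<close> is invertible and by \<open>l\<close> where \<open>t\<close> is.\<close>

lemma glue_summand:
  assumes fa: "fully_additive C" and o [simp]: "A \<in> Obj C" "B \<in> Obj C"
    and m [simp]: "f \<in> Mor C A B" "j \<in> Mor C A B" "g \<in> Mor C B A" "l \<in> Mor C B A" "v \<in> Mor C A A"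
      "s \<in> carrier R" "t \<in> carrier R" "a \<in> carrier R" "b \<in> carrier R"
    and gf: "Comp C A B A g f = s \<odot>\<^bsub>Hom C A A\<^esub> Ident C A"
    and lj: "Comp C A B A l j = t \<odot>\<^bsub>Hom C A A\<^esub> Ident C A"
    and fv: "Comp C A A B f v = s \<odot>\<^bsub>Hom C A B\<^esub> j"
    and gj: "Comp C A B A g j = v"
    and jlf: "Comp C A A B j (Comp C A B A l f) = t \<odot>\<^bsub>Hom C A B\<^esub> f"
    and st: "a \<otimes> s \<oplus> b \<otimes> t = \<one>"
  shows "\<exists>A'\<in>Obj C. direct_summand C A' B \<and> (\<forall>p. maximalideal p R \<longrightarrow> (\<exists>k. iso_at p A' A k))"
proof -
  define e where "e = a \<odot>\<^bsub>Hom C B B\<^esub> Comp C B A B f g \<oplus>\<^bsub>Hom C B B\<^esub> b \<odot>\<^bsub>Hom C B B\<^esub> Comp C B A B j l"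
  have [simp]: "e \<in> Mor C B B" unfolding e_def by simp
  have one: "(a \<otimes> s) \<odot>\<^bsub>Hom C A B\<^esub> h \<oplus>\<^bsub>Hom C A B\<^esub> (b \<otimes> t) \<odot>\<^bsub>Hom C A B\<^esub> h = h" if "h \<in> Mor C A B" for h
    using that st by (simp flip: hom_smult_l_distr)
  have ef: "Comp C A B B e f = f"
    unfolding e_def by (simp add: cat_distribs gf jlf one)
  have ej: "Comp C A B B e j = j"
    unfolding e_def by (simp add: cat_distribs gj fv lj one)
  have ef': "Comp C B B B e (Comp C B A B f g) = Comp C B A B f g" "Comp C B B B e (Comp C B A B j l) = Comp C B A B j l"
    by (simp_all add: comp_assoc ef ej)
  have "Comp C B B B e (a \<odot>\<^bsub>Hom C B B\<^esub> Comp C B A B f g \<oplus>\<^bsub>Hom C B B\<^esub> b \<odot>\<^bsub>Hom C B B\<^esub> Comp C B A B j l) =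
      a \<odot>\<^bsub>Hom C B B\<^esub> Comp C B A B f g \<oplus>\<^bsub>Hom C B B\<^esub> b \<odot>\<^bsub>Hom C B B\<^esub> Comp C B A B j l"
    by (simp add: comp_add_right comp_smult_right ef')
  then have ee: "Comp C B B B e e = e"
    by (simp flip: e_def)
  have fge: "Comp C B B B (Comp C B A B f g) e = s \<odot>\<^bsub>Hom C B B\<^esub> e"
  proof -
    have "Comp C B A B f (Comp C B A A v l) = s \<odot>\<^bsub>Hom C B B\<^esub> Comp C B A B j l"
      by (simp add: comp_assoc fv comp_smult_left)
    moreover have "Comp C B A A v l = Comp C B B A g (Comp C B A B j l)"
      by (simp add: comp_assoc gj)
    moreover have "Comp C B B A g (Comp C B A B f g) = s \<odot>\<^bsub>Hom C B A\<^esub> g"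
      by (simp add: comp_assoc gf comp_smult_left)
    ultimately show ?thesis unfolding e_def by (simp add: cat_distribs m_comm)
  qed
  have jle: "Comp C B B B (Comp C B A B j l) e = t \<odot>\<^bsub>Hom C B B\<^esub> e"
  proof -
    have "Comp C B A B j (Comp C B B A l (Comp C B A B f g)) = t \<odot>\<^bsub>Hom C B B\<^esub> Comp C B A B f g"
    proof -
      have "Comp C B A B j (Comp C B B A l (Comp C B A B f g)) = Comp C B A B (Comp C A A B j (Comp C A B A l f)) g"
        by (simp add: comp_assoc_left)
      then show ?thesis unfolding jlf by (simp add: comp_smult_left)
    qed
    moreover have "Comp C B B A l (Comp C B A B j l) = t \<odot>\<^bsub>Hom C B A\<^esub> l"
      by (simp add: comp_assoc lj comp_smult_left)
    ultimately show ?thesis unfolding e_def by (simp add: cat_distribs m_comm)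
  qed
  obtain A' p i where [simp]: "A' \<in> Obj C" "p \<in> Mor C B A'" "i \<in> Mor C A' B"
    and ip: "Comp C B A' B i p = e" "Comp C A' B A' p i = Ident C A'"
    using fa ee unfolding fully_additive_def by (metis \<open>e \<in> Mor C B B\<close> o(2))
  have ei: "Comp C A' B B e i = i"
    unfolding ip(1)[symmetric] by (simp add: comp_assoc_left ip(2))
  \<comment> \<open>\<open>(h, h', r)\<close> stands for \<open>(f, g, s)\<close> or
    \<open>(j, l, t)\<close>; the maps inverse to each other up to \<open>r\<close> are
    \<open>h' i\<close> and \<open>p h\<close>.\<close>
  have iso: "iso_at q A' A (Comp C A' B A h' i)"
    if h: "h \<in> Mor C A B" "h' \<in> Mor C B A" "r \<in> carrier R" "r \<notin> q"
      and h'h: "Comp C A B A h' h = r \<odot>\<^bsub>Hom C A A\<^esub> Ident C A"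
      and eh: "Comp C A B B e h = h" and hh'e: "Comp C B B B (Comp C B A B h h') e = r \<odot>\<^bsub>Hom C B B\<^esub> e" for h h' r q
  proof (rule iso_at_scalar[of _ _ _ "Comp C A B A' p h" r])
    have "Comp C A A' B i (Comp C A B A' p h) = h"
      using h by (simp add: comp_assoc ip eh)
    then show "Comp C A' A A' (Comp C A B A' p h) (Comp C A' B A h' i) = r \<odot>\<^bsub>Hom C A' A'\<^esub> Ident C A'"
    proof -
      have "Comp C A' A B h (Comp C A' B A h' i) = Comp C A' B B (Comp C B B B (Comp C B A B h h') e) i"
        using h by (simp add: comp_assoc_left ei)
      also have "\<dots> = r \<odot>\<^bsub>Hom C A' B\<^esub> i" unfolding hh'e using h by (simp add: comp_smult_left ei)
      finally show ?thesis using h by (simp add: comp_assoc_left comp_smult_right ip)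
    qed
    show "Comp C A A' A (Comp C A' B A h' i) (Comp C A B A' p h) = r \<odot>\<^bsub>Hom C A A\<^esub> Ident C A"
      using h \<open>Comp C A A' B i (Comp C A B A' p h) = h\<close> by (simp add: comp_assoc_left h'h)
  qed (use h in auto)
  have "\<exists>k. iso_at q A' A k" if q: "maximalideal q R" for q
  proof (cases "s \<in> q")
    case True
    interpret q: maximalideal q R by fact
    have "t \<notin> q"
    proof
      assume "t \<in> q"
      then have "a \<otimes> s \<oplus> b \<otimes> t \<in> q" using True by (intro q.a_closed q.I_l_closed) auto
      then show False using st one_notin_maximalideal[OF q] by simp
    qed
    then show ?thesis using iso[OF m(2,4,7) _ lj ej jle] by blast
  next
    case False
    then show ?thesis using iso[OF m(1,3,6) _ gf ef fge] by blast
  qed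
  moreover have "direct_summand C A' B"
    by (rule retract_direct_summand[OF fa]) (use ip in auto)
  ultimately show ?thesis by (intro bexI[of _ A']) auto
qed

end

section \<open>Roiter's exchange: a map \<open>A \<rightarrow> A'\<close> that is locally
  correctable through \<open>B\<close>\<close>

context hom_finite_over_dedekind begin

text \<open>The maps that factor through the column \<open>A \<rightarrow> B^n\<close> with entries
  \<open>y_k\<close>. Recursion on the list lets \<open>choose_columns\<close> fix the coefficients
  one at a time.\<close>

primrec factor_sums :: "'o \<Rightarrow> 'o \<Rightarrow> 'o \<Rightarrow> 'm list \<Rightarrow> 'm set" where
  "factor_sums A B A' [] = {\<zero>\<^bsub>Hom C A A'\<^esub>}"
| "factor_sums A B A' (y # ys) =
    {Comp C A B A' c y \<oplus>\<^bsub>Hom C A A'\<^esub> z | c z. c \<in> Mor C B A' \<and> z \<in> factor_sums A B A' ys}"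

lemma factor_sums_closed:
  assumes "A \<in> Obj C" "B \<in> Obj C" "A' \<in> Obj C" "set ys \<subseteq> Mor C A B"
  shows "factor_sums A B A' ys \<subseteq> Mor C A A'"
  using assms(4) by (induction ys) (use assms(1-3) in auto)

lemma zero_in_factor_sums:
  assumes "A \<in> Obj C" "B \<in> Obj C" "A' \<in> Obj C" "set ys \<subseteq> Mor C A B"
  shows "\<zero>\<^bsub>Hom C A A'\<^esub> \<in> factor_sums A B A' ys"
  using assms(4)
proof (induction ys)
  case (Cons y ys)
  then show ?case using assms(1-3) unfolding factor_sums.simps mem_Collect_eq
    by (rule_tac exI[of _ "\<zero>\<^bsub>Hom C B A'\<^esub>"], rule_tac exI[of _ "\<zero>\<^bsub>Hom C A A'\<^esub>"]) auto
qed simp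

text \<open>The columns \<open>c\<close> of \<open>h = \<Sum> c y\<close> are chosen one after the other. At the finitely many \<open>p\<close> where
  the present \<open>h\<close> is not an isomorphism, the next column is prescribed modulo \<open>p\<close>; at all other
  \<open>p\<close> a change by \<open>c y\<close> can be undone with \<open>b = -c\<close>.\<close>

lemma choose_columns:
  assumes inf: "infinite {p. maximalideal p R}"
    and o [simp]: "A \<in> Obj C" "B \<in> Obj C" "A' \<in> Obj C"
    and ys: "set ys \<subseteq> Mor C A B"
    and h: "h \<in> Mor C A A'" "\<exists>q. maximalideal q R \<and> iso_at q A A' h"
    and loc: "\<And>p. maximalideal p R \<Longrightarrow> \<exists>z\<in>factor_sums A B A' ys. \<exists>b\<in>Mor C B A'. \<exists>g\<in>Mor C A B.
      iso_at p A A' (h \<oplus>\<^bsub>Hom C A A'\<^esub> (z \<oplus>\<^bsub>Hom C A A'\<^esub> Comp C A B A' b g))"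
  shows "\<exists>h'\<in>Mor C A A'. (\<exists>q. maximalideal q R \<and> iso_at q A A' h') \<and>
    (\<forall>p. maximalideal p R \<longrightarrow> (\<exists>b\<in>Mor C B A'. \<exists>g\<in>Mor C A B.
      iso_at p A A' (h' \<oplus>\<^bsub>Hom C A A'\<^esub> Comp C A B A' b g)))"
  using ys h loc
proof (induction ys arbitrary: h)
  case Nil
  have "\<exists>b\<in>Mor C B A'. \<exists>g\<in>Mor C A B. iso_at p A A' (h \<oplus>\<^bsub>Hom C A A'\<^esub> Comp C A B A' b g)"
    if p: "maximalideal p R" for p
    using Nil.prems(4)[OF p] by auto
  then show ?case using Nil.prems by blast
next
  case (Cons y ys)
  have y [simp]: "y \<in> Mor C A B" and ys: "set ys \<subseteq> Mor C A B" using Cons.prems by auto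
  note [simp] = Cons.prems(2)
  note fs = factor_sums_closed[OF o ys, THEN subsetD]
  define S where "S = {p. maximalideal p R \<and> \<not> iso_at p A A' h}"
  have S: "finite S" unfolding S_def using finite_not_iso_at Cons.prems(3) by auto
  \<comment> \<open>Infinitely many maximal ideals leave one outside the finite set
    \<open>S\<close>. Keeping the next map invertible at \<open>q\<close> ensures that its set of
    bad \<open>p\<close> is finite again.\<close>
  then obtain q where q: "maximalideal q R" "iso_at q A A' h" "q \<notin> S"
    using inf unfolding S_def by (metis (mono_tags, lifting) mem_Collect_eq finite_subset subsetI)
  \<comment> \<open>At \<open>q\<close> invertibility is asked for; at a bad \<open>p\<close> the
    coefficient \<open>c\<close> has to leave the problem solvable with the remaining columns. Both
    survive changing \<open>c\<close> modulo \<open>p\<close>.\<close>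
  define \<Phi> where "\<Phi> p c \<longleftrightarrow> (p = q \<longrightarrow> iso_at p A A' (h \<oplus>\<^bsub>Hom C A A'\<^esub> Comp C A B A' c y)) \<and>
    (p \<in> S \<longrightarrow> (\<exists>z\<in>factor_sums A B A' ys. \<exists>b\<in>Mor C B A'. \<exists>g\<in>Mor C A B.
      iso_at p A A' (h \<oplus>\<^bsub>Hom C A A'\<^esub> Comp C A B A' c y \<oplus>\<^bsub>Hom C A A'\<^esub>
        (z \<oplus>\<^bsub>Hom C A A'\<^esub> Comp C A B A' b g))))" for p c
  have "\<exists>c\<in>Mor C B A'. \<forall>p\<in>insert q S. \<Phi> p c"
  proof (rule interpolate)
    show "finite (insert q S)" using S by simp
    show max: "maximalideal p R" if "p \<in> insert q S" for p using that q unfolding S_def by auto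
    show "\<exists>c\<in>Mor C B A'. \<Phi> p c" if pS: "p \<in> insert q S" for p
    proof (cases "p = q")
      case True
      then show ?thesis unfolding \<Phi>_def using q by (intro bexI[of _ "\<zero>\<^bsub>Hom C B A'\<^esub>"]) auto
    next
      case False
      obtain z' b g where z': "z' \<in> factor_sums A B A' (y # ys)" "b \<in> Mor C B A'" "g \<in> Mor C A B"
        "iso_at p A A' (h \<oplus>\<^bsub>Hom C A A'\<^esub> (z' \<oplus>\<^bsub>Hom C A A'\<^esub> Comp C A B A' b g))"
        using Cons.prems(4)[OF max[OF pS]] by blast
      then obtain c z where cz: "c \<in> Mor C B A'" "z \<in> factor_sums A B A' ys" "z' = Comp C A B A' c y \<oplus>\<^bsub>Hom C A A'\<^esub> z"
        by auto
      have "iso_at p A A' (h \<oplus>\<^bsub>Hom C A A'\<^esub> Comp C A B A' c y \<oplus>\<^bsub>Hom C A A'\<^esub> (z \<oplus>\<^bsub>Hom C A A'\<^esub> Comp C A B A' b g))"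
        using z' cz fs[OF cz(2)] by (simp add: hom_a_assoc)
      then show ?thesis unfolding \<Phi>_def using False cz z' by blast
    qed
    show "\<Phi> p (c \<oplus>\<^bsub>Hom C B A'\<^esub> r \<odot>\<^bsub>Hom C B A'\<^esub> m)"
      if p: "p \<in> insert q S" and c: "c \<in> Mor C B A'" "m \<in> Mor C B A'" and r: "r \<in> p" and \<Phi>: "\<Phi> p c" for p c m r
    proof -
      have r': "r \<in> carrier R" using maximalideal_Icarr[OF max[OF p] r] .
      have pert: "iso_at p A A' (x \<oplus>\<^bsub>Hom C A A'\<^esub> r \<odot>\<^bsub>Hom C A A'\<^esub> Comp C A B A' m y)" if "iso_at p A A' x" for x
        by (rule iso_at_perturbation[OF max[OF p] _ _ that _ r]) (use c in auto)
      show ?thesis unfolding \<Phi>_def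
      proof (intro conjI impI)
        assume "p = q"
        then have "iso_at p A A' (h \<oplus>\<^bsub>Hom C A A'\<^esub> Comp C A B A' c y)" using \<Phi> unfolding \<Phi>_def by blast
        from pert[OF this] show "iso_at p A A' (h \<oplus>\<^bsub>Hom C A A'\<^esub> Comp C A B A' (c \<oplus>\<^bsub>Hom C B A'\<^esub> r \<odot>\<^bsub>Hom C B A'\<^esub> m) y)"
          using c r' by (simp add: comp_add_left comp_smult_left hom_a_assoc)
      next
        assume "p \<in> S"
        then obtain z b g where zbg: "z \<in> factor_sums A B A' ys" "b \<in> Mor C B A'" "g \<in> Mor C A B" and
          iso: "iso_at p A A' (h \<oplus>\<^bsub>Hom C A A'\<^esub> Comp C A B A' c y \<oplus>\<^bsub>Hom C A A'\<^esub> (z \<oplus>\<^bsub>Hom C A A'\<^esub> Comp C A B A' b g))"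
          using \<Phi> unfolding \<Phi>_def by blast
        have "iso_at p A A' (h \<oplus>\<^bsub>Hom C A A'\<^esub> Comp C A B A' (c \<oplus>\<^bsub>Hom C B A'\<^esub> r \<odot>\<^bsub>Hom C B A'\<^esub> m) y \<oplus>\<^bsub>Hom C A A'\<^esub>
            (z \<oplus>\<^bsub>Hom C A A'\<^esub> Comp C A B A' b g))"
          using pert[OF iso] c r' zbg fs[OF zbg(1)] by (simp add: comp_add_left comp_smult_left hom_a_ac)
        then show "\<exists>z\<in>factor_sums A B A' ys. \<exists>b\<in>Mor C B A'. \<exists>g\<in>Mor C A B.
          iso_at p A A' (h \<oplus>\<^bsub>Hom C A A'\<^esub> Comp C A B A' (c \<oplus>\<^bsub>Hom C B A'\<^esub> r \<odot>\<^bsub>Hom C B A'\<^esub> m) y \<oplus>\<^bsub>Hom C A A'\<^esub>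
            (z \<oplus>\<^bsub>Hom C A A'\<^esub> Comp C A B A' b g))" using zbg by blast
      qed
    qed
  qed simp_all
  then obtain c where c [simp]: "c \<in> Mor C B A'" and \<Phi>: "\<And>p. p \<in> insert q S \<Longrightarrow> \<Phi> p c" by blast
  define h' where "h' = h \<oplus>\<^bsub>Hom C A A'\<^esub> Comp C A B A' c y"
  show ?case
  proof (rule Cons.IH[OF ys, of h'])
    show "h' \<in> Mor C A A'" unfolding h'_def by simp
    show "\<exists>q. maximalideal q R \<and> iso_at q A A' h'"
      using \<Phi>[of q] q unfolding \<Phi>_def h'_def by blast
    show "\<exists>z\<in>factor_sums A B A' ys. \<exists>b\<in>Mor C B A'. \<exists>g\<in>Mor C A B.
      iso_at p A A' (h' \<oplus>\<^bsub>Hom C A A'\<^esub> (z \<oplus>\<^bsub>Hom C A A'\<^esub> Comp C A B A' b g))" if p: "maximalideal p R" for p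
    proof (cases "p \<in> S")
      case True
      then show ?thesis using \<Phi>[of p] unfolding \<Phi>_def h'_def by blast
    next
      case False
      then have "iso_at p A A' h" using p unfolding S_def by blast
      moreover have "h' \<oplus>\<^bsub>Hom C A A'\<^esub> (\<zero>\<^bsub>Hom C A A'\<^esub> \<oplus>\<^bsub>Hom C A A'\<^esub> Comp C A B A' (\<ominus>\<^bsub>Hom C B A'\<^esub> c) y) = h"
        unfolding h'_def by (simp add: hom_a_assoc)
      ultimately show ?thesis using zero_in_factor_sums[OF o ys]
        by (metis c hom_neg_closed o(2,3) y)
    qed
  qed
qed

text \<open>The coefficients are the composites \<open>w x_i\<close>. The list is reversed because
  the induction on \<open>n\<close> splits off the last summand, which has to become the
  head.\<close>

lemma finsum_in_factor_sums:
  fixes x y :: "nat \<Rightarrow> 'm"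
  assumes o [simp]: "A \<in> Obj C" "B \<in> Obj C" "A' \<in> Obj C"
    and xy: "\<And>i. i < n \<Longrightarrow> x i \<in> Mor C B A" "\<And>i. i < n \<Longrightarrow> y i \<in> Mor C A B" and w: "w \<in> Mor C A A'"
  shows "Comp C A A A' w (\<Oplus>\<^bsub>Hom C A A\<^esub>i\<in>{..<n}. Comp C A B A (x i) (y i)) \<in> factor_sums A B A' (map y (rev [0..<n]))"
proof -
  interpret M: abelian_group "Hom C A A" using hom_abelian_group by simp
  show ?thesis using xy
  proof (induction n)
    case (Suc n)
    let ?s = "\<Oplus>\<^bsub>Hom C A A\<^esub>i\<in>{..<n}. Comp C A B A (x i) (y i)"
    have s: "?s \<in> Mor C A A" using Suc.prems by (intro M.finsum_closed) auto
    have "(\<Oplus>\<^bsub>Hom C A A\<^esub>i\<in>{..<Suc n}. Comp C A B A (x i) (y i)) = Comp C A B A (x n) (y n) \<oplus>\<^bsub>Hom C A A\<^esub> ?s"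
      unfolding lessThan_Suc using Suc.prems by (intro M.finsum_insert) auto
    then have "Comp C A A A' w (\<Oplus>\<^bsub>Hom C A A\<^esub>i\<in>{..<Suc n}. Comp C A B A (x i) (y i)) =
        Comp C A B A' (Comp C B A A' w (x n)) (y n) \<oplus>\<^bsub>Hom C A A'\<^esub> Comp C A A A' w ?s"
      using Suc.prems w s by (simp add: comp_add_right comp_assoc_left)
    moreover have "Comp C B A A' w (x n) \<in> Mor C B A'" using Suc.prems w by simp
    moreover have "Comp C A A A' w ?s \<in> factor_sums A B A' (map y (rev [0..<n]))"
      using Suc by simp
    ultimately show ?case by auto
  qed (use w in simp)
qed

text \<open>Where \<open>d\<close> is invertible, every map \<open>A \<rightarrow> A'\<close> is
  congruent modulo \<open>p\<close> to a sum \<open>\<Sum> c_k y_k\<close>, so \<open>h\<close> can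
  be moved to any local isomorphism; at the finitely many \<open>p\<close> containing
  \<open>d\<close> it is chosen to be one from the start.\<close>

theorem roiter_map:
  fixes x y :: "nat \<Rightarrow> 'm"
  assumes o [simp]: "A \<in> Obj C" "B \<in> Obj C" "A' \<in> Obj C"
    and xy: "\<And>i. i < n \<Longrightarrow> x i \<in> Mor C B A" "\<And>i. i < n \<Longrightarrow> y i \<in> Mor C A B"
    and d: "d \<in> carrier R" "d \<noteq> \<zero>"
    and sum: "(\<Oplus>\<^bsub>Hom C A A\<^esub>i\<in>{..<n}. Comp C A B A (x i) (y i)) = d \<odot>\<^bsub>Hom C A A\<^esub> Ident C A"
    and gen: "\<And>p. maximalideal p R \<Longrightarrow> \<exists>f. iso_at p A A' f"
  shows "\<exists>h\<in>Mor C A A'. \<exists>b\<in>Mor C B A'. \<forall>p. maximalideal p R \<longrightarrow>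
    (\<exists>c\<in>Mor C A B. iso_at p A A' (h \<oplus>\<^bsub>Hom C A A'\<^esub> Comp C A B A' b c))"
proof -
  have semilocal: "\<exists>h\<in>Mor C A A'. \<forall>p\<in>F. iso_at p A A' h"
    if F: "finite F" "\<And>p. p \<in> F \<Longrightarrow> maximalideal p R" for F
  proof (rule interpolate[OF F])
    show "\<exists>c\<in>Mor C A A'. iso_at p A A' c" if "p \<in> F" for p
      using gen[OF F(2)[OF that]] iso_atD by blast
    show "iso_at p A A' (c \<oplus>\<^bsub>Hom C A A'\<^esub> r \<odot>\<^bsub>Hom C A A'\<^esub> m)"
      if "p \<in> F" "c \<in> Mor C A A'" "m \<in> Mor C A A'" "r \<in> p" "iso_at p A A' c" for p c m r
      by (rule iso_at_perturbation[OF F(2)[OF that(1)] o(1,3) that(5,3,4)])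
  qed auto
  show ?thesis
  proof (cases "finite {p. maximalideal p R}")
    case True
    then obtain h where h: "h \<in> Mor C A A'" "\<And>p. maximalideal p R \<Longrightarrow> iso_at p A A' h"
      using semilocal[OF True] by blast
    then show ?thesis
      by (intro bexI[of _ h] bexI[of _ "\<zero>\<^bsub>Hom C B A'\<^esub>"] allI impI bexI[of _ "\<zero>\<^bsub>Hom C A B\<^esub>"]) auto
  next
    case inf: False
    let ?ys = "map y (rev [0..<n])"
    have ys: "set ?ys \<subseteq> Mor C A B" using xy by auto
    obtain q where q: "maximalideal q R" using exists_maximalideal by blast
    \<comment> \<open>\<open>q\<close> is added so that \<open>h\<close> is invertible somewhere
      even if no maximal ideal contains \<open>d\<close>.\<close>
    let ?F = "insert q {p. maximalideal p R \<and> d \<in> p}"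
    have F: "finite ?F" "\<And>p. p \<in> ?F \<Longrightarrow> maximalideal p R"
      using finite_maximalideals_containing[OF d] q by auto
    obtain h where h [simp]: "h \<in> Mor C A A'" and "\<forall>p\<in>?F. iso_at p A A' h"
      using semilocal[OF F] by blast
    then have hq: "iso_at q A A' h" "\<And>p. maximalideal p R \<Longrightarrow> d \<in> p \<Longrightarrow> iso_at p A A' h"
      by blast+
    have "\<exists>z\<in>factor_sums A B A' ?ys. \<exists>b\<in>Mor C B A'. \<exists>g\<in>Mor C A B.
      iso_at p A A' (h \<oplus>\<^bsub>Hom C A A'\<^esub> (z \<oplus>\<^bsub>Hom C A A'\<^esub> Comp C A B A' b g))" if p: "maximalideal p R" for p
    proof -
      obtain z where z: "z \<in> factor_sums A B A' ?ys" "iso_at p A A' (h \<oplus>\<^bsub>Hom C A A'\<^esub> z)"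
      proof (cases "d \<in> p")
        case True
        then show ?thesis using that[OF zero_in_factor_sums[OF o ys]] hq(2)[OF p] by simp
      next
        case False
        obtain f where f: "iso_at p A A' f" using gen[OF p] by blast
        have [simp]: "f \<in> Mor C A A'" using iso_atD[OF f] .
        obtain r where r: "r \<in> carrier R" "\<one> \<ominus> r \<otimes> d \<in> p"
          using maximalideal_coprime[OF p d(1) False] by blast
        note [simp] = r(1) d(1)
        \<comment> \<open>Since \<open>r d\<close> is 1 modulo \<open>p\<close>, adding
          \<open>d r (f - h)\<close> to \<open>h\<close> gives \<open>f\<close> modulo
          \<open>p\<close>; the factor \<open>d\<close> turns this change into a sum over the given
          \<open>x_i y_i\<close>.\<close>
        let ?w = "r \<odot>\<^bsub>Hom C A A'\<^esub> (f \<oplus>\<^bsub>Hom C A A'\<^esub> \<ominus>\<^bsub>Hom C A A'\<^esub> h)"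
        have "Comp C A A A' ?w (d \<odot>\<^bsub>Hom C A A\<^esub> Ident C A) \<in> factor_sums A B A' ?ys"
          unfolding sum[symmetric] by (rule finsum_in_factor_sums) (use xy in auto)
        then have mem: "(d \<otimes> r) \<odot>\<^bsub>Hom C A A'\<^esub> (f \<oplus>\<^bsub>Hom C A A'\<^esub> \<ominus>\<^bsub>Hom C A A'\<^esub> h) \<in> factor_sums A B A' ?ys"
          by (simp add: comp_smult_right hom_smult_assoc)
        have "h \<oplus>\<^bsub>Hom C A A'\<^esub> (d \<otimes> r) \<odot>\<^bsub>Hom C A A'\<^esub> (f \<oplus>\<^bsub>Hom C A A'\<^esub> \<ominus>\<^bsub>Hom C A A'\<^esub> h) =
            f \<oplus>\<^bsub>Hom C A A'\<^esub> (\<one> \<ominus> r \<otimes> d) \<odot>\<^bsub>Hom C A A'\<^esub> (h \<oplus>\<^bsub>Hom C A A'\<^esub> \<ominus>\<^bsub>Hom C A A'\<^esub> f)"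
          by (simp add: a_minus_def hom_smult_l_distr hom_smult_r_distr hom_smult_l_minus hom_smult_r_minus
              hom_minus_add hom_a_ac m_comm[of r d], simp add: hom_a_lcomm[of A A' h "\<ominus>\<^bsub>Hom C A A'\<^esub> f"])
        then show ?thesis using that[OF mem] iso_at_perturbation[OF p o(1,3) f _ r(2)] by simp
      qed
      have "z \<in> Mor C A A'" using z factor_sums_closed[OF o ys] by blast
      then have "z \<oplus>\<^bsub>Hom C A A'\<^esub> Comp C A B A' \<zero>\<^bsub>Hom C B A'\<^esub> \<zero>\<^bsub>Hom C A B\<^esub> = z" by simp
      then show ?thesis using z by (metis hom_zero_closed o)
    qed
    then obtain h' where h' [simp]: "h' \<in> Mor C A A'" and q: "\<exists>q. maximalideal q R \<and> iso_at q A A' h'"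
      and loc: "\<And>p. maximalideal p R \<Longrightarrow> \<exists>b\<in>Mor C B A'. \<exists>g\<in>Mor C A B. iso_at p A A' (h' \<oplus>\<^bsub>Hom C A A'\<^esub> Comp C A B A' b g)"
      using choose_columns[OF inf o ys h] q hq(1) by blast
    \<comment> \<open>All columns are fixed, and a single \<open>b\<close> must now serve every
      \<open>p\<close>. Only the finitely many \<open>p\<close> in \<open>S\<close> constrain it,
      with \<open>g\<close> depending on \<open>p\<close>; elsewhere \<open>g = 0\<close>
      works.\<close>
    define S where "S = {p. maximalideal p R \<and> \<not> iso_at p A A' h'}"
    have "\<exists>b\<in>Mor C B A'. \<forall>p\<in>S. \<exists>g\<in>Mor C A B. iso_at p A A' (h' \<oplus>\<^bsub>Hom C A A'\<^esub> Comp C A B A' b g)"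
    proof (rule interpolate)
      show "finite S" unfolding S_def using finite_not_iso_at q by auto
      show max: "maximalideal p R" if "p \<in> S" for p using that unfolding S_def by blast
      show "\<exists>b\<in>Mor C B A'. \<exists>g\<in>Mor C A B. iso_at p A A' (h' \<oplus>\<^bsub>Hom C A A'\<^esub> Comp C A B A' b g)" if "p \<in> S" for p
        using loc max[OF that] by blast
      show "\<exists>g\<in>Mor C A B. iso_at p A A' (h' \<oplus>\<^bsub>Hom C A A'\<^esub> Comp C A B A' (c \<oplus>\<^bsub>Hom C B A'\<^esub> r \<odot>\<^bsub>Hom C B A'\<^esub> m) g)"
        if p: "p \<in> S" and c: "c \<in> Mor C B A'" "m \<in> Mor C B A'" and r: "r \<in> p"
          and ex: "\<exists>g\<in>Mor C A B. iso_at p A A' (h' \<oplus>\<^bsub>Hom C A A'\<^esub> Comp C A B A' c g)" for p c m r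
      proof -
        obtain g where g: "g \<in> Mor C A B" "iso_at p A A' (h' \<oplus>\<^bsub>Hom C A A'\<^esub> Comp C A B A' c g)" using ex by blast
        have "r \<in> carrier R" using maximalideal_Icarr[OF max[OF p] r] .
        then have "iso_at p A A' (h' \<oplus>\<^bsub>Hom C A A'\<^esub> Comp C A B A' (c \<oplus>\<^bsub>Hom C B A'\<^esub> r \<odot>\<^bsub>Hom C B A'\<^esub> m) g)"
          using iso_at_perturbation[OF max[OF p] o(1,3) g(2), of "Comp C A B A' m g" r] r c g
          by (simp add: comp_add_left comp_smult_left hom_a_assoc)
        then show ?thesis using g by blast
      qed
    qed auto
    then obtain b where b: "b \<in> Mor C B A'" "\<And>p. p \<in> S \<Longrightarrow> \<exists>g\<in>Mor C A B. iso_at p A A' (h' \<oplus>\<^bsub>Hom C A A'\<^esub> Comp C A B A' b g)"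
      by blast
    have "\<exists>g\<in>Mor C A B. iso_at p A A' (h' \<oplus>\<^bsub>Hom C A A'\<^esub> Comp C A B A' b g)" if "maximalideal p R" for p
    proof (cases "p \<in> S")
      case False
      then show ?thesis using that b(1) unfolding S_def by (intro bexI[of _ "\<zero>\<^bsub>Hom C A B\<^esub>"]) auto
    qed (use b in blast)
    then show ?thesis using b(1) h' by blast
  qed
qed

end

section \<open>Local summands: combining a map split away from \<open>s\<close> with a map split at
  \<open>s\<close>\<close>

lemma (in cring) comaximal_power:
  assumes c [simp]: "a \<in> carrier R" "s \<in> carrier R" "t \<in> carrier R" and t: "t = \<one> \<oplus> a \<otimes> s"
  shows "\<exists>x\<in>carrier R. \<exists>y\<in>carrier R. x \<otimes> s [^] (n::nat) \<oplus> y \<otimes> t = \<one>"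
proof (induction n)
  case 0
  show ?case by (intro bexI[of _ \<one>] bexI[of _ \<zero>]) auto
next
  case (Suc n)
  then obtain x y where xy: "x \<in> carrier R" "y \<in> carrier R" "x \<otimes> s [^] n \<oplus> y \<otimes> t = \<one>" by blast
  define w where "w = s [^] n"
  have w: "w \<in> carrier R" unfolding w_def by simp
  have one: "t \<ominus> a \<otimes> s = \<one>" unfolding t by (simp add: a_minus_def a_assoc r_neg)
  \<comment> \<open>The relation for \<open>n\<close> is multiplied by \<open>t - a s = 1\<close>,
    and the multiples of \<open>t\<close> are collected.\<close>
  have "(\<ominus> (x \<otimes> a)) \<otimes> (w \<otimes> s) \<oplus> (x \<otimes> w \<oplus> y \<otimes> (t \<ominus> a \<otimes> s)) \<otimes> t = (x \<otimes> w \<oplus> y \<otimes> t) \<otimes> (t \<ominus> a \<otimes> s)"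
    using xy(1,2) w c by algebra
  also have "\<dots> = \<one>" using xy one unfolding w_def by simp
  finally show ?case using xy w
    by (intro bexI[of _ "\<ominus> (x \<otimes> a)"] bexI[of _ "x \<otimes> w \<oplus> y \<otimes> (t \<ominus> a \<otimes> s)"]) (auto simp: w_def)
qed

context hom_finite_over_dedekind begin

text \<open>\<open>?T\<close> consists of the scalars that some \<open>l j\<close> attains modulo
  \<open>s\<close>. It contains \<open>s\<close> trivially, and at the \<open>p\<close> containing
  \<open>s\<close> a local left inverse supplies an element outside \<open>p\<close>; hence 1 is
  attained up to a multiple of \<open>s\<close>.\<close>

lemma semilocal_split:
  assumes o [simp]: "A \<in> Obj C" "B \<in> Obj C" and jm [simp]: "j \<in> Mor C A B" and s [simp]: "s \<in> carrier R"
    and loc: "\<And>p. maximalideal p R \<Longrightarrow> s \<in> p \<Longrightarrow> split_at p A B j"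
  shows "\<exists>l\<in>Mor C B A. \<exists>a\<in>carrier R. Comp C A B A l j = (\<one> \<oplus> a \<otimes> s) \<odot>\<^bsub>Hom C A A\<^esub> Ident C A"
proof -
  let ?T = "{t \<in> carrier R. \<exists>l\<in>Mor C B A. \<exists>a\<in>carrier R. Comp C A B A l j = (t \<oplus> a \<otimes> s) \<odot>\<^bsub>Hom C A A\<^esub> Ident C A}"
  have "ideal ?T R"
  proof (rule cring_idealI)
    show "\<zero> \<in> ?T" by (auto intro!: bexI[of _ "\<zero>\<^bsub>Hom C B A\<^esub>"] bexI[of _ \<zero>])
    show "t \<oplus> t' \<in> ?T" if tt: "t \<in> ?T" "t' \<in> ?T" for t t'
    proof -
      obtain l a l' a' where l: "l \<in> Mor C B A" "a \<in> carrier R" "Comp C A B A l j = (t \<oplus> a \<otimes> s) \<odot>\<^bsub>Hom C A A\<^esub> Ident C A"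
        "l' \<in> Mor C B A" "a' \<in> carrier R" "Comp C A B A l' j = (t' \<oplus> a' \<otimes> s) \<odot>\<^bsub>Hom C A A\<^esub> Ident C A"
        "t \<in> carrier R" "t' \<in> carrier R"
        using tt by blast
      have "Comp C A B A (l \<oplus>\<^bsub>Hom C B A\<^esub> l') j = (t \<oplus> t' \<oplus> (a \<oplus> a') \<otimes> s) \<odot>\<^bsub>Hom C A A\<^esub> Ident C A"
        using l by (simp add: comp_add_left hom_smult_l_distr l_distr hom_a_ac)
      then show ?thesis using l by (metis (mono_tags, lifting) a_closed hom_add_closed mem_Collect_eq o)
    qed
    show "x \<otimes> t \<in> ?T" if tt: "t \<in> ?T" "x \<in> carrier R" for t x
    proof -
      obtain l a where l: "l \<in> Mor C B A" "a \<in> carrier R" "Comp C A B A l j = (t \<oplus> a \<otimes> s) \<odot>\<^bsub>Hom C A A\<^esub> Ident C A"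
        "t \<in> carrier R"
        using tt by blast
      have "Comp C A B A (x \<odot>\<^bsub>Hom C B A\<^esub> l) j = (x \<otimes> t \<oplus> (x \<otimes> a) \<otimes> s) \<odot>\<^bsub>Hom C A A\<^esub> Ident C A"
        using l tt by (simp add: smult_simps r_distr m_assoc)
      then show ?thesis using l tt by (metis (mono_tags, lifting) m_closed hom_smult_closed mem_Collect_eq o)
    qed
  qed auto
  then have "\<one> \<in> ?T"
  proof (rule local_global[OF _ _ noetherian])
    fix p assume p: "maximalideal p R"
    show "\<exists>t\<in>?T. t \<notin> p"
    proof (cases "s \<in> p")
      case True
      then obtain l t where "l \<in> Mor C B A" "t \<in> carrier R - p" "Comp C A B A l j = t \<odot>\<^bsub>Hom C A A\<^esub> Ident C A"
        using loc[OF p] unfolding split_at_def by blast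
      then show ?thesis by (intro bexI[of _ t]) (auto intro!: bexI[of _ l] bexI[of _ \<zero>])
    next
      case False
      \<comment> \<open>With \<open>l = 0\<close> and \<open>a = - 1\<close> the required scalar is
        \<open>s - s = 0\<close>.\<close>
      have "s \<in> ?T"
        by (auto intro!: bexI[of _ "\<zero>\<^bsub>Hom C B A\<^esub>"] bexI[of _ "\<ominus> \<one>"] simp: l_minus r_neg)
      then show ?thesis using False by blast
    qed
  qed
  then show ?thesis by blast
qed

text \<open>Over \<open>K\<close>, the maps \<open>f\<close> (split away from \<open>s\<close>) and \<open>j\<close> (split at \<open>s\<close>) constructed here have the
  same image; gluing along \<open>v\<close> yields the required object of the genus.\<close>

theorem local_summand:
  assumes fa: "fully_additive C" and o [simp]: "A \<in> Obj C" "B \<in> Obj C"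
    and loc: "\<And>p. maximalideal p R \<Longrightarrow> \<exists>f. split_at p A B f"
  shows "\<exists>A'\<in>Obj C. direct_summand C A' B \<and> (\<forall>p. maximalideal p R \<longrightarrow> (\<exists>k. iso_at p A' A k))"
proof (cases "finite {p. maximalideal p R}")
  case True
  have "\<exists>f\<in>Mor C A B. \<forall>p\<in>{p. maximalideal p R}. split_at p A B f"
  proof (rule interpolate[OF True])
    show "\<exists>f\<in>Mor C A B. split_at p A B f" if "p \<in> {p. maximalideal p R}" for p
      using loc that split_atD by blast
    show "split_at p A B (c \<oplus>\<^bsub>Hom C A B\<^esub> r \<odot>\<^bsub>Hom C A B\<^esub> m)"
      if "p \<in> {p. maximalideal p R}" "c \<in> Mor C A B" "m \<in> Mor C A B" "r \<in> p" "split_at p A B c" for p c m r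
      by (rule split_at_perturbation[OF _ o that(5,3,4)]) (use that in simp)
  qed auto
  then obtain f where f: "f \<in> Mor C A B" "\<And>p. maximalideal p R \<Longrightarrow> split_at p A B f" by blast
  then obtain l where "l \<in> Mor C B A" "Comp C A B A l f = Ident C A"
    using split_at_all_imp_split[OF o f(2,1)] by blast
  then have "direct_summand C A B" using retract_direct_summand[OF fa o f(1)] by blast
  then show ?thesis using iso_at_ident[OF o(1) one_notin_maximalideal] by (intro bexI[of _ A]) auto
next
  case inf: False
  obtain p0 where p0: "maximalideal p0 R" using exists_maximalideal by blast
  obtain f0 g0 s0 where m0 [simp]: "f0 \<in> Mor C A B" "g0 \<in> Mor C B A" "s0 \<in> carrier R" and s0: "s0 \<notin> p0"
    "Comp C A B A g0 f0 = s0 \<odot>\<^bsub>Hom C A A\<^esub> Ident C A"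
    using loc[OF p0] unfolding split_at_def by blast
  obtain d where d: "d \<in> carrier R - {\<zero>}"
    "\<And>r x. r \<in> carrier R - {\<zero>} \<Longrightarrow> x \<in> Mor C A B \<Longrightarrow> r \<odot>\<^bsub>Hom C A B\<^esub> x = \<zero>\<^bsub>Hom C A B\<^esub> \<Longrightarrow> d \<odot>\<^bsub>Hom C A B\<^esub> x = \<zero>\<^bsub>Hom C A B\<^esub>"
    using module.torsion_annihilator[OF hom_module[OF o] noetherian domain_axioms hom_finite[OF o]] by blast
  have [simp]: "d \<in> carrier R" using d by simp
  \<comment> \<open>One scalar with two duties: \<open>f0\<close> is split at every \<open>p\<close>
    not containing \<open>s\<close>, and \<open>s\<close> annihilates the torsion of the maps
    \<open>A \<rightarrow> B\<close>.\<close>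
  define s where "s = s0 \<otimes> d"
  have s [simp]: "s \<in> carrier R" unfolding s_def by simp
  have s_nz: "s \<noteq> \<zero>" unfolding s_def using d s0 zero_in_maximalideal[OF p0] integral_iff by auto
  define g where "g = d \<odot>\<^bsub>Hom C B A\<^esub> g0"
  have g [simp]: "g \<in> Mor C B A" unfolding g_def by simp
  have gf0: "Comp C A B A g f0 = s \<odot>\<^bsub>Hom C A A\<^esub> Ident C A"
    unfolding g_def s_def by (simp add: smult_simps s0 m_comm)
  define S where "S = {p. maximalideal p R \<and> s \<in> p}"
  have S: "finite S" unfolding S_def using finite_maximalideals_containing[OF s s_nz] .
  then obtain q where q: "maximalideal q R" "q \<notin> S"
    using inf by (metis (mono_tags, lifting) mem_Collect_eq finite_subset subsetI)
  then have sq: "s \<notin> q" unfolding S_def by blast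
  \<comment> \<open>Splitting is needed at the \<open>p\<close> containing \<open>s\<close>;
    invertibility of \<open>g j\<close> at the extra place \<open>q\<close> is what makes it
    invertible over \<open>K\<close>.\<close>
  define \<Phi> where "\<Phi> p j \<longleftrightarrow> (p = q \<longrightarrow> iso_at p A A (Comp C A B A g j)) \<and> (p \<in> S \<longrightarrow> split_at p A B j)" for p j
  have max: "maximalideal p R" if "p \<in> insert q S" for p using that q unfolding S_def by auto
  have "\<exists>j\<in>Mor C A B. \<forall>p\<in>insert q S. \<Phi> p j"
  proof (rule interpolate)
    show "\<exists>j\<in>Mor C A B. \<Phi> p j" if p: "p \<in> insert q S" for p
    proof (cases "p = q")
      case True
      have "iso_at q A A (Comp C A B A g f0)" unfolding gf0
        by (rule iso_at_scalar[of _ _ _ "Ident C A" s]) (use sq in \<open>auto simp: smult_simps\<close>)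
      then show ?thesis unfolding \<Phi>_def using True q by (intro bexI[of _ f0]) auto
    next
      case False
      obtain f where "split_at p A B f" using loc[OF max[OF p]] by blast
      then show ?thesis unfolding \<Phi>_def using False by (intro bexI[of _ f]) (auto dest: split_atD)
    qed
    show "\<Phi> p (c \<oplus>\<^bsub>Hom C A B\<^esub> r \<odot>\<^bsub>Hom C A B\<^esub> m)"
      if p: "p \<in> insert q S" and c: "c \<in> Mor C A B" "m \<in> Mor C A B" and r: "r \<in> p" and \<Phi>: "\<Phi> p c" for p c m r
      unfolding \<Phi>_def
    proof (intro conjI impI)
      have r': "r \<in> carrier R" using maximalideal_Icarr[OF max[OF p] r] .
      assume "p = q"
      then have "iso_at p A A (Comp C A B A g c)" using \<Phi> unfolding \<Phi>_def by blast
      from iso_at_perturbation[OF max[OF p] o(1) o(1) this _ r, of "Comp C A B A g m"]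
      show "iso_at p A A (Comp C A B A g (c \<oplus>\<^bsub>Hom C A B\<^esub> r \<odot>\<^bsub>Hom C A B\<^esub> m))"
        using c r' by (simp add: comp_add_right comp_smult_right)
    next
      assume "p \<in> S"
      then have "split_at p A B c" using \<Phi> unfolding \<Phi>_def by blast
      then show "split_at p A B (c \<oplus>\<^bsub>Hom C A B\<^esub> r \<odot>\<^bsub>Hom C A B\<^esub> m)"
        by (rule split_at_perturbation[OF max[OF p] o _ c(2) r])
    qed
  qed (use S max in auto)
  then obtain j0 where j0 [simp]: "j0 \<in> Mor C A B" and \<Phi>: "\<And>p. p \<in> insert q S \<Longrightarrow> \<Phi> p j0" by blast
  define v where "v = Comp C A B A g j0"
  have v [simp]: "v \<in> Mor C A A" unfolding v_def by simp
  have "iso_at q A A v" using \<Phi>[of q] unfolding \<Phi>_def v_def by blast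
  then obtain v' N where v' [simp]: "v' \<in> Mor C A A" "N \<in> carrier R" and N: "N \<notin> q" and
    vv: "Comp C A A A v' v = N \<odot>\<^bsub>Hom C A A\<^esub> Ident C A" "Comp C A A A v v' = N \<odot>\<^bsub>Hom C A A\<^esub> Ident C A"
    unfolding iso_at_def by blast
  have N_nz: "N \<noteq> \<zero>" using N zero_in_maximalideal[OF q(1)] by blast
  \<comment> \<open>Inverting \<open>v\<close> costs the scalar \<open>N\<close>. A multiple of it
    is separated into a power of \<open>s\<close> and a part congruent to 1 modulo
    \<open>s s\<close>.\<close>
  obtain r u k where r [simp]: "r \<in> carrier R" "u \<in> carrier R" and rN: "r \<otimes> N = s [^] (k::nat) \<otimes> (\<one> \<ominus> (s \<otimes> s) \<otimes> u)"
    using dvd_power_times_unipotent[OF v'(2) N_nz s] by blast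
  define w where "w = s [^] k"
  have w [simp]: "w \<in> carrier R" unfolding w_def by simp
  have rN': "r \<otimes> N = w \<otimes> (\<one> \<ominus> s \<otimes> s \<otimes> u)" using rN w_def by simp
  define z where "z = Comp C A A B j0 v'"
  have z [simp]: "z \<in> Mor C A B" unfolding z_def by simp
  have gz: "Comp C A B A g z = N \<odot>\<^bsub>Hom C A A\<^esub> Ident C A"
    unfolding z_def by (simp add: comp_assoc vv flip: v_def)
  have zv: "Comp C A A B z v = N \<odot>\<^bsub>Hom C A B\<^esub> j0"
    unfolding z_def by (simp add: comp_assoc_left vv comp_smult_right)
  \<comment> \<open>Over \<open>K\<close>, \<open>f0/s\<close> and \<open>z/N\<close> are right
    inverses of \<open>g\<close>. So is \<open>\<phi> = s s u (f0/s) + (1 - s s u)(z/N)\<close>, and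
    \<open>f = w s s \<phi>\<close> and \<open>j = \<phi> v\<close>. The denominators disappear
    because \<open>r N = w (1 - s s u)\<close> and \<open>z v = N j0\<close>; moreover
    \<open>j\<close> is congruent to \<open>j0\<close> modulo \<open>s\<close>.\<close>
  define f where "f = (w \<otimes> s \<otimes> s \<otimes> s \<otimes> u) \<odot>\<^bsub>Hom C A B\<^esub> f0 \<oplus>\<^bsub>Hom C A B\<^esub> (r \<otimes> s \<otimes> s) \<odot>\<^bsub>Hom C A B\<^esub> z"
  define j where "j = (s \<otimes> u) \<odot>\<^bsub>Hom C A B\<^esub> Comp C A A B f0 v \<oplus>\<^bsub>Hom C A B\<^esub> (\<one> \<ominus> s \<otimes> s \<otimes> u) \<odot>\<^bsub>Hom C A B\<^esub> j0"
  have f [simp]: "f \<in> Mor C A B" and j [simp]: "j \<in> Mor C A B" unfolding f_def j_def by simp_all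
  have "w \<otimes> s \<otimes> s \<otimes> s \<otimes> u \<otimes> s \<oplus> r \<otimes> s \<otimes> s \<otimes> N = w \<otimes> s \<otimes> s \<otimes> s \<otimes> u \<otimes> s \<oplus> s \<otimes> s \<otimes> (r \<otimes> N)"
    using r w s v' by algebra
  also have "\<dots> = w \<otimes> s \<otimes> s" unfolding rN' using r w s by algebra
  finally have c1: "w \<otimes> s \<otimes> s \<otimes> s \<otimes> u \<otimes> s \<oplus> r \<otimes> s \<otimes> s \<otimes> N = w \<otimes> s \<otimes> s" .
  have "r \<otimes> s \<otimes> s \<otimes> N = s \<otimes> s \<otimes> (r \<otimes> N)" using r s v' by algebra
  also have "\<dots> = w \<otimes> s \<otimes> s \<otimes> (\<one> \<ominus> s \<otimes> s \<otimes> u)" unfolding rN' using r w s by algebra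
  finally have c2: "r \<otimes> s \<otimes> s \<otimes> N = w \<otimes> s \<otimes> s \<otimes> (\<one> \<ominus> s \<otimes> s \<otimes> u)" .
  have gf: "Comp C A B A g f = (w \<otimes> s \<otimes> s) \<odot>\<^bsub>Hom C A A\<^esub> Ident C A"
  proof -
    have "Comp C A B A g f = (w \<otimes> s \<otimes> s \<otimes> s \<otimes> u \<otimes> s \<oplus> r \<otimes> s \<otimes> s \<otimes> N) \<odot>\<^bsub>Hom C A A\<^esub> Ident C A"
      unfolding f_def by (simp add: comp_add_right comp_smult_right gf0 gz hom_smult_assoc hom_smult_l_distr)
    then show ?thesis unfolding c1 .
  qed
  have fv: "Comp C A A B f v = (w \<otimes> s \<otimes> s) \<odot>\<^bsub>Hom C A B\<^esub> j"
  proof -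
    have "Comp C A A B f v = (w \<otimes> s \<otimes> s \<otimes> s \<otimes> u) \<odot>\<^bsub>Hom C A B\<^esub> Comp C A A B f0 v \<oplus>\<^bsub>Hom C A B\<^esub> (r \<otimes> s \<otimes> s \<otimes> N) \<odot>\<^bsub>Hom C A B\<^esub> j0"
      unfolding f_def by (simp add: comp_add_left comp_smult_left zv hom_smult_assoc)
    then show ?thesis unfolding c2 j_def by (simp add: hom_smult_r_distr hom_smult_assoc m_assoc)
  qed
  have "s \<otimes> u \<otimes> s \<oplus> (\<one> \<ominus> s \<otimes> s \<otimes> u) = \<one>" using r s by algebra
  then have gj: "Comp C A B A g j = v"
    unfolding j_def
    by (simp add: comp_add_right comp_smult_right comp_assoc gf0 comp_smult_left hom_smult_assoc
        flip: v_def hom_smult_l_distr)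
  have j_split: "split_at p A B j" if p: "maximalideal p R" "s \<in> p" for p
  proof -
    have "split_at p A B j0" using \<Phi>[of p] p unfolding \<Phi>_def S_def by blast
    from split_at_perturbation[OF p(1) o this _ p(2),
        of "u \<odot>\<^bsub>Hom C A B\<^esub> Comp C A A B f0 v \<oplus>\<^bsub>Hom C A B\<^esub> \<ominus>\<^bsub>Hom C A B\<^esub> ((s \<otimes> u) \<odot>\<^bsub>Hom C A B\<^esub> j0)"]
    show ?thesis unfolding j_def
      by (simp add: a_minus_def hom_smult_r_distr hom_smult_l_distr hom_smult_l_minus hom_smult_r_minus
          hom_smult_assoc hom_a_ac m_assoc)
  qed
  obtain l a where l [simp]: "l \<in> Mor C B A" "a \<in> carrier R"
    and lj: "Comp C A B A l j = (\<one> \<oplus> a \<otimes> s) \<odot>\<^bsub>Hom C A A\<^esub> Ident C A"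
    using semilocal_split[OF o j s j_split] by blast
  define t where "t = \<one> \<oplus> a \<otimes> s"
  have t [simp]: "t \<in> carrier R" unfolding t_def by simp
  have jlf: "Comp C A A B j (Comp C A B A l f) = t \<odot>\<^bsub>Hom C A B\<^esub> f"
  proof -
    \<comment> \<open>Cancelling \<open>v\<close>, which is invertible only over \<open>K\<close>,
      gives the identity up to torsion. It is shown in this weak form for \<open>f1\<close>;
      multiplying by \<open>s\<close>, which kills the torsion, gives it exactly for
      \<open>f = s f1\<close>.\<close>
    define f1 where "f1 = (w \<otimes> s \<otimes> s \<otimes> u) \<odot>\<^bsub>Hom C A B\<^esub> f0 \<oplus>\<^bsub>Hom C A B\<^esub> (r \<otimes> s) \<odot>\<^bsub>Hom C A B\<^esub> z"
    have f1 [simp]: "f1 \<in> Mor C A B" unfolding f1_def by simp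
    have ff1: "f = s \<odot>\<^bsub>Hom C A B\<^esub> f1" unfolding f_def f1_def by (simp add: hom_smult_r_distr hom_smult_assoc m_ac)
    define y where "y = Comp C A A B j (Comp C A B A l f1) \<oplus>\<^bsub>Hom C A B\<^esub> \<ominus>\<^bsub>Hom C A B\<^esub> (t \<odot>\<^bsub>Hom C A B\<^esub> f1)"
    have y [simp]: "y \<in> Mor C A B" unfolding y_def by simp
    have "s \<odot>\<^bsub>Hom C A B\<^esub> Comp C A A B y v = \<zero>\<^bsub>Hom C A B\<^esub>"
    proof -
      have "s \<odot>\<^bsub>Hom C A B\<^esub> Comp C A A B y v = Comp C A A B (Comp C A A B j (Comp C A B A l f) \<oplus>\<^bsub>Hom C A B\<^esub> \<ominus>\<^bsub>Hom C A B\<^esub> (t \<odot>\<^bsub>Hom C A B\<^esub> f)) v"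
        unfolding y_def ff1
        by (simp add: comp_add_left comp_smult_left comp_smult_right hom_smult_r_distr hom_smult_r_minus hom_smult_assoc m_comm)
      also have "\<dots> = \<zero>\<^bsub>Hom C A B\<^esub>"
        by (simp add: comp_add_left comp_smult_left comp_smult_right comp_assoc_left fv lj hom_smult_assoc m_comm flip: t_def)
      finally show ?thesis .
    qed
    then have "Comp C A A B (s \<odot>\<^bsub>Hom C A B\<^esub> Comp C A A B y v) v' = \<zero>\<^bsub>Hom C A B\<^esub>" by simp
    then have "(s \<otimes> N) \<odot>\<^bsub>Hom C A B\<^esub> y = \<zero>\<^bsub>Hom C A B\<^esub>"
      by (simp add: comp_smult_left comp_assoc_left vv comp_smult_right hom_smult_assoc)
    then have "d \<odot>\<^bsub>Hom C A B\<^esub> y = \<zero>\<^bsub>Hom C A B\<^esub>"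
      using d(2)[of "s \<otimes> N" y] s_nz N_nz integral_iff by auto
    then have "s \<odot>\<^bsub>Hom C A B\<^esub> y = \<zero>\<^bsub>Hom C A B\<^esub>"
      unfolding s_def using hom_smult_assoc[of A B s0 d y] by simp
    then have "Comp C A A B j (Comp C A B A l f) \<oplus>\<^bsub>Hom C A B\<^esub> \<ominus>\<^bsub>Hom C A B\<^esub> (t \<odot>\<^bsub>Hom C A B\<^esub> f) = \<zero>\<^bsub>Hom C A B\<^esub>"
      unfolding y_def ff1
      by (simp add: comp_smult_right hom_smult_r_distr hom_smult_r_minus hom_smult_assoc m_comm)
    from hom_add_eq_zeroD[OF _ _ _ _ this]
    have "\<ominus>\<^bsub>Hom C A B\<^esub> (t \<odot>\<^bsub>Hom C A B\<^esub> f) = \<ominus>\<^bsub>Hom C A B\<^esub> Comp C A A B j (Comp C A B A l f)" by simp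
    then show ?thesis by (metis hom_minus_minus comp_closed f hom_smult_closed j l(1) o t)
  qed
  \<comment> \<open>The exponent \<open>k + 2\<close> is that of \<open>w s s\<close>, the scalar of
    \<open>g f\<close>.\<close>
  obtain a' b' where ab: "a' \<in> carrier R" "b' \<in> carrier R" "a' \<otimes> s [^] Suc (Suc k) \<oplus> b' \<otimes> t = \<one>"
    using comaximal_power[OF l(2) s t t_def, of "Suc (Suc k)"] by blast
  have "s [^] Suc (Suc k) = w \<otimes> s \<otimes> s" unfolding w_def by simp
  with ab have st: "a' \<otimes> (w \<otimes> s \<otimes> s) \<oplus> b' \<otimes> t = \<one>" by simp
  show ?thesis
    by (rule glue_summand[OF fa o f j g l(1) v _ t ab(1,2) gf lj[folded t_def] fv gj jlf st]) simp
qed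

end

section \<open>The category add C\<close>

lemma (in abelian_monoid) finsum_swap:
  assumes "finite I" "finite K" "\<And>i k. i \<in> I \<Longrightarrow> k \<in> K \<Longrightarrow> h i k \<in> carrier G"
  shows "(\<Oplus>i\<in>I. \<Oplus>k\<in>K. h i k) = (\<Oplus>k\<in>K. \<Oplus>i\<in>I. h i k)"
  using assms(1,3)
proof (induction I)
  case empty
  then show ?case by (simp add: finsum_zero)
next
  case (insert i I)
  have "(\<Oplus>k\<in>K. \<Oplus>i\<in>insert i I. h i k) = (\<Oplus>k\<in>K. h i k \<oplus> (\<Oplus>i\<in>I. h i k))"
    using insert by (intro finsum_cong' finsum_insert) auto
  also have "\<dots> = (\<Oplus>k\<in>K. h i k) \<oplus> (\<Oplus>k\<in>K. \<Oplus>i\<in>I. h i k)"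
    using insert by (intro finsum_addf) auto
  finally show ?case using insert by (subst finsum_insert) auto
qed

context preadditive_category begin

lemma hom_abelian_monoid: "A \<in> Obj C \<Longrightarrow> B \<in> Obj C \<Longrightarrow> abelian_monoid (Hom C A B)"
  using hom_abelian_group by (simp add: abelian_group.axioms)

lemma comp_finsum_right:
  assumes "A \<in> Obj C" "B \<in> Obj C" "D \<in> Obj C" "finite K" "\<And>k. k \<in> K \<Longrightarrow> f k \<in> Mor C A B" "g \<in> Mor C B D"
  shows "Comp C A B D g (\<Oplus>\<^bsub>Hom C A B\<^esub>k\<in>K. f k) = (\<Oplus>\<^bsub>Hom C A D\<^esub>k\<in>K. Comp C A B D g (f k))"
  using assms(4,5)
proof (induction K)
  case (insert k K)
  interpret M: abelian_monoid "Hom C A B" using assms hom_abelian_monoid by blast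
  interpret N: abelian_monoid "Hom C A D" using assms hom_abelian_monoid by blast
  have "(\<Oplus>\<^bsub>Hom C A B\<^esub>k\<in>insert k K. f k) = f k \<oplus>\<^bsub>Hom C A B\<^esub> (\<Oplus>\<^bsub>Hom C A B\<^esub>k\<in>K. f k)"
    using insert by (intro M.finsum_insert) auto
  moreover have "(\<Oplus>\<^bsub>Hom C A B\<^esub>k\<in>K. f k) \<in> Mor C A B"
    using insert by (intro M.finsum_closed) auto
  moreover have "(\<Oplus>\<^bsub>Hom C A D\<^esub>k\<in>insert k K. Comp C A B D g (f k)) =
      Comp C A B D g (f k) \<oplus>\<^bsub>Hom C A D\<^esub> (\<Oplus>\<^bsub>Hom C A D\<^esub>k\<in>K. Comp C A B D g (f k))"
    using insert assms by (intro N.finsum_insert) auto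
  ultimately show ?case using insert assms by (simp add: comp_add_right)
qed (use assms in \<open>simp add: abelian_monoid.finsum_empty hom_abelian_monoid\<close>)

lemma comp_finsum_left:
  assumes "A \<in> Obj C" "B \<in> Obj C" "D \<in> Obj C" "finite K" "\<And>k. k \<in> K \<Longrightarrow> g k \<in> Mor C B D" "f \<in> Mor C A B"
  shows "Comp C A B D (\<Oplus>\<^bsub>Hom C B D\<^esub>k\<in>K. g k) f = (\<Oplus>\<^bsub>Hom C A D\<^esub>k\<in>K. Comp C A B D (g k) f)"
  using assms(4,5)
proof (induction K)
  case (insert k K)
  interpret M: abelian_monoid "Hom C B D" using assms hom_abelian_monoid by blast
  interpret N: abelian_monoid "Hom C A D" using assms hom_abelian_monoid by blast
  have "(\<Oplus>\<^bsub>Hom C B D\<^esub>k\<in>insert k K. g k) = g k \<oplus>\<^bsub>Hom C B D\<^esub> (\<Oplus>\<^bsub>Hom C B D\<^esub>k\<in>K. g k)"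
    using insert by (intro M.finsum_insert) auto
  moreover have "(\<Oplus>\<^bsub>Hom C B D\<^esub>k\<in>K. g k) \<in> Mor C B D"
    using insert by (intro M.finsum_closed) auto
  moreover have "(\<Oplus>\<^bsub>Hom C A D\<^esub>k\<in>insert k K. Comp C A B D (g k) f) =
      Comp C A B D (g k) f \<oplus>\<^bsub>Hom C A D\<^esub> (\<Oplus>\<^bsub>Hom C A D\<^esub>k\<in>K. Comp C A B D (g k) f)"
    using insert assms by (intro N.finsum_insert) auto
  ultimately show ?case using insert assms by (simp add: comp_add_left)
qed (use assms in \<open>simp add: abelian_monoid.finsum_empty hom_abelian_monoid\<close>)

lemma matrix_ext:
  assumes "M \<in> Mor (matrix_category C) As Bs" "N \<in> Mor (matrix_category C) As Bs"
    and "\<And>i j. i < length Bs \<Longrightarrow> j < length As \<Longrightarrow> M (i, j) = N (i, j)"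
  shows "M = N"
  using assms(1,2) unfolding matrix_category_def
  by (intro PiE_ext) (auto simp: matrix_index_def assms(3))

lemma matrix_Obj: "As \<in> Obj (matrix_category C) \<longleftrightarrow> set As \<subseteq> Obj C"
  by (simp add: matrix_category_def)

lemma matrix_entry:
  "M \<in> Mor (matrix_category C) As Bs \<Longrightarrow> i < length Bs \<Longrightarrow> j < length As \<Longrightarrow> M (i, j) \<in> Mor C (As ! j) (Bs ! i)"
  unfolding matrix_category_def by (auto simp: matrix_index_def PiE_iff)

lemma matrix_MorI:
  "(\<And>i j. i < length Bs \<Longrightarrow> j < length As \<Longrightarrow> F i j \<in> Mor C (As ! j) (Bs ! i)) \<Longrightarrow>
    (\<lambda>(i, j)\<in>matrix_index As Bs. F i j) \<in> Mor (matrix_category C) As Bs"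
  unfolding matrix_category_def by (auto simp: matrix_index_def)

lemma matrix_index_mem [simp]: "(i, j) \<in> matrix_index As Bs \<longleftrightarrow> i < length Bs \<and> j < length As"
  by (simp add: matrix_index_def)

lemma matrix_add:
  "M \<oplus>\<^bsub>Hom (matrix_category C) As Bs\<^esub> N = (\<lambda>(i, j)\<in>matrix_index As Bs. M (i, j) \<oplus>\<^bsub>Hom C (As ! j) (Bs ! i)\<^esub> N (i, j))"
  by (simp add: matrix_category_def)

lemma matrix_zero:
  "\<zero>\<^bsub>Hom (matrix_category C) As Bs\<^esub> = (\<lambda>(i, j)\<in>matrix_index As Bs. \<zero>\<^bsub>Hom C (As ! j) (Bs ! i)\<^esub>)"
  by (simp add: matrix_category_def)

lemma matrix_Comp:
  "Comp (matrix_category C) As Bs Ds N M = (\<lambda>(i, j)\<in>matrix_index As Ds.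
     \<Oplus>\<^bsub>Hom C (As ! j) (Ds ! i)\<^esub>k\<in>{..<length Bs}. Comp C (As ! j) (Bs ! k) (Ds ! i) (N (i, k)) (M (k, j)))"
  by (simp add: matrix_category_def)

lemma matrix_Ident:
  "Ident (matrix_category C) As = (\<lambda>(i, j)\<in>matrix_index As As.
     if i = j then Ident C (As ! i) else \<zero>\<^bsub>Hom C (As ! j) (As ! i)\<^esub>)"
  by (simp add: matrix_category_def)

lemma matrix_add_entry [simp]:
  "i < length Bs \<Longrightarrow> j < length As \<Longrightarrow>
    (M \<oplus>\<^bsub>Hom (matrix_category C) As Bs\<^esub> N) (i, j) = M (i, j) \<oplus>\<^bsub>Hom C (As ! j) (Bs ! i)\<^esub> N (i, j)"
  by (simp add: matrix_add)

lemma matrix_zero_entry [simp]: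
  "i < length Bs \<Longrightarrow> j < length As \<Longrightarrow>
    \<zero>\<^bsub>Hom (matrix_category C) As Bs\<^esub> (i, j) = \<zero>\<^bsub>Hom C (As ! j) (Bs ! i)\<^esub>"
  by (simp add: matrix_zero)

lemma nth_Obj: "set As \<subseteq> Obj C \<Longrightarrow> i < length As \<Longrightarrow> As ! i \<in> Obj C"
  by auto

lemma hom_finsum_closed:
  "A \<in> Obj C \<Longrightarrow> B \<in> Obj C \<Longrightarrow> (\<And>k. k \<in> K \<Longrightarrow> f k \<in> Mor C A B) \<Longrightarrow> (\<Oplus>\<^bsub>Hom C A B\<^esub>k\<in>K. f k) \<in> Mor C A B"
  by (intro abelian_monoid.finsum_closed hom_abelian_monoid) auto

lemma hom_finsum_cong:
  "A \<in> Obj C \<Longrightarrow> B \<in> Obj C \<Longrightarrow> (\<And>k. k \<in> K \<Longrightarrow> g k \<in> Mor C A B) \<Longrightarrow> (\<And>k. k \<in> K \<Longrightarrow> f k = g k) \<Longrightarrow>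
    (\<Oplus>\<^bsub>Hom C A B\<^esub>k\<in>K. f k) = (\<Oplus>\<^bsub>Hom C A B\<^esub>k\<in>K. g k)"
  by (intro abelian_monoid.finsum_cong' hom_abelian_monoid) auto

lemma matrix_Comp_closed:
  assumes "set As \<subseteq> Obj C" "set Bs \<subseteq> Obj C" "set Ds \<subseteq> Obj C"
    "M \<in> Mor (matrix_category C) As Bs" "N \<in> Mor (matrix_category C) Bs Ds"
  shows "Comp (matrix_category C) As Bs Ds N M \<in> Mor (matrix_category C) As Ds"
  unfolding matrix_Comp
  by (rule matrix_MorI, rule hom_finsum_closed) (auto intro!: comp_closed matrix_entry[OF assms(4)] matrix_entry[OF assms(5)] nth_Obj assms(1-3))

lemma matrix_add_closed:
  assumes "set As \<subseteq> Obj C" "set Bs \<subseteq> Obj C" "M \<in> Mor (matrix_category C) As Bs" "N \<in> Mor (matrix_category C) As Bs"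
  shows "M \<oplus>\<^bsub>Hom (matrix_category C) As Bs\<^esub> N \<in> Mor (matrix_category C) As Bs"
  unfolding matrix_add
  by (rule matrix_MorI) (auto intro!: hom_add_closed nth_Obj[OF assms(1)] nth_Obj[OF assms(2)] matrix_entry[OF assms(3)] matrix_entry[OF assms(4)])

text \<open>All axioms are checked entrywise. Associativity exchanges two finite sums; the unit laws
  isolate one term of a sum.\<close>

lemma matrix_category_preadditive: "preadditive_category (matrix_category C)"
proof (rule preadditive_category.intro)
  let ?C = "matrix_category C"
  show "abelian_group (Hom ?C As Bs)" if "As \<in> Obj ?C" "Bs \<in> Obj ?C" for As Bs
  proof (rule abelian_groupI)
    have o: "set As \<subseteq> Obj C" "set Bs \<subseteq> Obj C" using that by (auto simp: matrix_Obj)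
    note [simp] = nth_Obj[OF o(1)] nth_Obj[OF o(2)]
    show cl: "M \<oplus>\<^bsub>Hom ?C As Bs\<^esub> N \<in> Mor ?C As Bs" if "M \<in> Mor ?C As Bs" "N \<in> Mor ?C As Bs" for M N
      using that o by (intro matrix_add_closed)
    show z: "\<zero>\<^bsub>Hom ?C As Bs\<^esub> \<in> Mor ?C As Bs"
      unfolding matrix_zero by (rule matrix_MorI) auto
    show "M \<oplus>\<^bsub>Hom ?C As Bs\<^esub> N \<oplus>\<^bsub>Hom ?C As Bs\<^esub> L = M \<oplus>\<^bsub>Hom ?C As Bs\<^esub> (N \<oplus>\<^bsub>Hom ?C As Bs\<^esub> L)"
      if "M \<in> Mor ?C As Bs" "N \<in> Mor ?C As Bs" "L \<in> Mor ?C As Bs" for M N L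
      by (rule matrix_ext[of _ As Bs]) (use that matrix_entry in \<open>auto simp: hom_a_assoc intro!: cl\<close>)
    show "M \<oplus>\<^bsub>Hom ?C As Bs\<^esub> N = N \<oplus>\<^bsub>Hom ?C As Bs\<^esub> M"
      if "M \<in> Mor ?C As Bs" "N \<in> Mor ?C As Bs" for M N
      by (rule matrix_ext[of _ As Bs]) (use that matrix_entry in \<open>auto intro: hom_a_comm intro!: cl\<close>)
    show "\<zero>\<^bsub>Hom ?C As Bs\<^esub> \<oplus>\<^bsub>Hom ?C As Bs\<^esub> M = M" if "M \<in> Mor ?C As Bs" for M
      by (rule matrix_ext[of _ As Bs]) (use that z matrix_entry in \<open>auto intro!: cl\<close>)
    show "\<exists>N\<in>Mor ?C As Bs. N \<oplus>\<^bsub>Hom ?C As Bs\<^esub> M = \<zero>\<^bsub>Hom ?C As Bs\<^esub>" if M: "M \<in> Mor ?C As Bs" for M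
    proof -
      let ?N = "\<lambda>(i, j)\<in>matrix_index As Bs. \<ominus>\<^bsub>Hom C (As ! j) (Bs ! i)\<^esub> M (i, j)"
      have N: "?N \<in> Mor ?C As Bs" by (rule matrix_MorI) (use M matrix_entry in auto)
      have "?N \<oplus>\<^bsub>Hom ?C As Bs\<^esub> M = \<zero>\<^bsub>Hom ?C As Bs\<^esub>"
        by (rule matrix_ext[of _ As Bs]) (use cl[OF N M] z M matrix_entry in auto)
      then show ?thesis using N by blast
    qed
  qed
  show "Comp ?C As Bs Ds N M \<in> Mor ?C As Ds"
    if "As \<in> Obj ?C" "Bs \<in> Obj ?C" "Ds \<in> Obj ?C" "M \<in> Mor ?C As Bs" "N \<in> Mor ?C Bs Ds" for As Bs Ds M N
    using that matrix_Comp_closed by (simp add: matrix_Obj)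
  show "Comp ?C As Ds Es L (Comp ?C As Bs Ds N M) = Comp ?C As Bs Es (Comp ?C Bs Ds Es L N) M"
    if "As \<in> Obj ?C" "Bs \<in> Obj ?C" "Ds \<in> Obj ?C" "Es \<in> Obj ?C" and
      m: "M \<in> Mor ?C As Bs" "N \<in> Mor ?C Bs Ds" "L \<in> Mor ?C Ds Es" for As Bs Ds Es M N L
  proof (rule matrix_ext)
    have o: "set As \<subseteq> Obj C" "set Bs \<subseteq> Obj C" "set Ds \<subseteq> Obj C" "set Es \<subseteq> Obj C" using that by (auto simp: matrix_Obj)
    show "Comp ?C As Ds Es L (Comp ?C As Bs Ds N M) \<in> Mor ?C As Es" "Comp ?C As Bs Es (Comp ?C Bs Ds Es L N) M \<in> Mor ?C As Es"
      using o m matrix_Comp_closed by auto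
    fix i j assume ij: "i < length Es" "j < length As"
    note [simp] = nth_Obj[OF o(1)] nth_Obj[OF o(2)] nth_Obj[OF o(3)] nth_Obj[OF o(4)] ij
      matrix_entry[OF m(1)] matrix_entry[OF m(2)] matrix_entry[OF m(3)]
    let ?h = "\<lambda>k l. Comp C (As ! j) (Ds ! k) (Es ! i) (L (i, k)) (Comp C (As ! j) (Bs ! l) (Ds ! k) (N (k, l)) (M (l, j)))"
    have "Comp ?C As Ds Es L (Comp ?C As Bs Ds N M) (i, j) =
      (\<Oplus>\<^bsub>Hom C (As ! j) (Es ! i)\<^esub>k\<in>{..<length Ds}. \<Oplus>\<^bsub>Hom C (As ! j) (Es ! i)\<^esub>l\<in>{..<length Bs}. ?h k l)"
      unfolding matrix_Comp
      by (simp, intro hom_finsum_cong) (auto intro!: comp_finsum_right hom_finsum_closed)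
    also have "\<dots> = (\<Oplus>\<^bsub>Hom C (As ! j) (Es ! i)\<^esub>l\<in>{..<length Bs}. \<Oplus>\<^bsub>Hom C (As ! j) (Es ! i)\<^esub>k\<in>{..<length Ds}. ?h k l)"
      by (rule abelian_monoid.finsum_swap[OF hom_abelian_monoid]) auto
    also have "\<dots> = (\<Oplus>\<^bsub>Hom C (As ! j) (Es ! i)\<^esub>l\<in>{..<length Bs}. Comp C (As ! j) (Bs ! l) (Es ! i)
        (\<Oplus>\<^bsub>Hom C (Bs ! l) (Es ! i)\<^esub>k\<in>{..<length Ds}. Comp C (Bs ! l) (Ds ! k) (Es ! i) (L (i, k)) (N (k, l))) (M (l, j)))"
    proof (rule hom_finsum_cong)
      fix l assume "l \<in> {..<length Bs}"
      then have l [simp]: "l < length Bs" by simp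
      show "Comp C (As ! j) (Bs ! l) (Es ! i)
          (\<Oplus>\<^bsub>Hom C (Bs ! l) (Es ! i)\<^esub>k\<in>{..<length Ds}. Comp C (Bs ! l) (Ds ! k) (Es ! i) (L (i, k)) (N (k, l))) (M (l, j)) \<in> Mor C (As ! j) (Es ! i)"
        by (auto intro!: comp_closed hom_finsum_closed)
      have "Comp C (As ! j) (Bs ! l) (Es ! i) (\<Oplus>\<^bsub>Hom C (Bs ! l) (Es ! i)\<^esub>k\<in>{..<length Ds}. Comp C (Bs ! l) (Ds ! k) (Es ! i) (L (i, k)) (N (k, l))) (M (l, j)) =
          (\<Oplus>\<^bsub>Hom C (As ! j) (Es ! i)\<^esub>k\<in>{..<length Ds}. Comp C (As ! j) (Bs ! l) (Es ! i) (Comp C (Bs ! l) (Ds ! k) (Es ! i) (L (i, k)) (N (k, l))) (M (l, j)))"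
        by (rule comp_finsum_left) auto
      also have "\<dots> = (\<Oplus>\<^bsub>Hom C (As ! j) (Es ! i)\<^esub>k\<in>{..<length Ds}. ?h k l)"
        by (intro hom_finsum_cong) (auto simp: comp_assoc_left)
      finally show "(\<Oplus>\<^bsub>Hom C (As ! j) (Es ! i)\<^esub>k\<in>{..<length Ds}. ?h k l) = Comp C (As ! j) (Bs ! l) (Es ! i)
          (\<Oplus>\<^bsub>Hom C (Bs ! l) (Es ! i)\<^esub>k\<in>{..<length Ds}. Comp C (Bs ! l) (Ds ! k) (Es ! i) (L (i, k)) (N (k, l))) (M (l, j))" ..
    qed auto
    also have "\<dots> = Comp ?C As Bs Es (Comp ?C Bs Ds Es L N) M (i, j)"
      unfolding matrix_Comp by (simp, intro hom_finsum_cong) (auto intro!: comp_closed hom_finsum_closed)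
    finally show "Comp ?C As Ds Es L (Comp ?C As Bs Ds N M) (i, j) = Comp ?C As Bs Es (Comp ?C Bs Ds Es L N) M (i, j)" .
  qed
  show idc: "Ident ?C As \<in> Mor ?C As As" if "As \<in> Obj ?C" for As
    unfolding matrix_Ident by (rule matrix_MorI) (use that nth_Obj[of As] in \<open>auto simp: matrix_Obj\<close>)
  show "Comp ?C As Bs Bs (Ident ?C Bs) M = M"
    if "As \<in> Obj ?C" "Bs \<in> Obj ?C" and m: "M \<in> Mor ?C As Bs" for As Bs M
  proof (rule matrix_ext)
    have o: "set As \<subseteq> Obj C" "set Bs \<subseteq> Obj C" using that by (auto simp: matrix_Obj)
    show "Comp ?C As Bs Bs (Ident ?C Bs) M \<in> Mor ?C As Bs" "M \<in> Mor ?C As Bs"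
      using o m matrix_Comp_closed idc that by auto
    fix i j assume ij: "i < length Bs" "j < length As"
    note [simp] = nth_Obj[OF o(1)] nth_Obj[OF o(2)] ij matrix_entry[OF m(1)]
    have "Comp ?C As Bs Bs (Ident ?C Bs) M (i, j) =
        (\<Oplus>\<^bsub>Hom C (As ! j) (Bs ! i)\<^esub>k\<in>{..<length Bs}. if i = k then M (k, j) else \<zero>\<^bsub>Hom C (As ! j) (Bs ! i)\<^esub>)"
      unfolding matrix_Comp matrix_Ident by (simp, intro hom_finsum_cong) auto
    \<comment> \<open>\<open>M (k, j)\<close> ends in \<open>Bs ! k\<close>, so in general only
      \<open>k = i\<close> puts it into the Hom group over which the sum runs. The inner conditional
      gives an element of that group for every \<open>k\<close>, as the rule for a single term
      requires.\<close>
    also have "\<dots> = (\<Oplus>\<^bsub>Hom C (As ! j) (Bs ! i)\<^esub>k\<in>{..<length Bs}. if i = k then (if k = i then M (k, j) else \<zero>\<^bsub>Hom C (As ! j) (Bs ! i)\<^esub>) else \<zero>\<^bsub>Hom C (As ! j) (Bs ! i)\<^esub>)"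
      by (intro hom_finsum_cong) auto
    also have "\<dots> = M (i, j)"
      by (subst abelian_monoid.finsum_singleton[OF hom_abelian_monoid]) auto
    finally show "Comp ?C As Bs Bs (Ident ?C Bs) M (i, j) = M (i, j)" .
  qed
  show "Comp ?C As As Bs M (Ident ?C As) = M"
    if "As \<in> Obj ?C" "Bs \<in> Obj ?C" and m: "M \<in> Mor ?C As Bs" for As Bs M
  proof (rule matrix_ext)
    have o: "set As \<subseteq> Obj C" "set Bs \<subseteq> Obj C" using that by (auto simp: matrix_Obj)
    show "Comp ?C As As Bs M (Ident ?C As) \<in> Mor ?C As Bs" "M \<in> Mor ?C As Bs"
      using o m matrix_Comp_closed idc that by auto
    fix i j assume ij: "i < length Bs" "j < length As"
    note [simp] = nth_Obj[OF o(1)] nth_Obj[OF o(2)] ij matrix_entry[OF m(1)]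
    have "Comp ?C As As Bs M (Ident ?C As) (i, j) =
        (\<Oplus>\<^bsub>Hom C (As ! j) (Bs ! i)\<^esub>k\<in>{..<length As}. if j = k then (if k = j then M (i, k) else \<zero>\<^bsub>Hom C (As ! j) (Bs ! i)\<^esub>) else \<zero>\<^bsub>Hom C (As ! j) (Bs ! i)\<^esub>)"
      unfolding matrix_Comp matrix_Ident by (simp, intro hom_finsum_cong) auto
    also have "\<dots> = M (i, j)"
      by (subst abelian_monoid.finsum_singleton[OF hom_abelian_monoid]) auto
    finally show "Comp ?C As As Bs M (Ident ?C As) (i, j) = M (i, j)" .
  qed
  show "Comp ?C As Bs Ds (N \<oplus>\<^bsub>Hom ?C Bs Ds\<^esub> N') M = Comp ?C As Bs Ds N M \<oplus>\<^bsub>Hom ?C As Ds\<^esub> Comp ?C As Bs Ds N' M"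
    if "As \<in> Obj ?C" "Bs \<in> Obj ?C" "Ds \<in> Obj ?C" and m: "M \<in> Mor ?C As Bs" "N \<in> Mor ?C Bs Ds" "N' \<in> Mor ?C Bs Ds"
    for As Bs Ds M N N'
  proof (rule matrix_ext)
    have o: "set As \<subseteq> Obj C" "set Bs \<subseteq> Obj C" "set Ds \<subseteq> Obj C" using that by (auto simp: matrix_Obj)
    note [simp] = nth_Obj[OF o(1)] nth_Obj[OF o(2)] nth_Obj[OF o(3)]
      matrix_entry[OF m(1)] matrix_entry[OF m(2)] matrix_entry[OF m(3)]
    have s: "N \<oplus>\<^bsub>Hom ?C Bs Ds\<^esub> N' \<in> Mor ?C Bs Ds"
      by (intro matrix_add_closed o m)
    show "Comp ?C As Bs Ds (N \<oplus>\<^bsub>Hom ?C Bs Ds\<^esub> N') M \<in> Mor ?C As Ds" using o m s matrix_Comp_closed by auto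
    show "Comp ?C As Bs Ds N M \<oplus>\<^bsub>Hom ?C As Ds\<^esub> Comp ?C As Bs Ds N' M \<in> Mor ?C As Ds"
      by (intro matrix_add_closed matrix_Comp_closed o m)
    fix i j assume [simp]: "i < length Ds" "j < length As"
    have "Comp ?C As Bs Ds (N \<oplus>\<^bsub>Hom ?C Bs Ds\<^esub> N') M (i, j) =
      (\<Oplus>\<^bsub>Hom C (As ! j) (Ds ! i)\<^esub>k\<in>{..<length Bs}. Comp C (As ! j) (Bs ! k) (Ds ! i) (N (i, k)) (M (k, j)) \<oplus>\<^bsub>Hom C (As ! j) (Ds ! i)\<^esub>
        Comp C (As ! j) (Bs ! k) (Ds ! i) (N' (i, k)) (M (k, j)))"
      unfolding matrix_Comp matrix_add by (simp, intro hom_finsum_cong) (auto simp: comp_add_left)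
    also have "\<dots> = (Comp ?C As Bs Ds N M \<oplus>\<^bsub>Hom ?C As Ds\<^esub> Comp ?C As Bs Ds N' M) (i, j)"
      unfolding matrix_Comp matrix_add
      by (simp, intro abelian_monoid.finsum_addf hom_abelian_monoid) auto
    finally show "Comp ?C As Bs Ds (N \<oplus>\<^bsub>Hom ?C Bs Ds\<^esub> N') M (i, j) = (Comp ?C As Bs Ds N M \<oplus>\<^bsub>Hom ?C As Ds\<^esub> Comp ?C As Bs Ds N' M) (i, j)" .
  qed
  show "Comp ?C As Bs Ds N (M \<oplus>\<^bsub>Hom ?C As Bs\<^esub> M') = Comp ?C As Bs Ds N M \<oplus>\<^bsub>Hom ?C As Ds\<^esub> Comp ?C As Bs Ds N M'"
    if "As \<in> Obj ?C" "Bs \<in> Obj ?C" "Ds \<in> Obj ?C" and m: "M \<in> Mor ?C As Bs" "M' \<in> Mor ?C As Bs" "N \<in> Mor ?C Bs Ds"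
    for As Bs Ds M M' N
  proof (rule matrix_ext)
    have o: "set As \<subseteq> Obj C" "set Bs \<subseteq> Obj C" "set Ds \<subseteq> Obj C" using that by (auto simp: matrix_Obj)
    note [simp] = nth_Obj[OF o(1)] nth_Obj[OF o(2)] nth_Obj[OF o(3)]
      matrix_entry[OF m(1)] matrix_entry[OF m(2)] matrix_entry[OF m(3)]
    have s: "M \<oplus>\<^bsub>Hom ?C As Bs\<^esub> M' \<in> Mor ?C As Bs"
      by (intro matrix_add_closed o m)
    show "Comp ?C As Bs Ds N (M \<oplus>\<^bsub>Hom ?C As Bs\<^esub> M') \<in> Mor ?C As Ds" using o m s matrix_Comp_closed by auto
    show "Comp ?C As Bs Ds N M \<oplus>\<^bsub>Hom ?C As Ds\<^esub> Comp ?C As Bs Ds N M' \<in> Mor ?C As Ds"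
      by (intro matrix_add_closed matrix_Comp_closed o m)
    fix i j assume [simp]: "i < length Ds" "j < length As"
    have "Comp ?C As Bs Ds N (M \<oplus>\<^bsub>Hom ?C As Bs\<^esub> M') (i, j) =
      (\<Oplus>\<^bsub>Hom C (As ! j) (Ds ! i)\<^esub>k\<in>{..<length Bs}. Comp C (As ! j) (Bs ! k) (Ds ! i) (N (i, k)) (M (k, j)) \<oplus>\<^bsub>Hom C (As ! j) (Ds ! i)\<^esub>
        Comp C (As ! j) (Bs ! k) (Ds ! i) (N (i, k)) (M' (k, j)))"
      unfolding matrix_Comp matrix_add by (simp, intro hom_finsum_cong) (auto simp: comp_add_right)
    also have "\<dots> = (Comp ?C As Bs Ds N M \<oplus>\<^bsub>Hom ?C As Ds\<^esub> Comp ?C As Bs Ds N M') (i, j)"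
      unfolding matrix_Comp matrix_add
      by (simp, intro abelian_monoid.finsum_addf hom_abelian_monoid) auto
    finally show "Comp ?C As Bs Ds N (M \<oplus>\<^bsub>Hom ?C As Bs\<^esub> M') (i, j) = (Comp ?C As Bs Ds N M \<oplus>\<^bsub>Hom ?C As Ds\<^esub> Comp ?C As Bs Ds N M') (i, j)" .
  qed
qed

end

section \<open>Idempotent completion, retracts and membership in \<open>add B\<close>\<close>

context preadditive_category begin

lemma idempotent_Obj:
  "U \<in> Obj (idempotent_completion C) \<longleftrightarrow>
    fst U \<in> Obj C \<and> snd U \<in> Mor C (fst U) (fst U) \<and> Comp C (fst U) (fst U) (fst U) (snd U) (snd U) = snd U"
  by (auto simp: idempotent_completion_def split: prod.splits)

text \<open>Applying either idempotent once more to \<open>f = e' f e\<close> separates the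
  condition into one on each side; in this form closure under composition is immediate.\<close>

lemma idempotent_Mor:
  assumes "U \<in> Obj (idempotent_completion C)" "V \<in> Obj (idempotent_completion C)"
  shows "f \<in> Mor (idempotent_completion C) U V \<longleftrightarrow> f \<in> Mor C (fst U) (fst V) \<and>
    Comp C (fst U) (fst V) (fst V) (snd V) f = f \<and> Comp C (fst U) (fst U) (fst V) f (snd U) = f" (is "?L \<longleftrightarrow> ?R")
proof -
  have o [simp]: "fst U \<in> Obj C" "fst V \<in> Obj C" "snd U \<in> Mor C (fst U) (fst U)" "snd V \<in> Mor C (fst V) (fst V)"
    and e: "Comp C (fst U) (fst U) (fst U) (snd U) (snd U) = snd U" "Comp C (fst V) (fst V) (fst V) (snd V) (snd V) = snd V"
    using assms by (auto simp: idempotent_Obj)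
  have L: "?L \<longleftrightarrow> f \<in> Mor C (fst U) (fst V) \<and>
    Comp C (fst U) (fst U) (fst V) (Comp C (fst U) (fst V) (fst V) (snd V) f) (snd U) = f"
    by (simp add: idempotent_completion_def case_prod_beta)
  show ?thesis
  proof
    assume ?L
    then have f: "f \<in> Mor C (fst U) (fst V)"
      and fe: "f = Comp C (fst U) (fst U) (fst V) (Comp C (fst U) (fst V) (fst V) (snd V) f) (snd U)" using L by auto
    let ?f = "Comp C (fst U) (fst U) (fst V) (Comp C (fst U) (fst V) (fst V) (snd V) f) (snd U)"
    have "Comp C (fst U) (fst V) (fst V) (snd V) ?f = ?f"
      using f by (simp add: comp_assoc e)
    then have "Comp C (fst U) (fst V) (fst V) (snd V) f = f"
      by (simp flip: fe)
    moreover have "Comp C (fst U) (fst U) (fst V) ?f (snd U) = ?f"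
      using f by (simp add: comp_assoc_left e)
    then have "Comp C (fst U) (fst U) (fst V) f (snd U) = f"
      by (simp flip: fe)
    ultimately show ?R using f by blast
  qed (use L in auto)
qed

lemma idempotent_simps [simp]:
  "f \<oplus>\<^bsub>Hom (idempotent_completion C) U V\<^esub> g = f \<oplus>\<^bsub>Hom C (fst U) (fst V)\<^esub> g"
  "\<zero>\<^bsub>Hom (idempotent_completion C) U V\<^esub> = \<zero>\<^bsub>Hom C (fst U) (fst V)\<^esub>"
  "Comp (idempotent_completion C) U V W = Comp C (fst U) (fst V) (fst W)"
  "Ident (idempotent_completion C) U = snd U"
  by (simp_all add: idempotent_completion_def case_prod_beta)

lemma idempotent_completion_preadditive: "preadditive_category (idempotent_completion C)"
proof (rule preadditive_category.intro)
  let ?I = "idempotent_completion C"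
  show "abelian_group (Hom ?I U V)" if o: "U \<in> Obj ?I" "V \<in> Obj ?I" for U V
  proof (rule abelian_groupI)
    note M = idempotent_Mor[OF o]
    have [simp]: "fst U \<in> Obj C" "fst V \<in> Obj C" "snd U \<in> Mor C (fst U) (fst U)" "snd V \<in> Mor C (fst V) (fst V)"
      using o by (auto simp: idempotent_Obj)
    show "\<exists>y\<in>Mor ?I U V. y \<oplus>\<^bsub>Hom ?I U V\<^esub> x = \<zero>\<^bsub>Hom ?I U V\<^esub>" if "x \<in> Mor ?I U V" for x
      using that by (intro bexI[of _ "\<ominus>\<^bsub>Hom C (fst U) (fst V)\<^esub> x"]) (auto simp: M)
    show "x \<oplus>\<^bsub>Hom ?I U V\<^esub> y = y \<oplus>\<^bsub>Hom ?I U V\<^esub> x" if "x \<in> Mor ?I U V" "y \<in> Mor ?I U V" for x y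
      unfolding idempotent_simps using that by (intro hom_a_comm) (simp_all add: M)
    show "x \<oplus>\<^bsub>Hom ?I U V\<^esub> y \<in> Mor ?I U V" if "x \<in> Mor ?I U V" "y \<in> Mor ?I U V" for x y
      using that unfolding M by (simp add: comp_add_left comp_add_right)
    show "\<zero>\<^bsub>Hom ?I U V\<^esub> \<in> Mor ?I U V"
      unfolding M by simp
    show "x \<oplus>\<^bsub>Hom ?I U V\<^esub> y \<oplus>\<^bsub>Hom ?I U V\<^esub> z = x \<oplus>\<^bsub>Hom ?I U V\<^esub> (y \<oplus>\<^bsub>Hom ?I U V\<^esub> z)"
      if "x \<in> Mor ?I U V" "y \<in> Mor ?I U V" "z \<in> Mor ?I U V" for x y z
      using that unfolding M by (simp add: hom_a_assoc)
    show "\<zero>\<^bsub>Hom ?I U V\<^esub> \<oplus>\<^bsub>Hom ?I U V\<^esub> x = x" if "x \<in> Mor ?I U V" for x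
      using that unfolding M by simp
  qed
  show "Comp ?I U V W g f \<in> Mor ?I U W"
    if o: "U \<in> Obj ?I" "V \<in> Obj ?I" "W \<in> Obj ?I" and m: "f \<in> Mor ?I U V" "g \<in> Mor ?I V W" for U V W f g
  proof -
    have [simp]: "fst U \<in> Obj C" "fst V \<in> Obj C" "fst W \<in> Obj C" "snd U \<in> Mor C (fst U) (fst U)" "snd W \<in> Mor C (fst W) (fst W)"
      using o by (auto simp: idempotent_Obj)
    have fg: "f \<in> Mor C (fst U) (fst V)" "g \<in> Mor C (fst V) (fst W)"
      "Comp C (fst U) (fst U) (fst V) f (snd U) = f" "Comp C (fst V) (fst W) (fst W) (snd W) g = g"
      using m o by (auto simp: idempotent_Mor)
    have "Comp C (fst U) (fst W) (fst W) (snd W) (Comp C (fst U) (fst V) (fst W) g f) = Comp C (fst U) (fst V) (fst W) g f"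
      using fg by (simp add: comp_assoc)
    moreover have "Comp C (fst U) (fst U) (fst W) (Comp C (fst U) (fst V) (fst W) g f) (snd U) = Comp C (fst U) (fst V) (fst W) g f"
      using fg by (simp add: comp_assoc_left)
    ultimately show ?thesis using o fg by (auto simp: idempotent_Mor)
  qed
  show "Comp ?I U W T h (Comp ?I U V W g f) = Comp ?I U V T (Comp ?I V W T h g) f"
    if o: "U \<in> Obj ?I" "V \<in> Obj ?I" "W \<in> Obj ?I" "T \<in> Obj ?I"
      and m: "f \<in> Mor ?I U V" "g \<in> Mor ?I V W" "h \<in> Mor ?I W T" for U V W T f g h
  proof -
    have "fst U \<in> Obj C" "fst V \<in> Obj C" "fst W \<in> Obj C" "fst T \<in> Obj C"
      "f \<in> Mor C (fst U) (fst V)" "g \<in> Mor C (fst V) (fst W)" "h \<in> Mor C (fst W) (fst T)"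
      using o m by (simp_all add: idempotent_Mor idempotent_Obj)
    then show ?thesis by (simp add: comp_assoc)
  qed
  show "Ident ?I U \<in> Mor ?I U U" if o: "U \<in> Obj ?I" for U
    unfolding idempotent_Mor[OF o o] using o unfolding idempotent_Obj by simp
  show "Comp ?I U V V (Ident ?I V) f = f" if o: "U \<in> Obj ?I" "V \<in> Obj ?I" and f: "f \<in> Mor ?I U V" for U V f
    using f unfolding idempotent_Mor[OF o] by simp
  show "Comp ?I U U V f (Ident ?I U) = f" if o: "U \<in> Obj ?I" "V \<in> Obj ?I" and f: "f \<in> Mor ?I U V" for U V f
    using f unfolding idempotent_Mor[OF o] by simp
  show "Comp ?I U V W (g \<oplus>\<^bsub>Hom ?I V W\<^esub> g') f = Comp ?I U V W g f \<oplus>\<^bsub>Hom ?I U W\<^esub> Comp ?I U V W g' f"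
    if o: "U \<in> Obj ?I" "V \<in> Obj ?I" "W \<in> Obj ?I"
      and m: "f \<in> Mor ?I U V" "g \<in> Mor ?I V W" "g' \<in> Mor ?I V W" for U V W f g g'
    using o m(1)[unfolded idempotent_Mor[OF o(1,2)]] m(2,3)[unfolded idempotent_Mor[OF o(2,3)]]
    unfolding idempotent_Obj idempotent_simps by (intro comp_add_left) blast+
  show "Comp ?I U V W g (f \<oplus>\<^bsub>Hom ?I U V\<^esub> f') = Comp ?I U V W g f \<oplus>\<^bsub>Hom ?I U W\<^esub> Comp ?I U V W g f'"
    if o: "U \<in> Obj ?I" "V \<in> Obj ?I" "W \<in> Obj ?I"
      and m: "f \<in> Mor ?I U V" "f' \<in> Mor ?I U V" "g \<in> Mor ?I V W" for U V W f f' g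
    using o m(1,2)[unfolded idempotent_Mor[OF o(1,2)]] m(3)[unfolded idempotent_Mor[OF o(2,3)]]
    unfolding idempotent_Obj idempotent_simps by (intro comp_add_right) blast+
qed

lemma add_category_preadditive: "preadditive_category (add_category C)"
  unfolding add_category_def
  by (rule preadditive_category.idempotent_completion_preadditive[OF matrix_category_preadditive])

lemma isomorphic_summand_retract:
  assumes "isomorphic_objs C A D" "direct_summand C D B"
  shows "\<exists>f\<in>Mor C A B. \<exists>g\<in>Mor C B A. Comp C A B A g f = Ident C A"
proof -
  obtain f g where m: "A \<in> Obj C" "D \<in> Obj C" "f \<in> Mor C A D" "g \<in> Mor C D A" "Comp C A D A g f = Ident C A"
    using assms(1) unfolding isomorphic_objs_def by blast
  obtain i p where n: "B \<in> Obj C" "i \<in> Mor C D B" "p \<in> Mor C B D" "Comp C D B D p i = Ident C D"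
    using assms(2) unfolding direct_summand_def is_direct_sum_pair by blast
  have "Comp C A B D p (Comp C A D B i f) = f" using m n by (simp add: comp_assoc)
  then have "Comp C A B A (Comp C B D A g p) (Comp C A D B i f) = Ident C A"
    using m n by (simp add: comp_assoc_left)
  then show ?thesis using m(1-4) n(1-3)
    by (intro bexI[of _ "Comp C A D B i f"] bexI[of _ "Comp C B D A g p"]) simp_all
qed

text \<open>Insert \<open>\<Sum> \<iota>_k \<pi>_k = 1\<close> on \<open>B^n\<close> between the
  inclusion and the projection of \<open>A\<close>; every summand then factors through
  \<open>B\<close>.\<close>

lemma add_of_object_sum:
  assumes "A \<in> add_of_object C B" "A \<in> Obj C" "B \<in> Obj C"
  shows "\<exists>n x y. (\<forall>k<n. x k \<in> Mor C B A \<and> y k \<in> Mor C A B) \<and>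
    (\<Oplus>\<^bsub>Hom C A A\<^esub>k\<in>{..<n::nat}. Comp C A B A (x k) (y k)) = Ident C A"
proof -
  obtain n S where S: "is_direct_sum C (replicate n B) S" "direct_summand C A S"
    using assms unfolding add_of_object_def by blast
  obtain \<iota> \<pi> where So: "S \<in> Obj C" and m: "\<And>k. k < n \<Longrightarrow> \<iota> k \<in> Mor C B S \<and> \<pi> k \<in> Mor C S B"
    and sum: "(\<Oplus>\<^bsub>Hom C S S\<^esub>k\<in>{..<length (replicate n B)}. Comp C S (replicate n B ! k) S (\<iota> k) (\<pi> k)) = Ident C S"
    using S(1) unfolding is_direct_sum_def by auto
  have sum': "(\<Oplus>\<^bsub>Hom C S S\<^esub>k\<in>{..<n}. Comp C S B S (\<iota> k) (\<pi> k)) = Ident C S"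
    unfolding sum[symmetric] using m So assms by (simp, intro hom_finsum_cong) auto
  obtain i p where n: "i \<in> Mor C A S" "p \<in> Mor C S A" "Comp C A S A p i = Ident C A"
    using S(2) unfolding direct_summand_def is_direct_sum_pair by blast
  have "Ident C A = Comp C A S A p (Comp C A S S (\<Oplus>\<^bsub>Hom C S S\<^esub>k\<in>{..<n}. Comp C S B S (\<iota> k) (\<pi> k)) i)"
    unfolding sum' using n So assms by simp
  also have "Comp C A S S (\<Oplus>\<^bsub>Hom C S S\<^esub>k\<in>{..<n}. Comp C S B S (\<iota> k) (\<pi> k)) i =
      (\<Oplus>\<^bsub>Hom C A S\<^esub>k\<in>{..<n}. Comp C A S S (Comp C S B S (\<iota> k) (\<pi> k)) i)"
    using n So assms m by (intro comp_finsum_left) auto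
  also have "Comp C A S A p \<dots> = (\<Oplus>\<^bsub>Hom C A A\<^esub>k\<in>{..<n}. Comp C A S A p (Comp C A S S (Comp C S B S (\<iota> k) (\<pi> k)) i))"
    using n So assms m by (intro comp_finsum_right) auto
  also have "\<dots> = (\<Oplus>\<^bsub>Hom C A A\<^esub>k\<in>{..<n}. Comp C A B A (Comp C B S A p (\<iota> k)) (Comp C A S B (\<pi> k) i))"
    using n So assms m by (intro hom_finsum_cong) (auto simp: comp_assoc_left)
  finally show ?thesis
    using m n So assms by (intro exI[of _ n] exI[of _ "\<lambda>k. Comp C B S A p (\<iota> k)"] exI[of _ "\<lambda>k. Comp C A S B (\<pi> k) i"]) auto
qed

section \<open>Objects of \<open>C\<close> as one-by-one matrices: a full and faithful
  embedding\<close>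

lemma embed_facts:
  assumes "A \<in> Obj C" "B \<in> Obj C"
  shows add_embed_Obj: "add_embed C A \<in> Obj (add_category C)"
    and add_embed_Mor: "M \<in> Mor (add_category C) (add_embed C A) (add_embed C B) \<longleftrightarrow> M \<in> Mor (matrix_category C) [A] [B]"
proof -
  interpret M: preadditive_category "matrix_category C" by (rule matrix_category_preadditive)
  have o: "[A] \<in> Obj (matrix_category C)" "[B] \<in> Obj (matrix_category C)"
    using assms by (auto simp: matrix_Obj)
  show A: "add_embed C A \<in> Obj (add_category C)"
    unfolding add_category_def M.idempotent_Obj add_embed_def using o by simp
  have B: "add_embed C B \<in> Obj (add_category C)"
    unfolding add_category_def M.idempotent_Obj add_embed_def using o by simp
  show "M \<in> Mor (add_category C) (add_embed C A) (add_embed C B) \<longleftrightarrow> M \<in> Mor (matrix_category C) [A] [B]"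
    unfolding add_category_def M.idempotent_Mor[OF A[unfolded add_category_def] B[unfolded add_category_def]]
    using o M.comp_ident_left[OF o] M.comp_ident_right[OF o] by (auto simp: add_embed_def)
qed

lemma embed_entry:
  assumes "A \<in> Obj C" "B \<in> Obj C" "M \<in> Mor (add_category C) (add_embed C A) (add_embed C B)"
  shows "M (0, 0) \<in> Mor C A B"
  using matrix_entry[of M "[A]" "[B]" 0 0] assms by (simp add: add_embed_Mor)

lemma embed_Comp_entry:
  assumes "A \<in> Obj C" "B \<in> Obj C" "D \<in> Obj C" "M \<in> Mor (add_category C) (add_embed C A) (add_embed C B)"
    "N \<in> Mor (add_category C) (add_embed C B) (add_embed C D)"
  shows "Comp (add_category C) (add_embed C A) (add_embed C B) (add_embed C D) N M (0, 0) =
    Comp C A B D (N (0, 0)) (M (0, 0))"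
proof -
  interpret M: preadditive_category "matrix_category C" by (rule matrix_category_preadditive)
  interpret AD: abelian_monoid "Hom C A D" using assms hom_abelian_monoid by blast
  have e: "M (0, 0) \<in> Mor C A B" "N (0, 0) \<in> Mor C B D" using assms embed_entry by auto
  have "{..<length [B]} = {0::nat}" by auto
  then show ?thesis using e assms(1-3)
    unfolding add_category_def by (simp add: add_embed_def matrix_Comp)
qed

lemma embed_Ident_entry:
  "Ident (add_category C) (add_embed C A) (0, 0) = Ident C A"
proof -
  interpret M: preadditive_category "matrix_category C" by (rule matrix_category_preadditive)
  show ?thesis unfolding add_category_def by (simp add: add_embed_def matrix_Ident)
qed

lemma embed_ext:
  assumes "A \<in> Obj C" "B \<in> Obj C" "M \<in> Mor (add_category C) (add_embed C A) (add_embed C B)"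
    "N \<in> Mor (add_category C) (add_embed C A) (add_embed C B)" "M (0, 0) = N (0, 0)"
  shows "M = N"
  by (rule matrix_ext[of _ "[A]" "[B]"]) (use assms in \<open>auto simp: add_embed_Mor\<close>)

lemma embed_surj:
  assumes "A \<in> Obj C" "B \<in> Obj C" "f \<in> Mor C A B"
  shows "\<exists>M\<in>Mor (add_category C) (add_embed C A) (add_embed C B). M (0, 0) = f"
proof -
  let ?M = "\<lambda>(i, j)\<in>matrix_index [A] [B]. f"
  have "?M \<in> Mor (matrix_category C) [A] [B]" by (rule matrix_MorI) (use assms in auto)
  then show ?thesis using assms by (intro bexI[of _ ?M]) (auto simp: add_embed_Mor)
qed

lemma isomorphic_add_embed:
  assumes o: "A \<in> Obj C" "B \<in> Obj C"
  shows "isomorphic_objs (add_category C) (add_embed C A) (add_embed C B) \<longleftrightarrow> isomorphic_objs C A B"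
proof
  interpret I: preadditive_category "add_category C" by (rule add_category_preadditive)
  assume "isomorphic_objs (add_category C) (add_embed C A) (add_embed C B)"
  then obtain M N where m: "M \<in> Mor (add_category C) (add_embed C A) (add_embed C B)" "N \<in> Mor (add_category C) (add_embed C B) (add_embed C A)"
    "Comp (add_category C) (add_embed C A) (add_embed C B) (add_embed C A) N M = Ident (add_category C) (add_embed C A)"
    "Comp (add_category C) (add_embed C B) (add_embed C A) (add_embed C B) M N = Ident (add_category C) (add_embed C B)"
    unfolding isomorphic_objs_def by blast
  have "Comp C A B A (N (0, 0)) (M (0, 0)) = Ident C A" "Comp C B A B (M (0, 0)) (N (0, 0)) = Ident C B"
    using embed_Comp_entry[OF o o(1) m(1,2)] embed_Comp_entry[OF o(2,1,2) m(2,1)] unfolding m(3,4) embed_Ident_entry by auto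
  then show "isomorphic_objs C A B"
    using o embed_entry m unfolding isomorphic_objs_def by blast
next
  interpret I: preadditive_category "add_category C" by (rule add_category_preadditive)
  note O = add_embed_Obj[OF o(1) o(1)] add_embed_Obj[OF o(2) o(2)]
  assume "isomorphic_objs C A B"
  then obtain f g where fg: "f \<in> Mor C A B" "g \<in> Mor C B A" "Comp C A B A g f = Ident C A" "Comp C B A B f g = Ident C B"
    unfolding isomorphic_objs_def by blast
  obtain M N where m: "M \<in> Mor (add_category C) (add_embed C A) (add_embed C B)" "M (0, 0) = f"
    "N \<in> Mor (add_category C) (add_embed C B) (add_embed C A)" "N (0, 0) = g"
    using embed_surj o fg(1,2) by meson
  have "Comp (add_category C) (add_embed C A) (add_embed C B) (add_embed C A) N M = Ident (add_category C) (add_embed C A)"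
    by (rule embed_ext[OF o(1,1)]) (use m fg o O in \<open>auto simp: embed_Comp_entry embed_Ident_entry\<close>)
  moreover have "Comp (add_category C) (add_embed C B) (add_embed C A) (add_embed C B) M N = Ident (add_category C) (add_embed C B)"
    by (rule embed_ext[OF o(2,2)]) (use m fg o O in \<open>auto simp: embed_Comp_entry embed_Ident_entry\<close>)
  ultimately show "isomorphic_objs (add_category C) (add_embed C A) (add_embed C B)"
    unfolding isomorphic_objs_def using O m by blast
qed

text \<open>\<open>D\<close> may be any object of \<open>add_category C\<close>, but the composite
  retraction runs between two embedded objects and is therefore a pair of one-by-one
  matrices.\<close>

lemma add_embed_retract:
  assumes o: "A \<in> Obj C" "B \<in> Obj C"
    and "isomorphic_objs (add_category C) (add_embed C A) D" "direct_summand (add_category C) D (add_embed C B)"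
  shows "\<exists>f\<in>Mor C A B. \<exists>g\<in>Mor C B A. Comp C A B A g f = Ident C A"
proof -
  interpret I: preadditive_category "add_category C" by (rule add_category_preadditive)
  obtain M N where m: "M \<in> Mor (add_category C) (add_embed C A) (add_embed C B)" "N \<in> Mor (add_category C) (add_embed C B) (add_embed C A)"
    "Comp (add_category C) (add_embed C A) (add_embed C B) (add_embed C A) N M = Ident (add_category C) (add_embed C A)"
    using I.isomorphic_summand_retract[OF assms(3,4)] by blast
  then show ?thesis using embed_Comp_entry[OF o o(1) m(1,2)] embed_entry o unfolding m(3) embed_Ident_entry by metis
qed

lemma add_embed_sum:
  assumes o: "A \<in> Obj C" "B \<in> Obj C" and "add_embed C A \<in> add_of_object (add_category C) (add_embed C B)"
  shows "\<exists>n x y. (\<forall>k<n. x k \<in> Mor C B A \<and> y k \<in> Mor C A B) \<and>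
    (\<Oplus>\<^bsub>Hom C A A\<^esub>k\<in>{..<n::nat}. Comp C A B A (x k) (y k)) = Ident C A"
proof -
  interpret I: preadditive_category "add_category C" by (rule add_category_preadditive)
  interpret M: preadditive_category "matrix_category C" by (rule matrix_category_preadditive)
  interpret AA: abelian_monoid "Hom C A A" using o hom_abelian_monoid by blast
  let ?A = "add_embed C A" and ?B = "add_embed C B" and ?I = "add_category C"
  note O = add_embed_Obj[OF o(1) o(1)] add_embed_Obj[OF o(2) o(2)]
  interpret IA: abelian_monoid "Hom ?I ?A ?A" using O I.hom_abelian_monoid by blast
  obtain n x y where xy: "\<And>k. k < n \<Longrightarrow> x k \<in> Mor ?I ?B ?A \<and> y k \<in> Mor ?I ?A ?B"
    and sum: "(\<Oplus>\<^bsub>Hom ?I ?A ?A\<^esub>k\<in>{..<n::nat}. Comp ?I ?A ?B ?A (x k) (y k)) = Ident ?I ?A"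
    using I.add_of_object_sum[OF assms(3) O] by blast
  \<comment> \<open>Taking the entry \<open>(0, 0)\<close> is additive, so it passes through the sum
    one term at a time.\<close>
  have "(\<Oplus>\<^bsub>Hom ?I ?A ?A\<^esub>k\<in>{..<m}. Comp ?I ?A ?B ?A (x k) (y k)) \<in> Mor ?I ?A ?A \<and>
    (\<Oplus>\<^bsub>Hom ?I ?A ?A\<^esub>k\<in>{..<m}. Comp ?I ?A ?B ?A (x k) (y k)) (0, 0) =
      (\<Oplus>\<^bsub>Hom C A A\<^esub>k\<in>{..<m}. Comp C A B A (x k (0, 0)) (y k (0, 0)))" if "m \<le> n" for m
    using that
  proof (induction m)
    case 0
    have "\<zero>\<^bsub>Hom ?I ?A ?A\<^esub> (0, 0) = \<zero>\<^bsub>Hom C A A\<^esub>"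
      unfolding add_category_def by (simp add: add_embed_def)
    then show ?case by simp
  next
    case (Suc m)
    have c: "\<And>k. k < n \<Longrightarrow> x k (0, 0) \<in> Mor C B A \<and> y k (0, 0) \<in> Mor C A B"
      using xy embed_entry o by blast
    have c1: "\<And>k. k < n \<Longrightarrow> Comp ?I ?A ?B ?A (x k) (y k) \<in> Mor ?I ?A ?A"
      using xy O by auto
    have c2: "\<And>k. k < n \<Longrightarrow> Comp C A B A (x k (0, 0)) (y k (0, 0)) \<in> Mor C A A"
      using c o by auto
    have "(\<Oplus>\<^bsub>Hom ?I ?A ?A\<^esub>k\<in>{..<Suc m}. Comp ?I ?A ?B ?A (x k) (y k)) =
      Comp ?I ?A ?B ?A (x m) (y m) \<oplus>\<^bsub>Hom ?I ?A ?A\<^esub> (\<Oplus>\<^bsub>Hom ?I ?A ?A\<^esub>k\<in>{..<m}. Comp ?I ?A ?B ?A (x k) (y k))"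
      unfolding lessThan_Suc using Suc.prems c1 by (intro IA.finsum_insert) auto
    moreover have "(\<Oplus>\<^bsub>Hom C A A\<^esub>k\<in>{..<Suc m}. Comp C A B A (x k (0, 0)) (y k (0, 0))) =
      Comp C A B A (x m (0, 0)) (y m (0, 0)) \<oplus>\<^bsub>Hom C A A\<^esub> (\<Oplus>\<^bsub>Hom C A A\<^esub>k\<in>{..<m}. Comp C A B A (x k (0, 0)) (y k (0, 0)))"
      unfolding lessThan_Suc using Suc.prems c2 by (intro AA.finsum_insert) auto
    moreover have "(M \<oplus>\<^bsub>Hom ?I ?A ?A\<^esub> N) (0, 0) = M (0, 0) \<oplus>\<^bsub>Hom C A A\<^esub> N (0, 0)" for M N
      unfolding add_category_def by (simp add: add_embed_def)
    moreover have "Comp ?I ?A ?B ?A (x m) (y m) (0, 0) = Comp C A B A (x m (0, 0)) (y m (0, 0))"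
      using embed_Comp_entry[OF o o(1)] xy Suc.prems by auto
    ultimately show ?case using Suc c1[of m] O by simp
  qed
  from this[OF order_refl] have "(\<Oplus>\<^bsub>Hom C A A\<^esub>k\<in>{..<n}. Comp C A B A (x k (0, 0)) (y k (0, 0))) = Ident C A"
    unfolding sum embed_Ident_entry by simp
  then show ?thesis using xy embed_entry o
    by (intro exI[of _ n] exI[of _ "\<lambda>k. x k (0, 0)"] exI[of _ "\<lambda>k. y k (0, 0)"]) auto
qed

end

section \<open>Localization of Hom modules\<close>

lemma (in abelian_group) add_minus_cancel:
  "x \<in> carrier G \<Longrightarrow> y \<in> carrier G \<Longrightarrow> x \<oplus> y \<oplus> \<ominus> x \<oplus> \<ominus> y = \<zero>"
  using r_neg[of "x \<oplus> y"] by (simp add: minus_add a_assoc)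

section \<open>Fractions over a multiplicative subset of a domain\<close>

locale localized_domain = domain R for R :: "('r, 'x) ring_scheme" (structure) +
  fixes T :: "'r set"
  assumes T_sub: "T \<subseteq> carrier R" and T_one: "\<one> \<in> T" and T_zero: "\<zero> \<notin> T"
    and T_mult [simp]: "\<And>s t. s \<in> T \<Longrightarrow> t \<in> T \<Longrightarrow> s \<otimes> t \<in> T"
begin

lemma T_carr [simp]: "s \<in> T \<Longrightarrow> s \<in> carrier R"
  using T_sub by blast

lemma one_T [simp]: "\<one> \<in> T"
  by (rule T_one)

lemma T_cancel: "u \<in> T \<Longrightarrow> a \<in> carrier R \<Longrightarrow> b \<in> carrier R \<Longrightarrow> u \<otimes> a = u \<otimes> b \<longleftrightarrow> a = b"
  using T_zero by (metis T_carr m_lcancel)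

abbreviation loc where "loc \<equiv> localization R T"

text \<open>In a domain the factor \<open>u\<close> in \<open>fraction\<close> cancels and leaves
  cross multiplication.\<close>

lemma mem_fraction:
  assumes "a \<in> carrier R" "s \<in> T"
  shows "(b, t) \<in> fraction R T a s \<longleftrightarrow> b \<in> carrier R \<and> t \<in> T \<and> a \<otimes> t = b \<otimes> s"
proof
  assume "(b, t) \<in> fraction R T a s"
  then obtain u where "b \<in> carrier R" "t \<in> T" "u \<in> T" "u \<otimes> (a \<otimes> t \<ominus> b \<otimes> s) = \<zero>"
    unfolding fraction_def by blast
  then show "b \<in> carrier R \<and> t \<in> T \<and> a \<otimes> t = b \<otimes> s"
    using assms T_zero integral_iff by (metis T_carr m_closed minus_closed r_right_minus_eq)
next
  assume "b \<in> carrier R \<and> t \<in> T \<and> a \<otimes> t = b \<otimes> s"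
  then show "(b, t) \<in> fraction R T a s"
    using assms unfolding fraction_def by (auto intro!: bexI[of _ \<one>] simp: a_minus_def r_neg)
qed

lemma fraction_eq_iff:
  assumes "a \<in> carrier R" "s \<in> T" "b \<in> carrier R" "t \<in> T"
  shows "fraction R T a s = fraction R T b t \<longleftrightarrow> a \<otimes> t = b \<otimes> s"
proof
  assume "fraction R T a s = fraction R T b t"
  then have "(b, t) \<in> fraction R T a s" using assms by (simp add: mem_fraction)
  then show "a \<otimes> t = b \<otimes> s" using assms by (simp add: mem_fraction)
next
  assume eq: "a \<otimes> t = b \<otimes> s"
  have "a \<otimes> w = c \<otimes> s \<longleftrightarrow> b \<otimes> w = c \<otimes> t" if c: "c \<in> carrier R" "w \<in> T" for c w
  proof -
    have "a \<otimes> w = c \<otimes> s \<longleftrightarrow> t \<otimes> (a \<otimes> w) = t \<otimes> (c \<otimes> s)" using assms c by (simp add: T_cancel)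
    also have "t \<otimes> (a \<otimes> w) = (a \<otimes> t) \<otimes> w" using assms c by (simp add: m_ac)
    also have "\<dots> = s \<otimes> (b \<otimes> w)" unfolding eq using assms c by (simp add: m_ac)
    also have "t \<otimes> (c \<otimes> s) = s \<otimes> (c \<otimes> t)" using assms c by (simp add: m_ac)
    finally show ?thesis using assms c by (simp add: T_cancel)
  qed
  then have "(c, w) \<in> fraction R T a s \<longleftrightarrow> (c, w) \<in> fraction R T b t" for c w
    unfolding mem_fraction[OF assms(1,2)] mem_fraction[OF assms(3,4)] by blast
  then show "fraction R T a s = fraction R T b t"
    by auto
qed

text \<open>The operations of \<open>localization\<close> are unions over all representatives; this
  collapses such a union once the value is independent of the representative.\<close>

lemma UN_fraction_const:
  assumes "a \<in> carrier R" "s \<in> T" and "\<And>b t. b \<in> carrier R \<Longrightarrow> t \<in> T \<Longrightarrow> a \<otimes> t = b \<otimes> s \<Longrightarrow> F b t = Q"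
  shows "(\<Union>(b, t)\<in>fraction R T a s. F b t) = Q"
proof -
  have "(a, s) \<in> fraction R T a s" using assms by (simp add: mem_fraction)
  moreover have "F b t = Q" if "(b, t) \<in> fraction R T a s" for b t
    using that assms by (simp add: mem_fraction)
  ultimately show ?thesis by blast
qed

lemma loc_carrier: "carrier loc = {fraction R T a s | a s. a \<in> carrier R \<and> s \<in> T}"
  and loc_one: "\<one>\<^bsub>loc\<^esub> = fraction R T \<one> \<one>"
  by (simp_all add: localization_def)

lemma fraction_closed [simp]: "a \<in> carrier R \<Longrightarrow> s \<in> T \<Longrightarrow> fraction R T a s \<in> carrier loc"
  by (auto simp: loc_carrier)

lemma loc_mult [simp]:
  assumes "a \<in> carrier R" "s \<in> T" "b \<in> carrier R" "t \<in> T"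
  shows "fraction R T a s \<otimes>\<^bsub>loc\<^esub> fraction R T b t = fraction R T (a \<otimes> b) (s \<otimes> t)"
proof -
  have "fraction R T (a' \<otimes> b') (s' \<otimes> t') = fraction R T (a \<otimes> b) (s \<otimes> t)"
    if e: "a' \<in> carrier R" "s' \<in> T" "a \<otimes> s' = a' \<otimes> s" "b' \<in> carrier R" "t' \<in> T" "b \<otimes> t' = b' \<otimes> t" for a' s' b' t'
  proof -
    have "(a' \<otimes> b') \<otimes> (s \<otimes> t) = (a' \<otimes> s) \<otimes> (b' \<otimes> t)" "(a \<otimes> b) \<otimes> (s' \<otimes> t') = (a \<otimes> s') \<otimes> (b \<otimes> t')"
      using e(1,2,4,5) assms by (simp_all add: m_ac)
    then show ?thesis using e assms by (simp add: fraction_eq_iff)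
  qed
  then have "(\<Union>(a', s')\<in>fraction R T a s. \<Union>(b', t')\<in>fraction R T b t. fraction R T (a' \<otimes> b') (s' \<otimes> t')) = fraction R T (a \<otimes> b) (s \<otimes> t)"
    by (intro UN_fraction_const assms)
  then show ?thesis by (simp add: localization_def)
qed

lemma loc_add [simp]:
  assumes "a \<in> carrier R" "s \<in> T" "b \<in> carrier R" "t \<in> T"
  shows "fraction R T a s \<oplus>\<^bsub>loc\<^esub> fraction R T b t = fraction R T (a \<otimes> t \<oplus> b \<otimes> s) (s \<otimes> t)"
proof -
  have "fraction R T (a' \<otimes> t' \<oplus> b' \<otimes> s') (s' \<otimes> t') = fraction R T (a \<otimes> t \<oplus> b \<otimes> s) (s \<otimes> t)"
    if e: "a' \<in> carrier R" "s' \<in> T" "a \<otimes> s' = a' \<otimes> s" "b' \<in> carrier R" "t' \<in> T" "b \<otimes> t' = b' \<otimes> t" for a' s' b' t'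
  proof -
    have "(a' \<otimes> t' \<oplus> b' \<otimes> s') \<otimes> (s \<otimes> t) = (a' \<otimes> s) \<otimes> (t \<otimes> t') \<oplus> (b' \<otimes> t) \<otimes> (s \<otimes> s')"
      "(a \<otimes> t \<oplus> b \<otimes> s) \<otimes> (s' \<otimes> t') = (a \<otimes> s') \<otimes> (t \<otimes> t') \<oplus> (b \<otimes> t') \<otimes> (s \<otimes> s')"
      using e(1,2,4,5) assms by (simp_all add: l_distr r_distr m_ac)
    then show ?thesis using e assms by (simp add: fraction_eq_iff)
  qed
  then have "(\<Union>(a', s')\<in>fraction R T a s. \<Union>(b', t')\<in>fraction R T b t. fraction R T (a' \<otimes> t' \<oplus> b' \<otimes> s') (s' \<otimes> t')) = fraction R T (a \<otimes> t \<oplus> b \<otimes> s) (s \<otimes> t)"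
    by (intro UN_fraction_const assms)
  then show ?thesis by (simp add: localization_def)
qed

lemma loc_smult [simp]:
  assumes "r \<in> carrier R" "a \<in> carrier R" "s \<in> T"
  shows "r \<odot>\<^bsub>loc\<^esub> fraction R T a s = fraction R T (r \<otimes> a) s"
proof -
  have "fraction R T (r \<otimes> a') s' = fraction R T (r \<otimes> a) s"
    if e: "a' \<in> carrier R" "s' \<in> T" "a \<otimes> s' = a' \<otimes> s" for a' s'
    using e assms by (simp add: fraction_eq_iff m_assoc)
  then have "(\<Union>(a', s')\<in>fraction R T a s. fraction R T (r \<otimes> a') s') = fraction R T (r \<otimes> a) s"
    by (intro UN_fraction_const assms)
  then show ?thesis by (simp add: localization_def)
qed

lemma locE:
  assumes "q \<in> carrier loc"
  obtains a s where "a \<in> carrier R" "s \<in> T" "q = fraction R T a s"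
  using assms by (auto simp: loc_carrier)

lemma loc_closed [simp]:
  "q \<in> carrier loc \<Longrightarrow> q' \<in> carrier loc \<Longrightarrow> q \<oplus>\<^bsub>loc\<^esub> q' \<in> carrier loc"
  "q \<in> carrier loc \<Longrightarrow> q' \<in> carrier loc \<Longrightarrow> q \<otimes>\<^bsub>loc\<^esub> q' \<in> carrier loc"
  "r \<in> carrier R \<Longrightarrow> q \<in> carrier loc \<Longrightarrow> r \<odot>\<^bsub>loc\<^esub> q \<in> carrier loc"
  by (auto elim!: locE)

lemma loc_distr:
  assumes "p \<in> carrier loc" "q \<in> carrier loc" "q' \<in> carrier loc"
  shows "(q \<oplus>\<^bsub>loc\<^esub> q') \<otimes>\<^bsub>loc\<^esub> p = q \<otimes>\<^bsub>loc\<^esub> p \<oplus>\<^bsub>loc\<^esub> q' \<otimes>\<^bsub>loc\<^esub> p"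
    and "p \<otimes>\<^bsub>loc\<^esub> (q \<oplus>\<^bsub>loc\<^esub> q') = p \<otimes>\<^bsub>loc\<^esub> q \<oplus>\<^bsub>loc\<^esub> p \<otimes>\<^bsub>loc\<^esub> q'"
proof -
  obtain a s where [simp]: "a \<in> carrier R" "s \<in> T" and p: "p = fraction R T a s"
    using assms(1) by (rule locE)
  obtain b t where [simp]: "b \<in> carrier R" "t \<in> T" and q: "q = fraction R T b t"
    using assms(2) by (rule locE)
  obtain c w where [simp]: "c \<in> carrier R" "w \<in> T" and q': "q' = fraction R T c w"
    using assms(3) by (rule locE)
  note e = p q q'
  show "(q \<oplus>\<^bsub>loc\<^esub> q') \<otimes>\<^bsub>loc\<^esub> p = q \<otimes>\<^bsub>loc\<^esub> p \<oplus>\<^bsub>loc\<^esub> q' \<otimes>\<^bsub>loc\<^esub> p"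
    unfolding e by (simp add: fraction_eq_iff) (simp add: l_distr r_distr m_ac)
  show "p \<otimes>\<^bsub>loc\<^esub> (q \<oplus>\<^bsub>loc\<^esub> q') = p \<otimes>\<^bsub>loc\<^esub> q \<oplus>\<^bsub>loc\<^esub> p \<otimes>\<^bsub>loc\<^esub> q'"
    unfolding e by (simp add: fraction_eq_iff) (simp add: l_distr r_distr m_ac)
qed

lemma loc_smult_mult:
  assumes "r \<in> carrier R" "q \<in> carrier loc" "q' \<in> carrier loc"
  shows "(r \<odot>\<^bsub>loc\<^esub> q) \<otimes>\<^bsub>loc\<^esub> q' = r \<odot>\<^bsub>loc\<^esub> (q \<otimes>\<^bsub>loc\<^esub> q')"
    and "q \<otimes>\<^bsub>loc\<^esub> (r \<odot>\<^bsub>loc\<^esub> q') = r \<odot>\<^bsub>loc\<^esub> (q \<otimes>\<^bsub>loc\<^esub> q')"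
  using assms by (auto elim!: locE simp: fraction_eq_iff m_ac)

end

section \<open>The tensor product of a localization with a module, seen as a module of
  fractions\<close>

locale localized_module = localized_domain R T + module R M
  for R :: "('r, 'x) ring_scheme" (structure) and T and M :: "('r, 'm, 'z) module_scheme"
begin

abbreviation "free \<equiv> free_Abelian_group (carrier loc \<times> carrier M)"
abbreviation "rel \<equiv> tensor_relations R loc M"
abbreviation "cls \<equiv> tensor_class R loc M"

text \<open>The generating set inside \<open>tensor_relations\<close>, named so that case
  distinctions and inductions can refer to it.\<close>

definition relators :: "(('r \<times> 'r) set \<times> 'm \<Rightarrow>\<^sub>0 int) set" where
  "relators = {frag_of (s \<oplus>\<^bsub>loc\<^esub> s', m) - frag_of (s, m) - frag_of (s', m) | s s' m.
        s \<in> carrier loc \<and> s' \<in> carrier loc \<and> m \<in> carrier M} \<union>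
     {frag_of (s, m \<oplus>\<^bsub>M\<^esub> m') - frag_of (s, m) - frag_of (s, m') | s m m'.
        s \<in> carrier loc \<and> m \<in> carrier M \<and> m' \<in> carrier M} \<union>
     {frag_of (r \<odot>\<^bsub>loc\<^esub> s, m) - frag_of (s, r \<odot>\<^bsub>M\<^esub> m) | r s m.
        r \<in> carrier R \<and> s \<in> carrier loc \<and> m \<in> carrier M}"

lemma rel_def: "rel = generate free relators"
  unfolding tensor_relations_def relators_def ..

lemma relatorsE [consumes 1, case_names left right scalar]:
  assumes "x \<in> relators"
  obtains s s' m where "s \<in> carrier loc" "s' \<in> carrier loc" "m \<in> carrier M"
      "x = frag_of (s \<oplus>\<^bsub>loc\<^esub> s', m) - frag_of (s, m) - frag_of (s', m)"
    | s m m' where "s \<in> carrier loc" "m \<in> carrier M" "m' \<in> carrier M"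
      "x = frag_of (s, m \<oplus>\<^bsub>M\<^esub> m') - frag_of (s, m) - frag_of (s, m')"
    | r s m where "r \<in> carrier R" "s \<in> carrier loc" "m \<in> carrier M"
      "x = frag_of (r \<odot>\<^bsub>loc\<^esub> s, m) - frag_of (s, r \<odot>\<^bsub>M\<^esub> m)"
  using assms unfolding relators_def by blast

sublocale F: comm_group free by (rule abelian_free_Abelian_group)

lemma free_closed [simp]:
  "0 \<in> carrier free" "x \<in> carrier free \<Longrightarrow> y \<in> carrier free \<Longrightarrow> x + y \<in> carrier free"
  "x \<in> carrier free \<Longrightarrow> y \<in> carrier free \<Longrightarrow> x - y \<in> carrier free"
  "x \<in> carrier free \<Longrightarrow> - x \<in> carrier free"
  using keys_add[of x y] keys_diff[of x y] by auto

lemma frag_of_free: "frag_of (s, m) \<in> carrier free \<longleftrightarrow> s \<in> carrier loc \<and> m \<in> carrier M"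
  unfolding frag_of_in_free_Abelian_group by simp

lemma relators_sub: "relators \<subseteq> carrier free"
proof
  fix x assume "x \<in> relators"
  then show "x \<in> carrier free"
    by (cases rule: relatorsE) (simp_all only: free_closed frag_of_free loc_closed smult_closed M.a_closed)
qed

lemma rel_subgroup: "subgroup rel free"
  unfolding rel_def by (rule F.generate_is_subgroup[OF relators_sub])

lemma rel_closed: "x \<in> rel \<Longrightarrow> x \<in> carrier free"
  using subgroup.mem_carrier[OF rel_subgroup] .

lemma rel_zero: "0 \<in> rel"
  using subgroup.one_closed[OF rel_subgroup] by simp

lemma rel_add: "x \<in> rel \<Longrightarrow> y \<in> rel \<Longrightarrow> x + y \<in> rel"
  using subgroup.m_closed[OF rel_subgroup] by simp

lemma rel_neg: "x \<in> rel \<Longrightarrow> - x \<in> rel"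
  using subgroup.m_inv_closed[OF rel_subgroup] rel_closed by fastforce

lemma rel_diff: "x \<in> rel \<Longrightarrow> y \<in> rel \<Longrightarrow> x - y \<in> rel"
  using rel_add[OF _ rel_neg] by fastforce

lemma relators_rel: "x \<in> relators \<Longrightarrow> x \<in> rel"
  unfolding rel_def by (rule generate.incl)

lemma rel_left:
  "s \<in> carrier loc \<Longrightarrow> s' \<in> carrier loc \<Longrightarrow> m \<in> carrier M \<Longrightarrow>
    frag_of (s \<oplus>\<^bsub>loc\<^esub> s', m) - frag_of (s, m) - frag_of (s', m) \<in> rel"
  by (rule relators_rel) (unfold relators_def, blast)

lemma rel_right:
  "s \<in> carrier loc \<Longrightarrow> m \<in> carrier M \<Longrightarrow> m' \<in> carrier M \<Longrightarrow>
    frag_of (s, m \<oplus>\<^bsub>M\<^esub> m') - frag_of (s, m) - frag_of (s, m') \<in> rel"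
  by (rule relators_rel) (unfold relators_def, blast)

lemma rel_scalar:
  "r \<in> carrier R \<Longrightarrow> s \<in> carrier loc \<Longrightarrow> m \<in> carrier M \<Longrightarrow>
    frag_of (r \<odot>\<^bsub>loc\<^esub> s, m) - frag_of (s, r \<odot>\<^bsub>M\<^esub> m) \<in> rel"
  by (rule relators_rel) (unfold relators_def, blast)

text \<open>One rule for differences covers the inverses and products of \<open>generate\<close>,
  which fits properties preserved by additive maps.\<close>

lemma rel_induct [consumes 1, case_names zero relator diff]:
  assumes "x \<in> rel" and "P 0" and "\<And>x. x \<in> relators \<Longrightarrow> P x"
    and "\<And>x y. x \<in> carrier free \<Longrightarrow> y \<in> carrier free \<Longrightarrow> P x \<Longrightarrow> P y \<Longrightarrow> P (x - y)"
  shows "P x"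
proof -
  have neg: "P (- x)" if "P x" "x \<in> carrier free" for x
    using assms(4)[of 0 x] assms(2) that by simp
  have "x \<in> carrier free \<and> P x" using assms(1) unfolding rel_def
  proof induction
    case (inv h)
    then have "h \<in> carrier free" using relators_sub by blast
    then show ?case using neg[OF assms(3)[OF inv]] by simp
  next
    case (eng x y)
    then show ?case using assms(4)[of x "- y"] neg[of y] by (metis F.m_closed diff_minus_eq_add free_closed(4) mult_free_Abelian_group)
  next
    case one
    show ?case using assms(2) by simp
  next
    case (incl h)
    then show ?case using assms(3)[OF incl] relators_sub by blast
  qed
  then show ?thesis ..
qed

lemma mem_cls: "x \<in> carrier free \<Longrightarrow> y \<in> cls x \<longleftrightarrow> y - x \<in> rel"
  unfolding tensor_class_def r_coset_def by (force simp: image_iff)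

lemma cls_eq:
  assumes "x \<in> carrier free" "y \<in> carrier free"
  shows "cls x = cls y \<longleftrightarrow> x - y \<in> rel"
proof
  assume "cls x = cls y"
  moreover have "x \<in> cls x" using assms rel_zero by (simp only: mem_cls) simp
  ultimately show "x - y \<in> rel" using assms mem_cls by blast
next
  assume "x - y \<in> rel"
  then have "x \<in> cls y" using assms mem_cls by blast
  then show "cls x = cls y"
    using F.repr_independence[OF _ assms(2) rel_subgroup] unfolding tensor_class_def by blast
qed

abbreviation "tens \<equiv> tensor R loc M"

lemma tensor_carrier: "carrier tens = cls ` carrier free"
  unfolding tensor_def Let_def tensor_class_def by (simp add: carrier_FactGroup)

lemma rel_normal: "rel \<lhd> free"
  by (rule F.subgroup_imp_normal[OF rel_subgroup])

lemma tensor_add: "x \<in> carrier free \<Longrightarrow> y \<in> carrier free \<Longrightarrow> cls x \<oplus>\<^bsub>tens\<^esub> cls y = cls (x + y)"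
  using normal.rcos_sum[OF rel_normal, of x y] unfolding tensor_def Let_def tensor_class_def by simp

lemma tensor_abelian_group: "abelian_group tens"
proof -
  interpret Q: comm_group "free Mod rel" by (rule F.abelian_FactGroup[OF rel_subgroup])
  have e: "carrier tens = carrier (free Mod rel)" "ring.add tens = monoid.mult (free Mod rel)"
    "\<zero>\<^bsub>tens\<^esub> = \<one>\<^bsub>free Mod rel\<^esub>"
    by (simp_all add: tensor_def Let_def)
  show ?thesis
  proof (rule abelian_groupI, unfold e)
    show "\<exists>y\<in>carrier (free Mod rel). y \<otimes>\<^bsub>free Mod rel\<^esub> x = \<one>\<^bsub>free Mod rel\<^esub>"
      if "x \<in> carrier (free Mod rel)" for x
      using Q.l_inv[OF that] Q.inv_closed[OF that] by blast
  qed (rule Q.m_closed Q.one_closed Q.m_assoc Q.m_comm Q.l_one; assumption)+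
qed

lemma cls_zero: "cls 0 = \<zero>\<^bsub>tens\<^esub>"
  using F.coset_mult_one[OF subgroup.subset[OF rel_subgroup]]
  unfolding tensor_class_def by (simp add: tensor_def Let_def)

sublocale tensor: abelian_group tens by (rule tensor_abelian_group)

text \<open>The tensor \<open>1/s \<otimes> m\<close>, to be thought of as \<open>m/s\<close>: by
  \<open>tensor_elim\<close> every element has this form, and \<open>frac_eqD\<close> is the usual
  consequence of equality of fractions.\<close>

definition frac :: "'r \<Rightarrow> 'm \<Rightarrow> (('r \<times> 'r) set \<times> 'm \<Rightarrow>\<^sub>0 int) set" where
  "frac s m = cls (frag_of (fraction R T \<one> s, m))"

lemma frac_closed [simp]: "s \<in> T \<Longrightarrow> m \<in> carrier M \<Longrightarrow> frac s m \<in> carrier tens"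
  unfolding frac_def tensor_carrier by (rule imageI) (simp only: frag_of_free, simp)

lemma cls_frag_of:
  assumes "a \<in> carrier R" "s \<in> T" "m \<in> carrier M"
  shows "cls (frag_of (fraction R T a s, m)) = frac s (a \<odot>\<^bsub>M\<^esub> m)"
proof -
  have "frag_of (a \<odot>\<^bsub>loc\<^esub> fraction R T \<one> s, m) - frag_of (fraction R T \<one> s, a \<odot>\<^bsub>M\<^esub> m) \<in> rel"
    using assms by (intro rel_scalar) auto
  then show ?thesis unfolding frac_def using assms
    by (subst cls_eq) (simp_all only: frag_of_free, simp_all)
qed

lemma frac_cancel: "s \<in> T \<Longrightarrow> t \<in> T \<Longrightarrow> m \<in> carrier M \<Longrightarrow> frac (s \<otimes> t) (t \<odot>\<^bsub>M\<^esub> m) = frac s m"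
  using cls_frag_of[of t "s \<otimes> t" m] fraction_eq_iff[of t "s \<otimes> t" \<one> s] unfolding frac_def by (simp add: m_comm)

lemma frac_add_same:
  assumes "s \<in> T" "m \<in> carrier M" "n \<in> carrier M"
  shows "frac s m \<oplus>\<^bsub>tens\<^esub> frac s n = frac s (m \<oplus>\<^bsub>M\<^esub> n)"
proof -
  let ?q = "fraction R T \<one> s"
  have f: "frag_of (?q, m) \<in> carrier free" "frag_of (?q, n) \<in> carrier free" "frag_of (?q, m \<oplus>\<^bsub>M\<^esub> n) \<in> carrier free"
    unfolding frag_of_free using assms by simp_all
  have "frag_of (?q, m \<oplus>\<^bsub>M\<^esub> n) - frag_of (?q, m) - frag_of (?q, n) \<in> rel"
    using assms by (intro rel_right) auto
  then have "frag_of (?q, m \<oplus>\<^bsub>M\<^esub> n) - (frag_of (?q, m) + frag_of (?q, n)) \<in> rel"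
    by (simp only: diff_diff_add)
  then show ?thesis unfolding frac_def tensor_add[OF f(1,2)]
    using cls_eq[OF f(3) free_closed(2)[OF f(1,2)]] by blast
qed

lemma frac_add:
  assumes "s \<in> T" "t \<in> T" "m \<in> carrier M" "n \<in> carrier M"
  shows "frac s m \<oplus>\<^bsub>tens\<^esub> frac t n = frac (s \<otimes> t) (t \<odot>\<^bsub>M\<^esub> m \<oplus>\<^bsub>M\<^esub> s \<odot>\<^bsub>M\<^esub> n)"
proof -
  have "frac s m = frac (s \<otimes> t) (t \<odot>\<^bsub>M\<^esub> m)" using frac_cancel[of s t m] assms by blast
  moreover have "frac t n = frac (s \<otimes> t) (s \<odot>\<^bsub>M\<^esub> n)"
    using frac_cancel[of t s n] assms m_comm[of t s] by simp
  ultimately show ?thesis using assms by (simp add: frac_add_same)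
qed

lemma frac_zero:
  assumes "s \<in> T"
  shows "frac s \<zero>\<^bsub>M\<^esub> = \<zero>\<^bsub>tens\<^esub>"
proof -
  have z: "frac s \<zero>\<^bsub>M\<^esub> \<in> carrier tens" using assms by simp
  have "frac s \<zero>\<^bsub>M\<^esub> \<oplus>\<^bsub>tens\<^esub> frac s \<zero>\<^bsub>M\<^esub> = frac s \<zero>\<^bsub>M\<^esub>"
    using frac_add_same[OF assms M.zero_closed M.zero_closed] by simp
  then show ?thesis using tensor.r_neg1[OF z z] tensor.l_neg[OF z] by simp
qed

lemma frac_minus:
  assumes "s \<in> T" "m \<in> carrier M"
  shows "\<ominus>\<^bsub>tens\<^esub> frac s m = frac s (\<ominus>\<^bsub>M\<^esub> m)"
proof (rule tensor.minus_equality)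
  show "frac s (\<ominus>\<^bsub>M\<^esub> m) \<oplus>\<^bsub>tens\<^esub> frac s m = \<zero>\<^bsub>tens\<^esub>"
    using assms frac_add_same[of s "\<ominus>\<^bsub>M\<^esub> m" m] frac_zero by (simp add: M.l_neg)
qed (use assms in auto)

text \<open>Induction over formal sums: two fractions with denominators \<open>s\<close> and
  \<open>t\<close> are combined over \<open>s t\<close>.\<close>

lemma tensor_elim:
  assumes "x \<in> carrier tens"
  obtains s m where "s \<in> T" "m \<in> carrier M" "x = frac s m"
proof -
  obtain y where y: "Poly_Mapping.keys y \<subseteq> carrier loc \<times> carrier M" "x = cls y"
    using assms unfolding tensor_carrier by auto
  have "\<exists>s\<in>T. \<exists>m\<in>carrier M. cls y = frac s m"
    using y(1)
  proof (induction y rule: free_Abelian_group_induct[consumes 1, case_names zero diff frag])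
    case zero
    show ?case unfolding cls_zero using frac_zero[OF one_T] M.zero_closed one_T by force
  next
    case (diff x y)
    then obtain s m t n where st: "s \<in> T" "m \<in> carrier M" "cls x = frac s m" "t \<in> T" "n \<in> carrier M" "cls y = frac t n" by blast
    have xy: "x \<in> carrier free" "y \<in> carrier free" "x - y \<in> carrier free" using diff free_closed(3)[of x y] by auto
    have c: "cls x \<in> carrier tens" "cls y \<in> carrier tens" "cls (x - y) \<in> carrier tens"
      unfolding tensor_carrier using xy by blast+
    have "cls x = cls (x - y) \<oplus>\<^bsub>tens\<^esub> cls y" using tensor_add[OF xy(3,2)] by simp
    then have "cls (x - y) = cls x \<oplus>\<^bsub>tens\<^esub> \<ominus>\<^bsub>tens\<^esub> cls y"
      using c by (simp add: tensor.a_assoc tensor.r_neg)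
    then have "cls (x - y) = frac (s \<otimes> t) (t \<odot>\<^bsub>M\<^esub> m \<oplus>\<^bsub>M\<^esub> s \<odot>\<^bsub>M\<^esub> (\<ominus>\<^bsub>M\<^esub> n))"
      using st by (simp add: frac_minus frac_add)
    then show ?case using st by (intro bexI[of _ "s \<otimes> t"] bexI[of _ "t \<odot>\<^bsub>M\<^esub> m \<oplus>\<^bsub>M\<^esub> s \<odot>\<^bsub>M\<^esub> (\<ominus>\<^bsub>M\<^esub> n)"]) auto
  next
    case (frag a)
    then obtain q m where "a = (q, m)" "q \<in> carrier loc" "m \<in> carrier M" by auto
    moreover obtain b s where "b \<in> carrier R" "s \<in> T" "q = fraction R T b s"
      using calculation(2) by (rule locE)
    ultimately show ?case using cls_frag_of[of b s m] smult_closed[of b m] by auto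
  qed
  then show ?thesis using that y by blast
qed

text \<open>For a common denominator \<open>d\<close> of the fractions in a formal sum \<open>x\<close>, the value \<open>d x\<close> is
  a well-defined element of \<open>M\<close>; it vanishes on the relations once \<open>d\<close> is divisible enough.\<close>

lemma frac_eq_zeroD:
  assumes s: "s \<in> T" and m: "m \<in> carrier M" and eq: "frac s m = \<zero>\<^bsub>tens\<^esub>"
  shows "\<exists>u\<in>T. u \<odot>\<^bsub>M\<^esub> m = \<zero>\<^bsub>M\<^esub>"
proof -
  \<comment> \<open>The numerator of \<open>q\<close> over the denominator \<open>d\<close>, if
    \<open>q\<close> has one, and otherwise some element of the ring. By cancellation in the domain
    it is unique whenever it exists.\<close>
  define num where "num d q = (SOME a. a \<in> carrier R \<and> ((\<exists>b\<in>carrier R. q = fraction R T b d) \<longrightarrow> q = fraction R T a d))" for d q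
  have num_spec: "num d q \<in> carrier R \<and> ((\<exists>b\<in>carrier R. q = fraction R T b d) \<longrightarrow> q = fraction R T (num d q) d)" for d q
    unfolding num_def by (rule someI_ex) blast
  have num_closed: "num d q \<in> carrier R" for d q
    using num_spec by blast
  have num: "num (s \<otimes> e) (fraction R T a s) = a \<otimes> e" if ase: "a \<in> carrier R" "s \<in> T" "e \<in> T" for a s e
  proof -
    have d: "s \<otimes> e \<in> T" and ae: "a \<otimes> e \<in> carrier R" using ase by simp_all
    have "fraction R T a s = fraction R T (a \<otimes> e) (s \<otimes> e)"
      using ase by (simp add: fraction_eq_iff m_ac)
    then have "fraction R T (num (s \<otimes> e) (fraction R T a s)) (s \<otimes> e) = fraction R T (a \<otimes> e) (s \<otimes> e)"
      using num_spec[of "s \<otimes> e" "fraction R T a s"] ae by metis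
    then have "num (s \<otimes> e) (fraction R T a s) \<otimes> (s \<otimes> e) = (a \<otimes> e) \<otimes> (s \<otimes> e)"
      unfolding fraction_eq_iff[OF num_closed d ae d] .
    then show ?thesis
      using T_cancel[OF d num_closed ae] m_comm[OF num_closed T_carr[OF d]] m_comm[OF ae T_carr[OF d]] by metis
  qed
  \<comment> \<open>For each \<open>d\<close>, the additive extension of
    \<open>(q, m) \<mapsto> num d q m\<close> to formal sums. If \<open>d\<close> is no common
    denominator, this is still a homomorphism, but its values carry no meaning.\<close>
  have ex: "\<forall>d. \<exists>h. h \<in> hom free (add_monoid M) \<and> (\<forall>x\<in>carrier loc \<times> carrier M. h (frag_of x) = num d (fst x) \<odot>\<^bsub>M\<^esub> snd x)"
  proof
    fix d
    have "(\<lambda>x. num d (fst x) \<odot>\<^bsub>M\<^esub> snd x) ` (carrier loc \<times> carrier M) \<subseteq> carrier (add_monoid M)"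
      using num_closed by auto
    then obtain h where "h \<in> hom free (add_monoid M)"
      "\<And>x. x \<in> carrier loc \<times> carrier M \<Longrightarrow> h (frag_of x) = num d (fst x) \<odot>\<^bsub>M\<^esub> snd x"
      by (rule comm_group.free_Abelian_group_universal[OF M.a_comm_group]) blast
    then show "\<exists>h. h \<in> hom free (add_monoid M) \<and> (\<forall>x\<in>carrier loc \<times> carrier M. h (frag_of x) = num d (fst x) \<odot>\<^bsub>M\<^esub> snd x)"
      by blast
  qed
  obtain h where hh: "\<forall>d. h d \<in> hom free (add_monoid M) \<and> (\<forall>x\<in>carrier loc \<times> carrier M. h d (frag_of x) = num d (fst x) \<odot>\<^bsub>M\<^esub> snd x)"
    using choice[OF ex] by (elim exE)
  have h: "h d \<in> hom free (add_monoid M)" for d using hh by blast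
  have hf: "h d (frag_of (q, m)) = num d q \<odot>\<^bsub>M\<^esub> m" if "d \<in> T" "q \<in> carrier loc" "m \<in> carrier M" for d q m
  proof -
    have "(q, m) \<in> carrier loc \<times> carrier M" using that by simp
    then show ?thesis using spec[OF hh, of d] by fastforce
  qed
  have hc: "h d x \<in> carrier M" if "d \<in> T" "x \<in> carrier free" for d x
    using hom_in_carrier[OF h that(2)] by simp
  have hadd: "h d (x + y) = h d x \<oplus>\<^bsub>M\<^esub> h d y" if "d \<in> T" "x \<in> carrier free" "y \<in> carrier free" for d x y
    using hom_mult[OF h that(2,3)] by simp
  have hdiff: "h d (x - y) = h d x \<oplus>\<^bsub>M\<^esub> \<ominus>\<^bsub>M\<^esub> h d y" if d: "d \<in> T" "x \<in> carrier free" "y \<in> carrier free" for d x y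
  proof -
    have xy: "x - y \<in> carrier free" using d free_closed(3) by blast
    have "h d x = h d (x - y) \<oplus>\<^bsub>M\<^esub> h d y" using hadd[OF d(1) xy d(3)] by simp
    then show ?thesis using hc[OF d(1) xy] hc[OF d(1) d(3)] by (simp add: M.a_assoc M.r_neg)
  qed
  \<comment> \<open>Vanishing is required at all multiples \<open>d e\<close>, so that two relations
    with different denominators can be evaluated at a common one.\<close>
  have "\<exists>d\<in>T. \<forall>e\<in>T. h (d \<otimes> e) x = \<zero>\<^bsub>M\<^esub>" if "x \<in> rel" for x
    using that
  proof (induction x rule: rel_induct)
    case zero
    have "h d 0 = \<zero>\<^bsub>M\<^esub>" if "d \<in> T" for d using hdiff[OF that, of 0 0] hc[OF that, of 0] by (simp add: M.r_neg)
    then show ?case by (intro bexI[of _ \<one>]) auto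
  next
    case (relator x)
    then show ?case
    proof (cases rule: relatorsE)
      case (left q q' m)
      obtain a s where "a \<in> carrier R" "s \<in> T" "q = fraction R T a s"
        using left(1) by (rule locE)
      moreover obtain b t where "b \<in> carrier R" "t \<in> T" "q' = fraction R T b t"
        using left(2) by (rule locE)
      ultimately have ab: "a \<in> carrier R" "s \<in> T" "q = fraction R T a s" "b \<in> carrier R" "t \<in> T" "q' = fraction R T b t"
        by blast+
      have "h (s \<otimes> t \<otimes> e) x = \<zero>\<^bsub>M\<^esub>" if e: "e \<in> T" for e
      proof -
        have d: "s \<otimes> t \<otimes> e \<in> T" using ab e by simp
        have "num (s \<otimes> t \<otimes> e) q = a \<otimes> (t \<otimes> e)" using num[of a s "t \<otimes> e"] ab e by (simp add: m_assoc)
        moreover have "num (s \<otimes> t \<otimes> e) q' = b \<otimes> (s \<otimes> e)" using num[of b t "s \<otimes> e"] ab e by (simp add: m_ac)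
        moreover have "num (s \<otimes> t \<otimes> e) (q \<oplus>\<^bsub>loc\<^esub> q') = (a \<otimes> t \<oplus> b \<otimes> s) \<otimes> e"
          using num[of "a \<otimes> t \<oplus> b \<otimes> s" "s \<otimes> t" e] ab e by simp
        ultimately have "h (s \<otimes> t \<otimes> e) x = ((a \<otimes> t \<oplus> b \<otimes> s) \<otimes> e) \<odot>\<^bsub>M\<^esub> m \<oplus>\<^bsub>M\<^esub> \<ominus>\<^bsub>M\<^esub> ((a \<otimes> (t \<otimes> e)) \<odot>\<^bsub>M\<^esub> m) \<oplus>\<^bsub>M\<^esub> \<ominus>\<^bsub>M\<^esub> ((b \<otimes> (s \<otimes> e)) \<odot>\<^bsub>M\<^esub> m)"
          unfolding left(4) using d left(1-3)
          by (simp only: hdiff hf free_closed frag_of_free loc_closed simp_thms)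
        also have "(a \<otimes> t \<oplus> b \<otimes> s) \<otimes> e = a \<otimes> (t \<otimes> e) \<oplus> b \<otimes> (s \<otimes> e)"
          using ab e by (simp add: l_distr m_assoc)
        finally show ?thesis using ab e left(3) by (simp add: smult_l_distr M.add_minus_cancel)
      qed
      then show ?thesis using ab by (intro bexI[of _ "s \<otimes> t"]) auto
    next
      case (right q m m')
      have "h (\<one> \<otimes> e) x = \<zero>\<^bsub>M\<^esub>" if e: "e \<in> T" for e
      proof -
        have e1: "\<one> \<otimes> e \<in> T" using e by simp
        have "h (\<one> \<otimes> e) x = num (\<one> \<otimes> e) q \<odot>\<^bsub>M\<^esub> (m \<oplus>\<^bsub>M\<^esub> m') \<oplus>\<^bsub>M\<^esub> \<ominus>\<^bsub>M\<^esub> (num (\<one> \<otimes> e) q \<odot>\<^bsub>M\<^esub> m) \<oplus>\<^bsub>M\<^esub> \<ominus>\<^bsub>M\<^esub> (num (\<one> \<otimes> e) q \<odot>\<^bsub>M\<^esub> m')"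
          unfolding right(4) using e1 right(1-3)
          by (simp only: hdiff hf free_closed frag_of_free M.a_closed simp_thms)
        then show ?thesis using num_closed[of "\<one> \<otimes> e" q] right(2,3)
          by (simp add: smult_r_distr M.add_minus_cancel)
      qed
      then show ?thesis by (intro bexI[of _ \<one>]) auto
    next
      case (scalar r q m)
      obtain a s where ab: "a \<in> carrier R" "s \<in> T" "q = fraction R T a s"
        using scalar(2) by (rule locE)
      have "h (s \<otimes> e) x = \<zero>\<^bsub>M\<^esub>" if e: "e \<in> T" for e
      proof -
        have d: "s \<otimes> e \<in> T" using ab e by simp
        have "num (s \<otimes> e) q = a \<otimes> e" using num ab e by simp
        moreover have "num (s \<otimes> e) (r \<odot>\<^bsub>loc\<^esub> q) = (r \<otimes> a) \<otimes> e" using num[of "r \<otimes> a" s e] ab e scalar(1) by simp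
        ultimately have "h (s \<otimes> e) x = ((r \<otimes> a) \<otimes> e) \<odot>\<^bsub>M\<^esub> m \<oplus>\<^bsub>M\<^esub> \<ominus>\<^bsub>M\<^esub> ((a \<otimes> e) \<odot>\<^bsub>M\<^esub> (r \<odot>\<^bsub>M\<^esub> m))"
          unfolding scalar(4) using d scalar(1-3)
          by (simp only: hdiff hf free_closed frag_of_free loc_closed smult_closed simp_thms)
        also have "(r \<otimes> a) \<otimes> e = (a \<otimes> e) \<otimes> r" using ab e scalar(1) by (simp add: m_ac)
        finally show ?thesis using ab e scalar by (simp add: smult_assoc1 M.r_neg)
      qed
      then show ?thesis using ab by (intro bexI[of _ s]) auto
    qed
  next
    case (diff x y)
    then obtain d d' where d: "d \<in> T" "d' \<in> T" "\<And>e. e \<in> T \<Longrightarrow> h (d \<otimes> e) x = \<zero>\<^bsub>M\<^esub>" "\<And>e. e \<in> T \<Longrightarrow> h (d' \<otimes> e) y = \<zero>\<^bsub>M\<^esub>" by blast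
    have "h (d \<otimes> d' \<otimes> e) (x - y) = \<zero>\<^bsub>M\<^esub>" if e: "e \<in> T" for e
    proof -
      have "d \<otimes> d' \<otimes> e = d \<otimes> (d' \<otimes> e)" "d \<otimes> d' \<otimes> e = d' \<otimes> (d \<otimes> e)" using d(1,2) e by (simp_all add: m_ac)
      then have "h (d \<otimes> d' \<otimes> e) x = \<zero>\<^bsub>M\<^esub>" "h (d \<otimes> d' \<otimes> e) y = \<zero>\<^bsub>M\<^esub>"
        using d(3)[of "d' \<otimes> e"] d(4)[of "d \<otimes> e"] d(1,2) e by simp_all
      moreover have "d \<otimes> d' \<otimes> e \<in> T" using d e by simp
      ultimately show ?thesis using hdiff diff by simp
    qed
    then show ?case using d by (intro bexI[of _ "d \<otimes> d'"]) auto
  qed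
  moreover have "frag_of (fraction R T \<one> s, m) \<in> rel"
  proof -
    have f: "frag_of (fraction R T \<one> s, m) \<in> carrier free" unfolding frag_of_free using s m by simp
    then show ?thesis using eq cls_eq[OF f free_closed(1)] cls_zero unfolding frac_def by simp
  qed
  ultimately obtain d where d: "d \<in> T" "\<And>e. e \<in> T \<Longrightarrow> h (d \<otimes> e) (frag_of (fraction R T \<one> s, m)) = \<zero>\<^bsub>M\<^esub>" by blast
  \<comment> \<open>Over the denominator \<open>d s\<close> the fraction \<open>1/s\<close> has
    numerator \<open>d\<close>, so \<open>d\<close> itself annihilates \<open>m\<close>.\<close>
  have "num (d \<otimes> s) (fraction R T \<one> s) = d"
    using num[of \<one> s d] s d by (simp add: m_comm)
  then have "h (d \<otimes> s) (frag_of (fraction R T \<one> s, m)) = d \<odot>\<^bsub>M\<^esub> m"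
    using hf[of "d \<otimes> s" "fraction R T \<one> s" m] s d m by simp
  then show ?thesis using d s by metis
qed

lemma frac_eqD:
  assumes "s \<in> T" "t \<in> T" "m \<in> carrier M" "n \<in> carrier M" "frac s m = frac t n"
  shows "\<exists>u\<in>T. (u \<otimes> t) \<odot>\<^bsub>M\<^esub> m = (u \<otimes> s) \<odot>\<^bsub>M\<^esub> n"
proof -
  have "frac (s \<otimes> t) (t \<odot>\<^bsub>M\<^esub> m \<oplus>\<^bsub>M\<^esub> s \<odot>\<^bsub>M\<^esub> (\<ominus>\<^bsub>M\<^esub> n)) = \<zero>\<^bsub>tens\<^esub>"
    using assms by (simp flip: frac_add frac_minus add: tensor.r_neg)
  then have "\<exists>u\<in>T. u \<odot>\<^bsub>M\<^esub> (t \<odot>\<^bsub>M\<^esub> m \<oplus>\<^bsub>M\<^esub> s \<odot>\<^bsub>M\<^esub> (\<ominus>\<^bsub>M\<^esub> n)) = \<zero>\<^bsub>M\<^esub>"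
    using assms by (intro frac_eq_zeroD[of "s \<otimes> t"]) auto
  then obtain u where u: "u \<in> T" "u \<odot>\<^bsub>M\<^esub> (t \<odot>\<^bsub>M\<^esub> m \<oplus>\<^bsub>M\<^esub> s \<odot>\<^bsub>M\<^esub> (\<ominus>\<^bsub>M\<^esub> n)) = \<zero>\<^bsub>M\<^esub>"
    by blast
  then have "(u \<otimes> t) \<odot>\<^bsub>M\<^esub> m \<oplus>\<^bsub>M\<^esub> \<ominus>\<^bsub>M\<^esub> ((u \<otimes> s) \<odot>\<^bsub>M\<^esub> n) = \<zero>\<^bsub>M\<^esub>"
    using assms by (simp add: smult_r_distr smult_r_minus smult_assoc1)
  then have "(u \<otimes> t) \<odot>\<^bsub>M\<^esub> m = (u \<otimes> s) \<odot>\<^bsub>M\<^esub> n"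
    using assms u by (metis M.minus_equality M.minus_minus M.a_inv_closed T_carr T_mult smult_closed)
  then show ?thesis using u by blast
qed

end

section \<open>Composition in the scalar extension\<close>

lemma frag_extend_fun_diff: "frag_extend (\<lambda>x. f x - g x) c = frag_extend f c - frag_extend g c"
proof -
  have "Poly_Mapping.keys c \<subseteq> UNIV" by simp
  then show ?thesis
    by (induction c rule: frag_induction) (simp_all add: frag_extend_diff)
qed

text \<open>The double sum inside \<open>Comp\<close> of \<open>scalar_extension\<close>, on
  representatives and before classes are taken.\<close>

definition bilinear_extend where
  "bilinear_extend S Cmp v u = frag_extend (\<lambda>(s, g). frag_extend (\<lambda>(t, f). frag_of (s \<otimes>\<^bsub>S\<^esub> t, Cmp g f)) u) v"

lemma bilinear_extend_simps:
  "bilinear_extend S Cmp (v - v') u = bilinear_extend S Cmp v u - bilinear_extend S Cmp v' u"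
  "bilinear_extend S Cmp v (u - u') = bilinear_extend S Cmp v u - bilinear_extend S Cmp v u'"
  "bilinear_extend S Cmp 0 u = 0" "bilinear_extend S Cmp v 0 = 0"
  "bilinear_extend S Cmp (frag_of (s, g)) (frag_of (t, f)) = frag_of (s \<otimes>\<^bsub>S\<^esub> t, Cmp g f)"
  unfolding bilinear_extend_def
  by (simp_all add: frag_extend_diff frag_extend_eq_0 case_prod_unfold flip: frag_extend_fun_diff)

locale localized_category = localized_domain R T + linear_category R C
  for R :: "('r, 'x) ring_scheme" (structure) and T and C :: "('o, 'r, 'm) category"
begin

lemma hom_localized_module: "A \<in> Obj C \<Longrightarrow> B \<in> Obj C \<Longrightarrow> localized_module R T (Hom C A B)"
  by (intro localized_module.intro hom_module localized_domain_axioms)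

abbreviation "SE \<equiv> scalar_extension R loc C"
abbreviation "fr A B \<equiv> localized_module.frac R T (Hom C A B)"

lemma SE_simps [simp]: "Obj SE = Obj C" "Hom SE A B = tensor R loc (Hom C A B)"
  by (simp_all add: scalar_extension_def)

context
  fixes A B D assumes o [simp]: "A \<in> Obj C" "B \<in> Obj C" "D \<in> Obj C"
begin

interpretation AB: localized_module R T "Hom C A B" by (rule hom_localized_module) simp_all
interpretation BD: localized_module R T "Hom C B D" by (rule hom_localized_module) simp_all
interpretation AD: localized_module R T "Hom C A D" by (rule hom_localized_module) simp_all

abbreviation "bil \<equiv> bilinear_extend loc (Comp C A B D)"

text \<open>Composing with one generator carries each of the three kinds of relators to a relator of
  the same kind. With the mirror image on the other side and linear extension, this makes
  composition well defined modulo relations.\<close>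

lemma bil_frag_left:
  assumes q: "q \<in> carrier loc" "f \<in> Mor C A B" and v: "v \<in> BD.rel"
  shows "bil v (frag_of (q, f)) \<in> AD.rel"
  using v
proof (induction v rule: BD.rel_induct)
  case zero
  show ?case by (simp add: bilinear_extend_simps AD.rel_zero)
next
  case (relator v)
  then show ?case
  proof (cases rule: BD.relatorsE)
    case (left s s' g)
    then show ?thesis using q AD.rel_left[of "s \<otimes>\<^bsub>loc\<^esub> q" "s' \<otimes>\<^bsub>loc\<^esub> q" "Comp C A B D g f"]
      by (simp add: bilinear_extend_simps loc_distr)
  next
    case (right s g g')
    then show ?thesis using q AD.rel_right[of "s \<otimes>\<^bsub>loc\<^esub> q" "Comp C A B D g f" "Comp C A B D g' f"]
      by (simp add: bilinear_extend_simps comp_add_left)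
  next
    case (scalar r s g)
    then show ?thesis using q AD.rel_scalar[of r "s \<otimes>\<^bsub>loc\<^esub> q" "Comp C A B D g f"]
      by (simp add: bilinear_extend_simps loc_smult_mult comp_smult_left)
  qed
next
  case (diff x y)
  then show ?case by (simp add: bilinear_extend_simps AD.rel_diff)
qed

lemma bil_frag_right:
  assumes q: "q \<in> carrier loc" "g \<in> Mor C B D" and u: "u \<in> AB.rel"
  shows "bil (frag_of (q, g)) u \<in> AD.rel"
  using u
proof (induction u rule: AB.rel_induct)
  case zero
  show ?case by (simp add: bilinear_extend_simps AD.rel_zero)
next
  case (relator u)
  then show ?case
  proof (cases rule: AB.relatorsE)
    case (left s s' f)
    then show ?thesis using q AD.rel_left[of "q \<otimes>\<^bsub>loc\<^esub> s" "q \<otimes>\<^bsub>loc\<^esub> s'" "Comp C A B D g f"]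
      by (simp add: bilinear_extend_simps loc_distr)
  next
    case (right s f f')
    then show ?thesis using q AD.rel_right[of "q \<otimes>\<^bsub>loc\<^esub> s" "Comp C A B D g f" "Comp C A B D g f'"]
      by (simp add: bilinear_extend_simps comp_add_right)
  next
    case (scalar r s f)
    then show ?thesis using q AD.rel_scalar[of r "q \<otimes>\<^bsub>loc\<^esub> s" "Comp C A B D g f"]
      by (simp add: bilinear_extend_simps loc_smult_mult comp_smult_right)
  qed
next
  case (diff x y)
  then show ?case by (simp add: bilinear_extend_simps AD.rel_diff)
qed

lemma bil_rel_left:
  assumes v: "v \<in> BD.rel" and u: "u \<in> carrier AB.free"
  shows "bil v u \<in> AD.rel"
proof -
  have "Poly_Mapping.keys u \<subseteq> carrier loc \<times> carrier (Hom C A B)" using u by simp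
  then show ?thesis
  proof (induction u rule: free_Abelian_group_induct[consumes 1, case_names zero diff frag])
    case (frag a)
    then show ?case using bil_frag_left[OF _ _ v] by (cases a) simp
  qed (simp_all add: bilinear_extend_simps AD.rel_zero AD.rel_diff)
qed

lemma bil_rel_right:
  assumes u: "u \<in> AB.rel" and v: "v \<in> carrier BD.free"
  shows "bil v u \<in> AD.rel"
proof -
  have "Poly_Mapping.keys v \<subseteq> carrier loc \<times> carrier (Hom C B D)" using v by simp
  then show ?thesis
  proof (induction v rule: free_Abelian_group_induct[consumes 1, case_names zero diff frag])
    case (frag a)
    then show ?case using bil_frag_right[OF _ _ u] by (cases a) simp
  qed (simp_all add: bilinear_extend_simps AD.rel_zero AD.rel_diff)
qed

lemma bil_closed:
  assumes v: "v \<in> carrier BD.free" and u: "u \<in> carrier AB.free"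
  shows "bil v u \<in> carrier AD.free"
proof -
  have 1: "bil (frag_of (q, g)) u \<in> carrier AD.free" if q: "q \<in> carrier loc" "g \<in> Mor C B D" for q g
  proof -
    have "Poly_Mapping.keys u \<subseteq> carrier loc \<times> carrier (Hom C A B)" using u by simp
    then show ?thesis
    proof (induction u rule: free_Abelian_group_induct[consumes 1, case_names zero diff frag])
      case (diff x y)
      show ?case unfolding bilinear_extend_simps by (rule AD.free_closed(3)[OF diff(3,4)])
    next
      case (frag a)
      then obtain t f where "a = (t, f)" "t \<in> carrier loc" "f \<in> Mor C A B" by auto
      then show ?case using q by (simp only: bilinear_extend_simps AD.frag_of_free loc_closed comp_closed o simp_thms)
    qed (simp add: bilinear_extend_simps)
  qed
  have "Poly_Mapping.keys v \<subseteq> carrier loc \<times> carrier (Hom C B D)" using v by simp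
  then show ?thesis
  proof (induction v rule: free_Abelian_group_induct[consumes 1, case_names zero diff frag])
    case (diff x y)
    show ?case unfolding bilinear_extend_simps by (rule AD.free_closed(3)[OF diff(3,4)])
  next
    case (frag a)
    then obtain q g where "a = (q, g)" "q \<in> carrier loc" "g \<in> Mor C B D" by auto
    then show ?case using 1 by simp
  qed (simp add: bilinear_extend_simps)
qed

text \<open>Changing both representatives changes the value by
  \<open>bil (v' - v) u' + bil v (u' - u)\<close>, which is a relation; so the union in the
  definition runs over equal classes.\<close>

lemma SE_Comp_cls:
  assumes v: "v \<in> carrier BD.free" and u: "u \<in> carrier AB.free"
  shows "Comp SE A B D (BD.cls v) (AB.cls u) = AD.cls (bil v u)"
proof -
  have "AD.cls (bil v' u') = AD.cls (bil v u)" if vu': "v' \<in> BD.cls v" "u' \<in> AB.cls u" for v' u'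
  proof -
    have d: "v' - v \<in> BD.rel" "u' - u \<in> AB.rel" using vu' v u BD.mem_cls AB.mem_cls by blast+
    have v': "v' \<in> carrier BD.free" using BD.free_closed(2)[OF BD.rel_closed[OF d(1)] v] by (simp only: diff_add_cancel)
    have u': "u' \<in> carrier AB.free" using AB.free_closed(2)[OF AB.rel_closed[OF d(2)] u] by (simp only: diff_add_cancel)
    have "bil (v' - v) u' + bil v (u' - u) \<in> AD.rel"
      by (rule AD.rel_add[OF bil_rel_left[OF d(1) u'] bil_rel_right[OF d(2) v]])
    then have "bil v' u' - bil v u \<in> AD.rel" by (simp add: bilinear_extend_simps)
    then show ?thesis using AD.cls_eq[OF bil_closed[OF v' u'] bil_closed[OF v u]] by blast
  qed
  moreover have "v \<in> BD.cls v" using BD.mem_cls[OF v] BD.rel_zero by simp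
  moreover have "u \<in> AB.cls u" using AB.mem_cls[OF u] AB.rel_zero by simp
  ultimately have "(\<Union>v\<in>BD.cls v. \<Union>u\<in>AB.cls u. AD.cls (bil v u)) = AD.cls (bil v u)"
    by blast
  then show ?thesis by (simp add: scalar_extension_def bilinear_extend_def)
qed

lemma SE_Comp_fr:
  assumes "s \<in> T" "t \<in> T" "g \<in> Mor C B D" "f \<in> Mor C A B"
  shows "Comp SE A B D (fr B D s g) (fr A B t f) = fr A D (s \<otimes> t) (Comp C A B D g f)"
proof -
  have "frag_of (fraction R T \<one> s, g) \<in> carrier BD.free" "frag_of (fraction R T \<one> t, f) \<in> carrier AB.free"
    unfolding BD.frag_of_free AB.frag_of_free using assms by simp_all
  from SE_Comp_cls[OF this] show ?thesis
    unfolding BD.frac_def AB.frac_def AD.frac_def using assms by (simp add: bilinear_extend_simps)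
qed

end

lemma SE_Ident: "A \<in> Obj C \<Longrightarrow> Ident SE A = fr A A \<one> (Ident C A)"
  unfolding localized_module.frac_def[OF hom_localized_module]
  by (simp add: scalar_extension_def loc_one)

lemma SE_fr_closed [simp]:
  "A \<in> Obj C \<Longrightarrow> B \<in> Obj C \<Longrightarrow> s \<in> T \<Longrightarrow> f \<in> Mor C A B \<Longrightarrow> fr A B s f \<in> carrier (tensor R loc (Hom C A B))"
  using localized_module.frac_closed[OF hom_localized_module] .

lemma SE_elim:
  assumes "A \<in> Obj C" "B \<in> Obj C" "F \<in> carrier (tensor R loc (Hom C A B))"
  obtains s f where "s \<in> T" "f \<in> Mor C A B" "F = fr A B s f"
  using localized_module.tensor_elim[OF hom_localized_module[OF assms(1,2)] assms(3)] .

lemma SE_fr_add: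
  "A \<in> Obj C \<Longrightarrow> B \<in> Obj C \<Longrightarrow> s \<in> T \<Longrightarrow> t \<in> T \<Longrightarrow> f \<in> Mor C A B \<Longrightarrow> g \<in> Mor C A B \<Longrightarrow>
    fr A B s f \<oplus>\<^bsub>tensor R loc (Hom C A B)\<^esub> fr A B t g = fr A B (s \<otimes> t) (t \<odot>\<^bsub>Hom C A B\<^esub> f \<oplus>\<^bsub>Hom C A B\<^esub> s \<odot>\<^bsub>Hom C A B\<^esub> g)"
  using localized_module.frac_add[OF hom_localized_module] .

lemma SE_fr_cancel:
  "A \<in> Obj C \<Longrightarrow> B \<in> Obj C \<Longrightarrow> s \<in> T \<Longrightarrow> t \<in> T \<Longrightarrow> f \<in> Mor C A B \<Longrightarrow>
    fr A B (s \<otimes> t) (t \<odot>\<^bsub>Hom C A B\<^esub> f) = fr A B s f"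
  using localized_module.frac_cancel[OF hom_localized_module] .

text \<open>With every morphism written as a single fraction, each axiom is that of \<open>C\<close>
  with denominators multiplied.\<close>

lemma scalar_extension_preadditive: "preadditive_category SE"
proof (rule preadditive_category.intro, unfold SE_simps)
  show "abelian_group (tensor R loc (Hom C A B))" if "A \<in> Obj C" "B \<in> Obj C" for A B
    using localized_module.tensor_abelian_group[OF hom_localized_module[OF that]] .
  show "Comp SE A B D G F \<in> carrier (tensor R loc (Hom C A D))"
    if o: "A \<in> Obj C" "B \<in> Obj C" "D \<in> Obj C" and m: "F \<in> carrier (tensor R loc (Hom C A B))" "G \<in> carrier (tensor R loc (Hom C B D))" for A B D F G
  proof -
    obtain t f where f: "t \<in> T" "f \<in> Mor C A B" "F = fr A B t f" using SE_elim[OF o(1,2) m(1)] .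
    obtain s g where g: "s \<in> T" "g \<in> Mor C B D" "G = fr B D s g" using SE_elim[OF o(2,3) m(2)] .
    show ?thesis using o f g by (simp add: SE_Comp_fr)
  qed
  show "Comp SE A D E H (Comp SE A B D G F) = Comp SE A B E (Comp SE B D E H G) F"
    if o: "A \<in> Obj C" "B \<in> Obj C" "D \<in> Obj C" "E \<in> Obj C" and m: "F \<in> carrier (tensor R loc (Hom C A B))" "G \<in> carrier (tensor R loc (Hom C B D))"
      "H \<in> carrier (tensor R loc (Hom C D E))" for A B D E F G H
  proof -
    obtain t f where f: "t \<in> T" "f \<in> Mor C A B" "F = fr A B t f" using SE_elim[OF o(1,2) m(1)] .
    obtain s g where g: "s \<in> T" "g \<in> Mor C B D" "G = fr B D s g" using SE_elim[OF o(2,3) m(2)] .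
    obtain r h where h: "r \<in> T" "h \<in> Mor C D E" "H = fr D E r h" using SE_elim[OF o(3,4) m(3)] .
    show ?thesis using o f g h by (simp add: SE_Comp_fr comp_assoc m_assoc)
  qed
  show "Ident SE A \<in> carrier (tensor R loc (Hom C A A))" if "A \<in> Obj C" for A
    using that by (simp add: SE_Ident)
  show "Comp SE A B B (Ident SE B) F = F"
    if o: "A \<in> Obj C" "B \<in> Obj C" and m: "F \<in> carrier (tensor R loc (Hom C A B))" for A B F
  proof -
    obtain t f where f: "t \<in> T" "f \<in> Mor C A B" "F = fr A B t f" using SE_elim[OF o(1,2) m(1)] .
    show ?thesis using o f by (simp add: SE_Comp_fr SE_Ident)
  qed
  show "Comp SE A A B F (Ident SE A) = F"
    if o: "A \<in> Obj C" "B \<in> Obj C" and m: "F \<in> carrier (tensor R loc (Hom C A B))" for A B F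
  proof -
    obtain t f where f: "t \<in> T" "f \<in> Mor C A B" "F = fr A B t f" using SE_elim[OF o(1,2) m(1)] .
    show ?thesis using o f by (simp add: SE_Comp_fr SE_Ident)
  qed
  show "Comp SE A B D (G \<oplus>\<^bsub>tensor R loc (Hom C B D)\<^esub> G') F = Comp SE A B D G F \<oplus>\<^bsub>tensor R loc (Hom C A D)\<^esub> Comp SE A B D G' F"
    if o: "A \<in> Obj C" "B \<in> Obj C" "D \<in> Obj C" and m: "F \<in> carrier (tensor R loc (Hom C A B))" "G \<in> carrier (tensor R loc (Hom C B D))"
      "G' \<in> carrier (tensor R loc (Hom C B D))" for A B D F G G'
  proof -
    obtain t f where f: "t \<in> T" "f \<in> Mor C A B" "F = fr A B t f" using SE_elim[OF o(1,2) m(1)] .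
    obtain s g where g: "s \<in> T" "g \<in> Mor C B D" "G = fr B D s g" using SE_elim[OF o(2,3) m(2)] .
    obtain s' g' where g': "s' \<in> T" "g' \<in> Mor C B D" "G' = fr B D s' g'" using SE_elim[OF o(2,3) m(3)] .
    let ?z = "s' \<odot>\<^bsub>Hom C A D\<^esub> Comp C A B D g f \<oplus>\<^bsub>Hom C A D\<^esub> s \<odot>\<^bsub>Hom C A D\<^esub> Comp C A B D g' f"
    have "Comp SE A B D (G \<oplus>\<^bsub>tensor R loc (Hom C B D)\<^esub> G') F = fr A D (s \<otimes> s' \<otimes> t) ?z"
      using o f g g' by (simp add: SE_fr_add SE_Comp_fr comp_add_left comp_smult_left)
    \<comment> \<open>One more factor \<open>t\<close>: the two composites on the other side have
      denominators \<open>s t\<close> and \<open>s' t\<close>, whose product contains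
      \<open>t\<close> twice.\<close>
    also have "\<dots> = fr A D (s \<otimes> s' \<otimes> t \<otimes> t) (t \<odot>\<^bsub>Hom C A D\<^esub> ?z)"
      using o f g g' by (intro SE_fr_cancel[symmetric]) simp_all
    also have "\<dots> = Comp SE A B D G F \<oplus>\<^bsub>tensor R loc (Hom C A D)\<^esub> Comp SE A B D G' F"
      using o f g g' by (simp add: SE_fr_add SE_Comp_fr hom_smult_r_distr hom_smult_assoc m_ac)
    finally show ?thesis .
  qed
  show "Comp SE A B D G (F \<oplus>\<^bsub>tensor R loc (Hom C A B)\<^esub> F') = Comp SE A B D G F \<oplus>\<^bsub>tensor R loc (Hom C A D)\<^esub> Comp SE A B D G F'"
    if o: "A \<in> Obj C" "B \<in> Obj C" "D \<in> Obj C" and m: "F \<in> carrier (tensor R loc (Hom C A B))" "F' \<in> carrier (tensor R loc (Hom C A B))"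
      "G \<in> carrier (tensor R loc (Hom C B D))" for A B D F F' G
  proof -
    obtain s f where f: "s \<in> T" "f \<in> Mor C A B" "F = fr A B s f" using SE_elim[OF o(1,2) m(1)] .
    obtain s' f' where f': "s' \<in> T" "f' \<in> Mor C A B" "F' = fr A B s' f'" using SE_elim[OF o(1,2) m(2)] .
    obtain t g where g: "t \<in> T" "g \<in> Mor C B D" "G = fr B D t g" using SE_elim[OF o(2,3) m(3)] .
    let ?z = "s' \<odot>\<^bsub>Hom C A D\<^esub> Comp C A B D g f \<oplus>\<^bsub>Hom C A D\<^esub> s \<odot>\<^bsub>Hom C A D\<^esub> Comp C A B D g f'"
    have "Comp SE A B D G (F \<oplus>\<^bsub>tensor R loc (Hom C A B)\<^esub> F') = fr A D (t \<otimes> (s \<otimes> s')) ?z"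
      using o f f' g by (simp add: SE_fr_add SE_Comp_fr comp_add_right comp_smult_right)
    also have "\<dots> = fr A D (t \<otimes> (s \<otimes> s') \<otimes> t) (t \<odot>\<^bsub>Hom C A D\<^esub> ?z)"
      using o f f' g by (intro SE_fr_cancel[symmetric]) simp_all
    also have "\<dots> = Comp SE A B D G F \<oplus>\<^bsub>tensor R loc (Hom C A D)\<^esub> Comp SE A B D G F'"
      using o f f' g by (simp add: SE_fr_add SE_Comp_fr hom_smult_r_distr hom_smult_assoc m_ac)
    finally show ?thesis .
  qed
qed

section \<open>Clearing denominators in identities of the scalar extension\<close>

lemma SE_Comp_eq_Ident:
  assumes "A \<in> Obj C" "B \<in> Obj C" "s \<in> T" "t \<in> T" "g \<in> Mor C B A" "f \<in> Mor C A B"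
    and "Comp SE A B A (fr B A s g) (fr A B t f) = Ident SE A"
  shows "\<exists>u\<in>T. u \<odot>\<^bsub>Hom C A A\<^esub> Comp C A B A g f = (u \<otimes> (s \<otimes> t)) \<odot>\<^bsub>Hom C A A\<^esub> Ident C A"
  using localized_module.frac_eqD[OF hom_localized_module[OF assms(1,1)], of "s \<otimes> t" \<one> "Comp C A B A g f" "Ident C A"] assms
  by (simp add: SE_Comp_fr SE_Ident)

text \<open>Both maps are replaced by their numerators; the factor \<open>u\<close> that makes the
  identity hold in \<open>C\<close> despite torsion is absorbed into \<open>g\<close>.\<close>

lemma retract_scalar_extension:
  assumes o: "A \<in> Obj C" "B \<in> Obj C"
    and "F \<in> Mor SE A B" "G \<in> Mor SE B A" "Comp SE A B A G F = Ident SE A"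
  shows "\<exists>f\<in>Mor C A B. \<exists>g\<in>Mor C B A. \<exists>s\<in>T. Comp C A B A g f = s \<odot>\<^bsub>Hom C A A\<^esub> Ident C A"
proof -
  obtain t f where f: "t \<in> T" "f \<in> Mor C A B" "F = fr A B t f" using SE_elim[OF o] assms(3) by auto
  obtain s g where g: "s \<in> T" "g \<in> Mor C B A" "G = fr B A s g" using SE_elim[OF o(2,1)] assms(4) by auto
  obtain u where u: "u \<in> T" "u \<odot>\<^bsub>Hom C A A\<^esub> Comp C A B A g f = (u \<otimes> (s \<otimes> t)) \<odot>\<^bsub>Hom C A A\<^esub> Ident C A"
    using SE_Comp_eq_Ident[OF o g(1) f(1) g(2) f(2)] assms(5) f g by blast
  then show ?thesis using o f g
    by (intro bexI[of _ f] bexI[of _ "u \<odot>\<^bsub>Hom C B A\<^esub> g"] bexI[of _ "u \<otimes> (s \<otimes> t)"]) (simp_all add: comp_smult_left)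
qed

text \<open>The two composites produce different clearing factors \<open>u\<close> and
  \<open>w\<close>; multiplying \<open>g\<close> by \<open>w u\<close> serves both, with the common
  scalar \<open>w u s t\<close>.\<close>

lemma isomorphic_scalar_extension:
  assumes o: "A \<in> Obj C" "B \<in> Obj C"
  shows "isomorphic_objs SE A B \<longleftrightarrow> (\<exists>f\<in>Mor C A B. \<exists>g\<in>Mor C B A. \<exists>s\<in>T.
    Comp C A B A g f = s \<odot>\<^bsub>Hom C A A\<^esub> Ident C A \<and> Comp C B A B f g = s \<odot>\<^bsub>Hom C B B\<^esub> Ident C B)"
proof
  assume "isomorphic_objs SE A B"
  then obtain F G where FG: "F \<in> Mor SE A B" "G \<in> Mor SE B A" "Comp SE A B A G F = Ident SE A" "Comp SE B A B F G = Ident SE B"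
    unfolding isomorphic_objs_def by blast
  obtain t f where f: "t \<in> T" "f \<in> Mor C A B" "F = fr A B t f" using SE_elim[OF o] FG(1) by auto
  obtain s g where g: "s \<in> T" "g \<in> Mor C B A" "G = fr B A s g" using SE_elim[OF o(2,1)] FG(2) by auto
  obtain u where u: "u \<in> T" "u \<odot>\<^bsub>Hom C A A\<^esub> Comp C A B A g f = (u \<otimes> (s \<otimes> t)) \<odot>\<^bsub>Hom C A A\<^esub> Ident C A"
    using SE_Comp_eq_Ident[OF o g(1) f(1) g(2) f(2)] FG(3) f g by blast
  obtain w where w: "w \<in> T" "w \<odot>\<^bsub>Hom C B B\<^esub> Comp C B A B f g = (w \<otimes> (t \<otimes> s)) \<odot>\<^bsub>Hom C B B\<^esub> Ident C B"
    using SE_Comp_eq_Ident[OF o(2,1) f(1) g(1) f(2) g(2)] FG(4) f g by blast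
  have "(w \<otimes> u) \<odot>\<^bsub>Hom C A A\<^esub> Comp C A B A g f = (w \<otimes> u \<otimes> (s \<otimes> t)) \<odot>\<^bsub>Hom C A A\<^esub> Ident C A"
  proof -
    have "(w \<otimes> u) \<odot>\<^bsub>Hom C A A\<^esub> Comp C A B A g f = w \<odot>\<^bsub>Hom C A A\<^esub> (u \<odot>\<^bsub>Hom C A A\<^esub> Comp C A B A g f)"
      using o f g u(1) w(1) by (simp add: hom_smult_assoc)
    then show ?thesis unfolding u(2) using o f g u(1) w(1) by (simp add: hom_smult_assoc m_assoc)
  qed
  moreover have "(w \<otimes> u) \<odot>\<^bsub>Hom C B B\<^esub> Comp C B A B f g = (w \<otimes> u \<otimes> (s \<otimes> t)) \<odot>\<^bsub>Hom C B B\<^esub> Ident C B"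
  proof -
    have "(w \<otimes> u) \<odot>\<^bsub>Hom C B B\<^esub> Comp C B A B f g = u \<odot>\<^bsub>Hom C B B\<^esub> (w \<odot>\<^bsub>Hom C B B\<^esub> Comp C B A B f g)"
      using o f g u(1) w(1) by (simp add: hom_smult_assoc m_comm)
    then show ?thesis unfolding w(2) using o f g u(1) w(1) by (simp add: hom_smult_assoc m_ac)
  qed
  ultimately show "\<exists>f\<in>Mor C A B. \<exists>g\<in>Mor C B A. \<exists>s\<in>T.
    Comp C A B A g f = s \<odot>\<^bsub>Hom C A A\<^esub> Ident C A \<and> Comp C B A B f g = s \<odot>\<^bsub>Hom C B B\<^esub> Ident C B"
    using o f g u(1) w(1)
    by (intro bexI[of _ f] bexI[of _ "(w \<otimes> u) \<odot>\<^bsub>Hom C B A\<^esub> g"] bexI[of _ "w \<otimes> u \<otimes> (s \<otimes> t)"])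
      (simp_all add: comp_smult_left comp_smult_right)
next
  assume "\<exists>f\<in>Mor C A B. \<exists>g\<in>Mor C B A. \<exists>s\<in>T.
    Comp C A B A g f = s \<odot>\<^bsub>Hom C A A\<^esub> Ident C A \<and> Comp C B A B f g = s \<odot>\<^bsub>Hom C B B\<^esub> Ident C B"
  then obtain f g s where m: "f \<in> Mor C A B" "g \<in> Mor C B A" "s \<in> T"
    "Comp C A B A g f = s \<odot>\<^bsub>Hom C A A\<^esub> Ident C A" "Comp C B A B f g = s \<odot>\<^bsub>Hom C B B\<^esub> Ident C B" by blast
  have cancel: "fr D D s (s \<odot>\<^bsub>Hom C D D\<^esub> Ident C D) = Ident SE D" if "D \<in> Obj C" for D
    using SE_fr_cancel[of D D \<one> s "Ident C D"] that m(3) by (simp add: SE_Ident)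
  show "isomorphic_objs SE A B" unfolding isomorphic_objs_def
    using o m cancel[OF o(1)] cancel[OF o(2)]
    by (intro conjI bexI[of _ "fr A B \<one> f"] bexI[of _ "fr B A s g"]) (simp_all add: SE_Comp_fr)
qed

text \<open>All denominators and the final clearing factor are absorbed into the left factors
  \<open>x'\<close>; the right factors are just the numerators of the \<open>y k\<close>.\<close>

lemma sum_scalar_extension:
  assumes o [simp]: "A \<in> Obj C" "B \<in> Obj C"
    and xy: "\<And>k. k < (n::nat) \<Longrightarrow> x k \<in> Mor SE B A \<and> y k \<in> Mor SE A B"
    and sum: "(\<Oplus>\<^bsub>Hom SE A A\<^esub>k\<in>{..<n}. Comp SE A B A (x k) (y k)) = Ident SE A"
  shows "\<exists>x' y'. \<exists>s\<in>T. (\<forall>k<n. x' k \<in> Mor C B A \<and> y' k \<in> Mor C A B) \<and>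
    (\<Oplus>\<^bsub>Hom C A A\<^esub>k\<in>{..<n}. Comp C A B A (x' k) (y' k)) = s \<odot>\<^bsub>Hom C A A\<^esub> Ident C A"
proof -
  interpret SE: preadditive_category SE by (rule scalar_extension_preadditive)
  interpret AA: localized_module R T "Hom C A A" by (rule hom_localized_module) simp_all
  interpret SH: abelian_monoid "Hom SE A A" using SE.hom_abelian_monoid by simp
  have "\<forall>k. \<exists>s f t g. k < n \<longrightarrow> s \<in> T \<and> f \<in> Mor C B A \<and> x k = fr B A s f \<and> t \<in> T \<and> g \<in> Mor C A B \<and> y k = fr A B t g"
    using xy SE_elim[OF o] SE_elim[OF o(2,1)] by (metis SE_simps(2))
  then obtain s f t g where fg: "\<And>k. k < n \<Longrightarrow> s k \<in> T \<and> f k \<in> Mor C B A \<and> x k = fr B A (s k) (f k) \<and> t k \<in> T \<and> g k \<in> Mor C A B \<and> y k = fr A B (t k) (g k)"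
    by metis
  have scale: "a \<odot>\<^bsub>Hom C A A\<^esub> (\<Oplus>\<^bsub>Hom C A A\<^esub>k\<in>{..<m}. Comp C A B A (x' k) (g k)) =
      (\<Oplus>\<^bsub>Hom C A A\<^esub>k\<in>{..<m}. Comp C A B A (a \<odot>\<^bsub>Hom C B A\<^esub> x' k) (g k))"
    if a: "a \<in> carrier R" and x': "\<And>k. k < m \<Longrightarrow> x' k \<in> Mor C B A" and m: "m \<le> n" for a x' m
  proof -
    let ?S = "\<Oplus>\<^bsub>Hom C A A\<^esub>k\<in>{..<m}. Comp C A B A (x' k) (g k)"
    have S: "?S \<in> Mor C A A" using x' fg m by (intro hom_finsum_closed) auto
    have "a \<odot>\<^bsub>Hom C A A\<^esub> ?S = Comp C A A A (a \<odot>\<^bsub>Hom C A A\<^esub> Ident C A) ?S"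
      using S a by (simp add: comp_smult_left)
    also have "\<dots> = (\<Oplus>\<^bsub>Hom C A A\<^esub>k\<in>{..<m}. Comp C A A A (a \<odot>\<^bsub>Hom C A A\<^esub> Ident C A) (Comp C A B A (x' k) (g k)))"
      using x' fg m a by (intro comp_finsum_right) auto
    also have "\<dots> = (\<Oplus>\<^bsub>Hom C A A\<^esub>k\<in>{..<m}. Comp C A B A (a \<odot>\<^bsub>Hom C B A\<^esub> x' k) (g k))"
      using x' fg m a by (intro hom_finsum_cong) (auto simp: comp_smult_left)
    finally show ?thesis .
  qed
  have "\<exists>x'. \<exists>a\<in>T. (\<forall>k<m. x' k \<in> Mor C B A) \<and>
    (\<Oplus>\<^bsub>Hom SE A A\<^esub>k\<in>{..<m}. Comp SE A B A (x k) (y k)) = fr A A a (\<Oplus>\<^bsub>Hom C A A\<^esub>k\<in>{..<m}. Comp C A B A (x' k) (g k))"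
    if "m \<le> n" for m
    using that
  proof (induction m)
    case 0
    show ?case using AA.frac_zero[of \<one>] by (intro exI[of _ "\<lambda>_. undefined"] bexI[of _ \<one>]) auto
  next
    case (Suc m)
    then obtain x' a where x': "a \<in> T" "\<forall>k<m. x' k \<in> Mor C B A"
      and IH: "(\<Oplus>\<^bsub>Hom SE A A\<^esub>k\<in>{..<m}. Comp SE A B A (x k) (y k)) = fr A A a (\<Oplus>\<^bsub>Hom C A A\<^esub>k\<in>{..<m}. Comp C A B A (x' k) (g k))"
      by auto
    have m: "m < n" using Suc by simp
    let ?S = "\<Oplus>\<^bsub>Hom C A A\<^esub>k\<in>{..<m}. Comp C A B A (x' k) (g k)"
    have S: "?S \<in> Mor C A A" using x' fg m by (intro hom_finsum_closed) auto
    define b where "b = s m \<otimes> t m"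
    have b: "b \<in> T" unfolding b_def using fg[OF m] by simp
    \<comment> \<open>The partial sum has denominator \<open>a\<close> and the new term has
      denominator \<open>b\<close>; both are put over \<open>b a\<close>.\<close>
    define x'' where "x'' k = (if k < m then b \<odot>\<^bsub>Hom C B A\<^esub> x' k else a \<odot>\<^bsub>Hom C B A\<^esub> f k)" for k
    have x'': "x'' k \<in> Mor C B A" if "k < Suc m" for k
      using that x' b fg[OF m] unfolding x''_def by (auto simp: less_Suc_eq)
    have "(\<Oplus>\<^bsub>Hom SE A A\<^esub>k\<in>{..<Suc m}. Comp SE A B A (x k) (y k)) =
      Comp SE A B A (x m) (y m) \<oplus>\<^bsub>Hom SE A A\<^esub> (\<Oplus>\<^bsub>Hom SE A A\<^esub>k\<in>{..<m}. Comp SE A B A (x k) (y k))"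
      unfolding lessThan_Suc using xy m by (intro SH.finsum_insert) (auto intro!: SE.comp_closed[unfolded SE_simps])
    also have "Comp SE A B A (x m) (y m) = fr A A b (Comp C A B A (f m) (g m))"
      using fg[OF m] unfolding b_def by (simp add: SE_Comp_fr)
    also have "fr A A b (Comp C A B A (f m) (g m)) \<oplus>\<^bsub>Hom SE A A\<^esub> (\<Oplus>\<^bsub>Hom SE A A\<^esub>k\<in>{..<m}. Comp SE A B A (x k) (y k)) =
      fr A A (b \<otimes> a) (a \<odot>\<^bsub>Hom C A A\<^esub> Comp C A B A (f m) (g m) \<oplus>\<^bsub>Hom C A A\<^esub> b \<odot>\<^bsub>Hom C A A\<^esub> ?S)"
      unfolding IH using fg[OF m] b x' S by (simp add: SE_fr_add)
    also have "a \<odot>\<^bsub>Hom C A A\<^esub> Comp C A B A (f m) (g m) \<oplus>\<^bsub>Hom C A A\<^esub> b \<odot>\<^bsub>Hom C A A\<^esub> ?S =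
      (\<Oplus>\<^bsub>Hom C A A\<^esub>k\<in>{..<Suc m}. Comp C A B A (x'' k) (g k))"
    proof -
      have "(\<Oplus>\<^bsub>Hom C A A\<^esub>k\<in>{..<Suc m}. Comp C A B A (x'' k) (g k)) =
        Comp C A B A (x'' m) (g m) \<oplus>\<^bsub>Hom C A A\<^esub> (\<Oplus>\<^bsub>Hom C A A\<^esub>k\<in>{..<m}. Comp C A B A (x'' k) (g k))"
        unfolding lessThan_Suc using x'' fg m by (intro AA.M.finsum_insert) auto
      also have "Comp C A B A (x'' m) (g m) = a \<odot>\<^bsub>Hom C A A\<^esub> Comp C A B A (f m) (g m)"
        unfolding x''_def using fg[OF m] x' by (simp add: comp_smult_left)
      also have "(\<Oplus>\<^bsub>Hom C A A\<^esub>k\<in>{..<m}. Comp C A B A (x'' k) (g k)) = b \<odot>\<^bsub>Hom C A A\<^esub> ?S"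
      proof -
        have "b \<odot>\<^bsub>Hom C A A\<^esub> ?S = (\<Oplus>\<^bsub>Hom C A A\<^esub>k\<in>{..<m}. Comp C A B A (b \<odot>\<^bsub>Hom C B A\<^esub> x' k) (g k))"
          using b x' m by (intro scale) auto
        also have "\<dots> = (\<Oplus>\<^bsub>Hom C A A\<^esub>k\<in>{..<m}. Comp C A B A (x'' k) (g k))"
          using x' b fg m by (intro hom_finsum_cong) (auto simp: x''_def)
        finally show ?thesis ..
      qed
      finally show ?thesis ..
    qed
    finally show ?case using x'' b x' by (intro exI[of _ x''] bexI[of _ "b \<otimes> a"]) auto
  qed
  from this[OF order_refl] obtain x' a where x': "a \<in> T" "\<And>k. k < n \<Longrightarrow> x' k \<in> Mor C B A"
    and eq: "Ident SE A = fr A A a (\<Oplus>\<^bsub>Hom C A A\<^esub>k\<in>{..<n}. Comp C A B A (x' k) (g k))"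
    unfolding sum by blast
  let ?S = "\<Oplus>\<^bsub>Hom C A A\<^esub>k\<in>{..<n}. Comp C A B A (x' k) (g k)"
  have S: "?S \<in> Mor C A A" using x' fg by (intro hom_finsum_closed) auto
  have "fr A A a ?S = fr A A \<one> (Ident C A)" using eq by (simp add: SE_Ident)
  then have "\<exists>u\<in>T. (u \<otimes> \<one>) \<odot>\<^bsub>Hom C A A\<^esub> ?S = (u \<otimes> a) \<odot>\<^bsub>Hom C A A\<^esub> Ident C A"
    using x' S by (intro AA.frac_eqD) auto
  then obtain u where u: "u \<in> T" "u \<odot>\<^bsub>Hom C A A\<^esub> ?S = (u \<otimes> a) \<odot>\<^bsub>Hom C A A\<^esub> Ident C A" by auto
  have "(\<Oplus>\<^bsub>Hom C A A\<^esub>k\<in>{..<n}. Comp C A B A (u \<odot>\<^bsub>Hom C B A\<^esub> x' k) (g k)) = (u \<otimes> a) \<odot>\<^bsub>Hom C A A\<^esub> Ident C A"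
    unfolding u(2)[symmetric] using u x' by (intro scale[symmetric]) auto
  then show ?thesis using u x' fg
    by (intro exI[of _ "\<lambda>k. u \<odot>\<^bsub>Hom C B A\<^esub> x' k"] exI[of _ g] bexI[of _ "u \<otimes> a"]) auto
qed

end

section \<open>The genus\<close>

context hom_finite_over_dedekind begin

lemma localized_at_maximal: "maximalideal p R \<Longrightarrow> localized_category R (carrier R - p) C"
  using one_notin_maximalideal zero_in_maximalideal maximalideal_mult_notin
  by unfold_locales auto

lemma localized_at_zero: "localized_category R (carrier R - {\<zero>}) C"
  using integral_iff by unfold_locales auto

lemma isomorphic_local_iff:
  assumes p: "maximalideal p R" and o: "A \<in> Obj C" "B \<in> Obj C"
  shows "isomorphic_objs (local_category R C p) (local_object R C p A) (local_object R C p B) \<longleftrightarrow> (\<exists>f. iso_at p A B f)"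
proof -
  interpret L: localized_category R "carrier R - p" C by (rule localized_at_maximal[OF p])
  have "A \<in> Obj L.SE" "B \<in> Obj L.SE" using o by simp_all
  from preadditive_category.isomorphic_add_embed[OF L.scalar_extension_preadditive this]
  show ?thesis
    unfolding local_category_def local_object_def iso_at_def L.isomorphic_scalar_extension[OF o] by blast
qed

lemma genus_iff:
  assumes "A \<in> Obj C"
  shows "B \<in> genus R C A \<longleftrightarrow> B \<in> Obj C \<and> (\<forall>p. maximalideal p R \<longrightarrow> (\<exists>f. iso_at p B A f))"
  unfolding genus_def using isomorphic_local_iff assms by auto

lemma local_summand_split_at:
  assumes p: "maximalideal p R" and o: "A \<in> Obj C" "B \<in> Obj C"
    and "isomorphic_objs (local_category R C p) (local_object R C p A) D"
    and "direct_summand (local_category R C p) D (local_object R C p B)"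
  shows "\<exists>f. split_at p A B f"
proof -
  interpret L: localized_category R "carrier R - p" C by (rule localized_at_maximal[OF p])
  have o': "A \<in> Obj L.SE" "B \<in> Obj L.SE" using o by simp_all
  obtain F G where "F \<in> Mor L.SE A B" "G \<in> Mor L.SE B A" "Comp L.SE A B A G F = Ident L.SE A"
    using preadditive_category.add_embed_retract[OF L.scalar_extension_preadditive o'] assms(4,5)
    unfolding local_category_def local_object_def by blast
  from L.retract_scalar_extension[OF o this] show ?thesis unfolding split_at_def by blast
qed

text \<open>Over \<open>K\<close> the denominators are the nonzero elements of \<open>R\<close>;
  clearing them in a decomposition of the identity leaves the multiple \<open>d\<close>.\<close>

lemma rational_summand_sum:
  assumes o: "A \<in> Obj C" "B \<in> Obj C"
    and "rational_object R C A \<in> add_of_object (rational_category R C) (rational_object R C B)"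
  shows "\<exists>(n::nat) x y d. d \<in> carrier R \<and> d \<noteq> \<zero> \<and> (\<forall>k<n. x k \<in> Mor C B A \<and> y k \<in> Mor C A B) \<and>
    (\<Oplus>\<^bsub>Hom C A A\<^esub>k\<in>{..<n}. Comp C A B A (x k) (y k)) = d \<odot>\<^bsub>Hom C A A\<^esub> Ident C A"
proof -
  interpret L: localized_category R "carrier R - {\<zero>}" C by (rule localized_at_zero)
  have o': "A \<in> Obj L.SE" "B \<in> Obj L.SE" using o by simp_all
  obtain n x y where xy: "\<forall>k<n. x k \<in> Mor L.SE B A \<and> y k \<in> Mor L.SE A B"
    "(\<Oplus>\<^bsub>Hom L.SE A A\<^esub>k\<in>{..<n::nat}. Comp L.SE A B A (x k) (y k)) = Ident L.SE A"
    using preadditive_category.add_embed_sum[OF L.scalar_extension_preadditive o'] assms(3)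
    unfolding rational_category_def rational_object_def fraction_field_def by blast
  obtain x' y' d where "d \<in> carrier R - {\<zero>}" "\<forall>k<n. x' k \<in> Mor C B A \<and> y' k \<in> Mor C A B"
    "(\<Oplus>\<^bsub>Hom C A A\<^esub>k\<in>{..<n}. Comp C A B A (x' k) (y' k)) = d \<odot>\<^bsub>Hom C A A\<^esub> Ident C A"
    using L.sum_scalar_extension[OF o _ xy(2)] xy(1) by blast
  then show ?thesis by blast
qed

lemma roiter_exchange:
  fixes x y :: "nat \<Rightarrow> 'm"
  assumes fa: "fully_additive C" and o: "A \<in> Obj C" "B \<in> Obj C" "A' \<in> Obj C"
    and d: "d \<in> carrier R" "d \<noteq> \<zero>" and xy: "\<And>k. k < n \<Longrightarrow> x k \<in> Mor C B A \<and> y k \<in> Mor C A B"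
    and sum: "(\<Oplus>\<^bsub>Hom C A A\<^esub>k\<in>{..<n}. Comp C A B A (x k) (y k)) = d \<odot>\<^bsub>Hom C A A\<^esub> Ident C A"
    and gen: "\<And>p. maximalideal p R \<Longrightarrow> \<exists>f. iso_at p A A' f"
  shows "\<exists>B'\<in>Obj C. is_direct_sum C [A', B'] (dsum_obj C A B) \<and> (\<forall>p. maximalideal p R \<longrightarrow> (\<exists>k. iso_at p B' B k))"
proof -
  obtain h b where hb: "h \<in> Mor C A A'" "b \<in> Mor C B A'"
    "\<And>p. maximalideal p R \<Longrightarrow> \<exists>c\<in>Mor C A B. iso_at p A A' (h \<oplus>\<^bsub>Hom C A A'\<^esub> Comp C A B A' b c)"
    using roiter_map[OF o _ _ d sum gen] xy by blast
  show ?thesis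
    by (rule kernel_in_genus[OF fa o(1,3,2) hb is_direct_sum_dsum_obj[OF fa o(1,2)]])
qed

text \<open>A map split at one place gives a nonzero multiple of the identity as a single composite
  \<open>g f\<close>, so the sum has one term. This suits (3) and (4), where all objects are locally
  isomorphic.\<close>

lemma roiter_exchange_single:
  assumes fa: "fully_additive C" and o: "A \<in> Obj C" "B \<in> Obj C" "A' \<in> Obj C"
    and q: "maximalideal q R" and f: "split_at q A B f"
    and gen: "\<And>p. maximalideal p R \<Longrightarrow> \<exists>f. iso_at p A A' f"
  shows "\<exists>B'\<in>Obj C. is_direct_sum C [A', B'] (dsum_obj C A B) \<and> (\<forall>p. maximalideal p R \<longrightarrow> (\<exists>k. iso_at p B' B k))"
proof -
  obtain g s where s: "s \<in> carrier R" "s \<notin> q" and g: "f \<in> Mor C A B" "g \<in> Mor C B A"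
    "Comp C A B A g f = s \<odot>\<^bsub>Hom C A A\<^esub> Ident C A"
    using f unfolding split_at_def by blast
  have "s \<noteq> \<zero>" using s zero_in_maximalideal[OF q] by blast
  moreover interpret H: abelian_monoid "Hom C A A" using o hom_abelian_monoid by blast
  have "{..<1} = {0::nat}" by auto
  then have "(\<Oplus>\<^bsub>Hom C A A\<^esub>k\<in>{..<1::nat}. Comp C A B A g f) = s \<odot>\<^bsub>Hom C A A\<^esub> Ident C A"
    using g s o by simp
  ultimately show ?thesis
    using roiter_exchange[OF fa o s(1), of 1 "\<lambda>_. g" "\<lambda>_. f"] g gen by blast
qed

end

theorem theorem2p6:
  fixes R :: "('r, 'x) ring_scheme" and \<A> :: "('o, 'r, 'm) category" and A B :: 'o
  assumes "dedekind_domain R"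
    and "hom_finite_R_category R \<A>"
    and "fully_additive \<A>"
    and "A \<in> Obj \<A>" and "B \<in> Obj \<A>"
  shows
    "((\<forall>\<pp>. maximalideal \<pp> R \<longrightarrow>
         (\<exists>D. isomorphic_objs (local_category R \<A> \<pp>) (local_object R \<A> \<pp> A) D \<and>
              direct_summand (local_category R \<A> \<pp>) D (local_object R \<A> \<pp> B))) \<longrightarrow>
       (\<exists>A'\<in>genus R \<A> A. direct_summand \<A> A' B))
     \<and> (\<forall>A'\<in>genus R \<A> A.
         rational_object R \<A> A \<in> add_of_object (rational_category R \<A>) (rational_object R \<A> B) \<longrightarrow>
         (\<exists>B'\<in>genus R \<A> B. isomorphic_objs \<A> (dsum_obj \<A> A B) (dsum_obj \<A> A' B')))
     \<and> (\<forall>A'\<in>genus R \<A> A. direct_summand \<A> A' (dsum_obj \<A> A A))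
     \<and> (\<forall>A'\<in>genus R \<A> A. \<forall>A''\<in>genus R \<A> A.
         \<exists>A'''\<in>genus R \<A> A. isomorphic_objs \<A> (dsum_obj \<A> A' A'') (dsum_obj \<A> A A'''))"
proof -
  interpret hom_finite_over_dedekind R \<A>
    by (intro hom_finite_over_dedekind.intro linear_category.intro hom_finite_R_category.axioms(1) assms(1,2))
  note fa = assms(3) and A = assms(4) and B = assms(5)
  note genus = genus_iff[OF A] genus_iff[OF B]
  have genus_sym: "\<exists>f. iso_at p A A' f" if "A' \<in> genus R \<A> A" "maximalideal p R" for A' p
    using that iso_at_sym[of p A' A] A unfolding genus by blast
  obtain q where q: "maximalideal q R" using exists_maximalideal by blast
  show ?thesis
  proof (intro conjI impI ballI)
    assume "\<forall>\<pp>. maximalideal \<pp> R \<longrightarrow>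
         (\<exists>D. isomorphic_objs (local_category R \<A> \<pp>) (local_object R \<A> \<pp> A) D \<and>
              direct_summand (local_category R \<A> \<pp>) D (local_object R \<A> \<pp> B))"
    then have split: "\<exists>f. split_at p A B f" if "maximalideal p R" for p
      using that local_summand_split_at[OF that A B] by blast
    obtain A' where "A' \<in> Obj \<A>" "direct_summand \<A> A' B" "\<forall>p. maximalideal p R \<longrightarrow> (\<exists>k. iso_at p A' A k)"
      using local_summand[OF fa A B split] by blast
    then show "\<exists>A'\<in>genus R \<A> A. direct_summand \<A> A' B"
      unfolding Bex_def genus by blast
  next
    fix A' assume A': "A' \<in> genus R \<A> A"
      and add: "rational_object R \<A> A \<in> add_of_object (rational_category R \<A>) (rational_object R \<A> B)"
    have A'o: "A' \<in> Obj \<A>" using A' unfolding genus by blast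
    obtain n :: nat and x y d where d: "d \<in> carrier R" "d \<noteq> \<zero>\<^bsub>R\<^esub>"
      "\<And>k. k < n \<Longrightarrow> x k \<in> Mor \<A> B A \<and> y k \<in> Mor \<A> A B"
      "(\<Oplus>\<^bsub>Hom \<A> A A\<^esub>k\<in>{..<n}. Comp \<A> A B A (x k) (y k)) = d \<odot>\<^bsub>Hom \<A> A A\<^esub> Ident \<A> A"
      using rational_summand_sum[OF A B add] by blast
    obtain B' where B': "B' \<in> Obj \<A>" "is_direct_sum \<A> [A', B'] (dsum_obj \<A> A B)"
      "\<forall>p. maximalideal p R \<longrightarrow> (\<exists>k. iso_at p B' B k)"
      using roiter_exchange[OF fa A B A'o d genus_sym[OF A']] by blast
    then show "\<exists>B'\<in>genus R \<A> B. isomorphic_objs \<A> (dsum_obj \<A> A B) (dsum_obj \<A> A' B')"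
      using direct_sum_pair_unique[OF B'(2) is_direct_sum_dsum_obj[OF fa A'o B'(1)]]
      unfolding Bex_def genus by blast
  next
    fix A' assume A': "A' \<in> genus R \<A> A"
    have A'o: "A' \<in> Obj \<A>" using A' unfolding genus by blast
    have "split_at q A A (Ident \<A> A)"
      by (rule iso_at_imp_split_at[OF iso_at_ident[OF A one_notin_maximalideal[OF q]]])
    from roiter_exchange_single[OF fa A A A'o q this genus_sym[OF A']]
    show "direct_summand \<A> A' (dsum_obj \<A> A A)" unfolding direct_summand_def by blast
  next
    fix A' A'' assume A': "A' \<in> genus R \<A> A" and A'': "A'' \<in> genus R \<A> A"
    have o: "A' \<in> Obj \<A>" "A'' \<in> Obj \<A>" using A' A'' unfolding genus by blast+
    have loc: "\<exists>f. iso_at p A' A f" "\<exists>f. iso_at p A'' A f" if "maximalideal p R" for p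
      using A' A'' that unfolding genus by blast+
    \<comment> \<open>The exchange is applied to the pair \<open>A'\<close>, \<open>A''\<close> with
      \<open>A\<close> as the object brought in. The map from \<open>A'\<close> to
      \<open>A''\<close> that it requires at one \<open>q\<close> is obtained through
      \<open>A\<close>.\<close>
    obtain f where "split_at q A' A'' f"
      using loc(1)[OF q] genus_sym[OF A'' q] iso_at_comp[OF q o(1) A o(2)] iso_at_imp_split_at by blast
    from roiter_exchange_single[OF fa o A q this loc(1)]
    obtain D where D: "D \<in> Obj \<A>" "is_direct_sum \<A> [A, D] (dsum_obj \<A> A' A'')"
      "\<forall>p. maximalideal p R \<longrightarrow> (\<exists>k. iso_at p D A'' k)" by blast
    \<comment> \<open>The complement \<open>D\<close> is locally isomorphic to \<open>A''\<close>,
      hence to \<open>A\<close>.\<close>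
    have "\<exists>k. iso_at p D A k" if p: "maximalideal p R" for p
      using D(3) loc(2)[OF p] iso_at_comp[OF p D(1) o(2) A] p by blast
    then have "D \<in> genus R \<A> A" unfolding genus using D(1) by blast
    then show "\<exists>A'''\<in>genus R \<A> A. isomorphic_objs \<A> (dsum_obj \<A> A' A'') (dsum_obj \<A> A A''')"
      using direct_sum_pair_unique[OF D(2) is_direct_sum_dsum_obj[OF fa A D(1)]] by blast
  qed
qed

end
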